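(* Let $f$ be a weak G-type potential with measure $\mu_f$ and associated function $f^*:(0,1)\to\mathbb R$. Let $\{g_a\}_{a>0}$ be a family of functions such that: for each $a>0$, $g_a(z)$ is finite for all $z\in\mathbb R^d\setminus\{0\}$ and $g_a(z)=\int_0^\infty e^{-|z|^2t}\,d\mu_{g_a}(t)$ for some positive measure $\mu_{g_a}$ on $(0,\infty)$; $\lim_{a\to0^+}g_a(x)=1$ for all $x\in\mathbb R^d\setminus\{0\}$; and $\sum_{v\in\mathcal V}g_a(u+v)<\infty$ for all $u\in\mathbb R^d\setminus\mathcal V$ and $a>0$. Let $(x_j)_{j=1}^N\in(\mathbb R^d)^N$ be a non-degenerate configuration, i.e. $x_i-x_j\notin\mathcal V$ for all $i\ne j$. For $\alpha\in(0,1)$ let $\mu_{f,\alpha}$ be the restriction of $\mu_f$ to $[\alpha,\infty)$, $f_\alpha(z):=\int_0^\infty e^{-|z|^2t}\,d\mu_{f,\alpha}(t)$, and $u^*:=\frac12(v_1+\cdots+v_d)$. Define $$K_{f,2}^{\mathrm p}(x,y):=\limsup_{\alpha\to0^+}\limsup_{a\to0^+}\bigg(\sum_{v\in\mathcal V}\big(f_\alpha(x-y+v)+f^*(\alpha)\big)g_a(x-y+v)-f^*(\alpha)\sum_{v\in\mathcal V}g_a(u^*+v)-\int_0^1\frac{\pi^{d/2}}{t^{d/2}}\,d(\mu_{f,\alpha}*\mu_{g_a})(t)\bigg)$$ and $E_{f,2}^{\mathrm p}((x_j)_{j=1}^N;\{g_a\}_{a>0}):=\sum_{k\ne j}K_{f,2}^{\mathrm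 p}(x_k,x_j)$. Then the $\limsup$'s in the definition of $K_{f,2}^{\mathrm p}(x_k,x_j)$ ($k\neq j$) are both limits and $$E_{f,2}^{\mathrm p}\big((x_j)_{j=1}^N;\{g_a\}_{a>0}\big)=\sum_{k\ne j}K_f^{\mathrm p}(x_k,x_j).$$
   Context: Let $V$ be a real $d\times d$ matrix with linearly independent columns $v_1,\dots,v_d$ and $\det V=1$; $\mathcal V=\{Vk:k\in\mathbb Z^d\}$; $\mathcal V^*=\{w\in\mathbb R^d: w\cdot v\in\mathbb Z\ \forall v\in\mathcal V\}$. $*$ between measures is convolution of measures on $(0,\infty)$ (push-forward of the product under addition); $\int_a^b h\,d\mu$ means integration over $[a,b)$ (over $(0,b)$ if $a=0$ and $\mu$ is a measure on $(0,\infty)$). Weak G-type potential: a lower-semicontinuous $f:\mathbb R^d\to\mathbb R\cup\{\infty\}$ for which there are a function $f^*:(0,1)\to\mathbb R$ and a signed measure $\mu_f$ on $(0,\infty)$ with finite negative part such that (W1) for every $q\neq0$, $f(q)$ is finite and $f(q)=\lim_{\alpha\to0^+}\big(\int_\alpha^\infty e^{-|q|^2t}\,d\mu_f(t)+f^*(\alpha)\big)$, where $\int_\alpha^\infty e^{-|q|^2t}\,d\mu_f(t)<\infty$ for all $\alpha>0$; and (W2) if $w_0$ is an element of $\mathcal V^*\setminus\{0\}$ of minimal length, then $\int_0^1 t^{-d/2}e^{-\pi^2|w_0|^2/t}\,d\mu_f(t)<\infty$. The periodic kernel is $$K_f^{\mathrm p}(x,y)=\sum_{v\in\mathcal V}\int_1^\infty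 e^{-|x-y+v|^2t}\,d\mu_f(t)+\sum_{w\in\mathcal V^*\setminus\{0\}}e^{2\pi i w\cdot(x-y)}\int_0^1\frac{\pi^{d/2}}{t^{d/2}}e^{-\pi^2|w|^2/t}\,d\mu_f(t).$$ *)

theory Defs
  imports "HOL-Probability.Convolution"
begin

section \<open>The lattice and its dual\<close>

definition lattice_of :: "real^'n^'n \<Rightarrow> (real^'n) set" where
  "lattice_of V = {V *v k | k. \<forall>i. k $ i \<in> \<int>}"

definition dual_lattice :: "real^'n^'n \<Rightarrow> (real^'n) set" where
  "dual_lattice V = {w. \<forall>v\<in>lattice_of V. w \<bullet> v \<in> \<int>}"

definition ustar :: "real^'n^'n \<Rightarrow> real^'n" where
  "ustar V = (1/2) *\<^sub>R (\<Sum>i\<in>UNIV. column i V)"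


section \<open>Signed measures with finite negative part\<close>

text \<open>A measure on \<open>(0,\<infinity>)\<close> is a Borel measure on the real line that gives no mass to \<open>(-\<infinity>,0]\<close>.\<close>

definition measure_on_pos :: "real measure \<Rightarrow> bool" where
  "measure_on_pos M \<longleftrightarrow> sets M = sets borel \<and> emeasure M {..0} = 0"

text \<open>
  A signed measure \<open>\<mu>\<close> is represented by a pair (positive part, negative part). For the measure
  attached to a potential this pair is required to be its Jordan decomposition, that is, the two
  parts are mutually singular; the negative part is finite, whereas the positive part may have
  infinite total mass.
\<close>

type_synonym signed_measure = "real measure \<times> real measure"

abbreviation pos_part :: "signed_measure \<Rightarrow> real measure" where "pos_part \<equiv> fst"
abbreviation neg_part :: "signed_measure \<Rightarrow> real measure" where "neg_part \<equiv> snd"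

definition mutually_singular :: "real measure \<Rightarrow> real measure \<Rightarrow> bool" where
  "mutually_singular M N \<longleftrightarrow> (\<exists>S\<in>sets borel. emeasure M S = 0 \<and> emeasure N (- S) = 0)"

definition signed_measure_on_pos :: "signed_measure \<Rightarrow> bool" where
  "signed_measure_on_pos \<mu> \<longleftrightarrow>
     measure_on_pos (pos_part \<mu>) \<and> measure_on_pos (neg_part \<mu>) \<and>
     mutually_singular (pos_part \<mu>) (neg_part \<mu>) \<and> finite_measure (neg_part \<mu>)"

definition signed_integrable :: "signed_measure \<Rightarrow> real set \<Rightarrow> (real \<Rightarrow> real) \<Rightarrow> bool" where
  "signed_integrable \<mu> A h \<longleftrightarrow> set_integrable (pos_part \<mu>) A h \<and> set_integrable (neg_part \<mu>) A h"

definition signed_integral :: "signed_measure \<Rightarrow> real set \<Rightarrow> (real \<Rightarrow> real) \<Rightarrow> real" where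
  "signed_integral \<mu> A h =
     set_lebesgue_integral (pos_part \<mu>) A h - set_lebesgue_integral (neg_part \<mu>) A h"

definition restrict_from :: "real \<Rightarrow> signed_measure \<Rightarrow> signed_measure" where
  "restrict_from \<alpha> \<mu> =
     (density (pos_part \<mu>) (indicator {\<alpha>..}), density (neg_part \<mu>) (indicator {\<alpha>..}))"

text \<open>
  Convolution of a signed and a positive measure, by bilinearity. The two components of the result
  need not be mutually singular, and both may have infinite total mass.
\<close>

definition signed_convolution :: "signed_measure \<Rightarrow> real measure \<Rightarrow> signed_measure" where
  "signed_convolution \<mu> \<nu> = (convolution (pos_part \<mu>) \<nu>, convolution (neg_part \<mu>) \<nu>)"


section \<open>Weak G-type potentials\<close>

text \<open>
  All integrands below are nonnegative and bounded on the domain of integration, so they have a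
  finite integral against the (finite) negative part, and the condition
  \<open>\<integral> h d\<mu> < \<infinity>\<close> is integrability of \<open>h\<close>.
\<close>

definition lower_semicontinuous :: "('a::topological_space \<Rightarrow> ereal) \<Rightarrow> bool" where
  "lower_semicontinuous f \<longleftrightarrow> (\<forall>x. f x \<le> Liminf (at x) f)"

definition weak_G_type ::
  "real^'n^'n \<Rightarrow> (real^'n \<Rightarrow> ereal) \<Rightarrow> (real \<Rightarrow> real) \<Rightarrow> signed_measure \<Rightarrow> bool" where
  "weak_G_type V f fstar \<mu> \<longleftrightarrow>
     lower_semicontinuous f \<and> (\<forall>q. f q \<noteq> -\<infinity>) \<and> signed_measure_on_pos \<mu> \<and>
     (\<forall>q. q \<noteq> 0 \<longrightarrow>
        \<bar>f q\<bar> \<noteq> \<infinity> \<and>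
        (\<forall>\<alpha>>0. signed_integrable \<mu> {\<alpha>..} (\<lambda>t. exp (- (norm q)\<^sup>2 * t))) \<and>
        ((\<lambda>\<alpha>. ereal (signed_integral \<mu> {\<alpha>..} (\<lambda>t. exp (- (norm q)\<^sup>2 * t)) + fstar \<alpha>))
           \<longlongrightarrow> f q) (at_right 0)) \<and>
     (\<forall>w0\<in>dual_lattice V - {0}.
        (\<forall>w\<in>dual_lattice V - {0}. norm w0 \<le> norm w) \<longrightarrow>
        signed_integrable \<mu> {0<..<1}
          (\<lambda>t. t powr (- real CARD('n) / 2) * exp (- pi\<^sup>2 * (norm w0)\<^sup>2 / t)))"


section \<open>The periodic kernels\<close>

text \<open>
  The kernels are only used at points with \<open>x - y\<close> outside the lattice, where every series involved
  converges absolutely.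
\<close>

definition K_per :: "real^'n^'n \<Rightarrow> signed_measure \<Rightarrow> real^'n \<Rightarrow> real^'n \<Rightarrow> complex" where
  "K_per V \<mu> x y =
     of_real (\<Sum>\<^sub>\<infinity>v\<in>lattice_of V.
        signed_integral \<mu> {1..} (\<lambda>t. exp (- (norm (x - y + v))\<^sup>2 * t))) +
     (\<Sum>\<^sub>\<infinity>w\<in>dual_lattice V - {0}.
        exp (2 * of_real pi * \<i> * of_real (w \<bullet> (x - y))) *
        of_real (signed_integral \<mu> {0<..<1}
          (\<lambda>t. pi powr (real CARD('n) / 2) / t powr (real CARD('n) / 2)
                 * exp (- pi\<^sup>2 * (norm w)\<^sup>2 / t))))"

definition f_trunc :: "signed_measure \<Rightarrow> real \<Rightarrow> real^'n \<Rightarrow> real" where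
  "f_trunc \<mu> \<alpha> z = signed_integral (restrict_from \<alpha> \<mu>) {0<..} (\<lambda>t. exp (- (norm z)\<^sup>2 * t))"

text \<open>
  The expression under the two upper limits. The functions \<open>g a\<close> take values in \<open>[0,\<infinity>]\<close>, being
  infinite at most at the origin.
\<close>

definition K2_pre ::
  "real^'n^'n \<Rightarrow> signed_measure \<Rightarrow> (real \<Rightarrow> real) \<Rightarrow> (real \<Rightarrow> real^'n \<Rightarrow> ennreal) \<Rightarrow>
   (real \<Rightarrow> real measure) \<Rightarrow> real^'n \<Rightarrow> real^'n \<Rightarrow> real \<Rightarrow> real \<Rightarrow> real" where
  "K2_pre V \<mu> fstar g \<mu>g x y \<alpha> a =
     (\<Sum>\<^sub>\<infinity>v\<in>lattice_of V. (f_trunc \<mu> \<alpha> (x - y + v) + fstar \<alpha>) * enn2real (g a (x - y + v)))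
     - fstar \<alpha> * (\<Sum>\<^sub>\<infinity>v\<in>lattice_of V. enn2real (g a (ustar V + v)))
     - signed_integral (signed_convolution (restrict_from \<alpha> \<mu>) (\<mu>g a)) {0<..<1}
         (\<lambda>t. pi powr (real CARD('n) / 2) / t powr (real CARD('n) / 2))"

definition K2_inner ::
  "real^'n^'n \<Rightarrow> signed_measure \<Rightarrow> (real \<Rightarrow> real) \<Rightarrow> (real \<Rightarrow> real^'n \<Rightarrow> ennreal) \<Rightarrow>
   (real \<Rightarrow> real measure) \<Rightarrow> real^'n \<Rightarrow> real^'n \<Rightarrow> real \<Rightarrow> ereal" where
  "K2_inner V \<mu> fstar g \<mu>g x y \<alpha> =
     Limsup (at_right 0) (\<lambda>a. ereal (K2_pre V \<mu> fstar g \<mu>g x y \<alpha> a))"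

definition K2_per ::
  "real^'n^'n \<Rightarrow> signed_measure \<Rightarrow> (real \<Rightarrow> real) \<Rightarrow> (real \<Rightarrow> real^'n \<Rightarrow> ennreal) \<Rightarrow>
   (real \<Rightarrow> real measure) \<Rightarrow> real^'n \<Rightarrow> real^'n \<Rightarrow> ereal" where
  "K2_per V \<mu> fstar g \<mu>g x y = Limsup (at_right 0) (K2_inner V \<mu> fstar g \<mu>g x y)"

definition E2_per ::
  "real^'n^'n \<Rightarrow> signed_measure \<Rightarrow> (real \<Rightarrow> real) \<Rightarrow> (real \<Rightarrow> real^'n \<Rightarrow> ennreal) \<Rightarrow>
   (real \<Rightarrow> real measure) \<Rightarrow> nat \<Rightarrow> (nat \<Rightarrow> real^'n) \<Rightarrow> ereal" where
  "E2_per V \<mu> fstar g \<mu>g N x =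
     (\<Sum>k\<in>{1..N}. \<Sum>j\<in>{1..N} - {k}. K2_per V \<mu> fstar g \<mu>g (x k) (x j))"

end

theory Submission
  imports Defs "HOL-Probability.Probability"
begin

text \<open>
  Put \<open>u = x - y\<close>, \<open>\<theta>\<^sub>u(t) = \<Sum>\<^sub>v e\<^bsup>-t|u+v|\<^sup>2\<^esup>\<close> and \<open>h(t) = \<theta>\<^sub>u(t) - 1\<^bsub>t<1\<^esub> (\<pi>/t)\<^bsup>d/2\<^esup>\<close>. By Poisson summation
  \<open>\<theta>\<^sub>u(t) - (\<pi>/t)\<^bsup>d/2\<^esup>\<close> is the dual lattice sum without its zero term, so the kernel is
  \<open>\<integral> h d\<mu>\<^sub>f\<close>. A product of Laplace transforms is the Laplace transform of the convolution, hence
  the truncated expression with parameters \<open>\<alpha>\<close> and \<open>a\<close> is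
  \<open>\<integral>\<integral>\<^bsub>t\<ge>\<alpha>\<^esub> h(t + s) d\<mu>\<^sub>f(t) d\<mu>\<^bsub>g\<^sub>a\<^esub>(s) + f\<^sup>*(\<alpha>) \<integral> (\<theta>\<^sub>u - \<theta>\<^bsub>u*\<^esub>)(s) d\<mu>\<^bsub>g\<^sub>a\<^esub>(s)\<close>.
  The measures \<open>\<mu>\<^bsub>g\<^sub>a\<^esub>\<close> concentrate at \<open>0\<^sup>+\<close>, since their Laplace transforms tend to 1. As \<open>h\<close> is
  continuous from the right (this is why the split at 1 must use the intervals \<open>(0,1)\<close> and
  \<open>[1,\<infinity>)\<close>) and \<open>\<theta>\<^sub>u - \<theta>\<^bsub>u*\<^esub>\<close> vanishes at \<open>0\<^sup>+\<close>, the limit \<open>a \<rightarrow> 0\<close> is \<open>\<integral>\<^bsub>t\<ge>\<alpha>\<^esub> h d\<mu>\<^sub>f\<close>, and the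
  limit \<open>\<alpha> \<rightarrow> 0\<close> follows by dominated convergence.
\<close>

section \<open>Sums of integrals and the tiling by unit cubes\<close>

text \<open>The separate pieces do not converge: each \<open>g a\<close> tends to 1 pointwise, so
  its lattice sums blow up as a tends to 0. Their common singular part is the zero-frequency Poisson
  term (pi/t)^(d/2), which does not depend on the point. The background integral removes it from the
  convolution sum, and the comparison with \<open>ustar V\<close> removes it from the term with
  \<open>fstar\<close>. Three features shape the estimates. The measures behind \<open>g a\<close>
  may have infinite mass, so every test function is controlled by exp(-ct), with c > 0 below all
  |u+v|^2; the transforms at c and 2c alone then force concentration at 0. Condition (W2) concerns a
  shortest dual vector only; for t < 1 the other dual terms are bounded by that one times factors
  that are summable and free of t. Finally, everything is linear in the signed measure, so its two
  parts are treated as positive measures and only finite quantities are subtracted. Poisson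
  summation rests on uniqueness of Fourier coefficients: both sides are continuous periodic
  functions given by absolutely convergent series.\<close>

lemma has_sum_integral:
  fixes f :: "'i \<Rightarrow> 'a \<Rightarrow> 'b::{banach, second_countable_topology}"
  assumes I: "countable I"
    and int: "\<And>i. i \<in> I \<Longrightarrow> integrable M (f i)"
    and pt: "\<And>x. x \<in> space M \<Longrightarrow> (\<lambda>i. norm (f i x)) summable_on I"
    and L1: "(\<lambda>i. \<integral>x. norm (f i x) \<partial>M) summable_on I"
  shows "integrable M (\<lambda>x. \<Sum>\<^sub>\<infinity>i\<in>I. f i x)"
    and "((\<lambda>i. \<integral>x. f i x \<partial>M) has_sum (\<integral>x. (\<Sum>\<^sub>\<infinity>i\<in>I. f i x) \<partial>M)) I"
proof -
  have "integrable M (\<lambda>x. \<Sum>\<^sub>\<infinity>i\<in>I. f i x) \<and>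
    ((\<lambda>i. \<integral>x. f i x \<partial>M) has_sum (\<integral>x. (\<Sum>\<^sub>\<infinity>i\<in>I. f i x) \<partial>M)) I"
  proof (cases "finite I")
    case True
    then show ?thesis using int
      by (auto simp: has_sum_finite_iff)
  next
    case False
    \<comment> \<open>The enumeration turns unordered sums into series over the naturals. Absolute
      convergence, at every point and for the integrals, is what allows the way back to
      \<open>has_sum\<close>.\<close>
    define e where "e = from_nat_into I"
    have e: "bij_betw e UNIV I"
      unfolding e_def using I False by (rule bij_betw_from_nat_into)
    have eI: "e n \<in> I" for n using e by (auto simp: bij_betw_def)
    have s1: "summable (\<lambda>n. norm (f (e n) x))" if "x \<in> space M" for x
      using pt[OF that] summable_on_reindex_bij_betw[OF e, of "\<lambda>i. norm (f i x)"]
      by (simp add: summable_on_imp_summable)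
    have s2: "summable (\<lambda>n. \<integral>x. norm (f (e n) x) \<partial>M)"
      by (rule summable_on_imp_summable, rule summable_on_reindex_bij_betw[OF e, THEN iffD2, OF L1])
    have eq: "(\<Sum>\<^sub>\<infinity>i\<in>I. f i x) = (\<Sum>n. f (e n) x)" if "x \<in> space M" for x
    proof -
      have "((\<lambda>n. f (e n) x) has_sum (\<Sum>n. f (e n) x)) UNIV"
        by (rule norm_summable_imp_has_sum[OF s1[OF that] summable_sums[OF summable_norm_cancel[OF s1[OF that]]]])
      then have "((\<lambda>i. f i x) has_sum (\<Sum>n. f (e n) x)) I"
        by (simp only: has_sum_reindex_bij_betw[OF e, of "\<lambda>i. f i x"])
      then show ?thesis by (rule infsumI)
    qed
    have ae: "AE x in M. summable (\<lambda>n. norm (f (e n) x))" using s1 by auto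
    note sm = integrable_suminf[OF int[OF eI] ae s2] sums_integral[OF int[OF eI] ae s2]
    have "summable (\<lambda>n. norm (\<integral>x. f (e n) x \<partial>M))"
      by (rule summable_comparison_test'[OF s2, of 0]) simp
    then have "((\<lambda>n. \<integral>x. f (e n) x \<partial>M) has_sum (\<integral>x. (\<Sum>n. f (e n) x) \<partial>M)) UNIV"
      using sm(2) by (rule norm_summable_imp_has_sum)
    then have "((\<lambda>i. \<integral>x. f i x \<partial>M) has_sum (\<integral>x. (\<Sum>n. f (e n) x) \<partial>M)) I"
      by (simp add: has_sum_reindex_bij_betw[OF e, of "\<lambda>i. \<integral>x. f i x \<partial>M"])
    moreover have "(\<integral>x. (\<Sum>\<^sub>\<infinity>i\<in>I. f i x) \<partial>M) = (\<integral>x. (\<Sum>n. f (e n) x) \<partial>M)"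
      using eq by (intro Bochner_Integration.integral_cong) auto
    moreover have "integrable M (\<lambda>x. \<Sum>\<^sub>\<infinity>i\<in>I. f i x)"
      using sm(1) eq by (subst Bochner_Integration.integrable_cong[OF refl]) auto
    ultimately show ?thesis by simp
  qed
  then show "integrable M (\<lambda>x. \<Sum>\<^sub>\<infinity>i\<in>I. f i x)"
    "((\<lambda>i. \<integral>x. f i x \<partial>M) has_sum (\<integral>x. (\<Sum>\<^sub>\<infinity>i\<in>I. f i x) \<partial>M)) I"
    by auto
qed

lemma has_sum_single:
  fixes f :: "'i \<Rightarrow> 'b::{comm_monoid_add, topological_space}"
  assumes "a \<in> A" "\<And>i. i \<in> A \<Longrightarrow> i \<noteq> a \<Longrightarrow> f i = 0"
  shows "(f has_sum f a) A"
proof -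
  have "(f has_sum f a) A \<longleftrightarrow> (f has_sum f a) {a}"
    using assms by (intro has_sum_cong_neutral) auto
  then show ?thesis using has_sum_finite[of "{a}" f] by simp
qed

section \<open>The integer lattice and its fundamental cube\<close>

definition Zd :: "(real^'n) set" where
  "Zd = {k. \<forall>i. k $ i \<in> \<int>}"

definition unit_cube :: "(real^'n) set" where
  "unit_cube = {y. \<forall>i. 0 \<le> y $ i \<and> y $ i < 1}"

lemma Zd_simps [simp, intro]:
  "(0::real^'n) \<in> Zd"
  "k \<in> Zd \<Longrightarrow> l \<in> Zd \<Longrightarrow> k + l \<in> Zd"
  "k \<in> Zd \<Longrightarrow> l \<in> Zd \<Longrightarrow> k - l \<in> Zd"
  "k \<in> Zd \<Longrightarrow> - k \<in> Zd"
  "axis i 1 \<in> Zd"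
  by (auto simp: Zd_def axis_def)

lemma inner_Zd: "k \<in> Zd \<Longrightarrow> l \<in> Zd \<Longrightarrow> k \<bullet> l \<in> \<int>"
  by (auto simp: Zd_def inner_vec_def intro!: Ints_sum)

lemma countable_Zd: "countable (Zd :: (real^'n) set)"
proof -
  have "inj_on (\<lambda>k i. \<lfloor>k $ i\<rfloor>) (Zd :: (real^'n) set)"
    by (auto simp: inj_on_def Zd_def vec_eq_iff fun_eq_iff) (metis Ints_cases floor_of_int)
  then show ?thesis using countableI by (metis countable_image_inj_on countableI_type)
qed

definition vec_floor :: "real^'n \<Rightarrow> real^'n" where
  "vec_floor y = (\<chi> i. of_int \<lfloor>y $ i\<rfloor>)"

lemma vec_floor: "vec_floor y \<in> Zd" "y - vec_floor y \<in> unit_cube"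
  by (simp_all add: vec_floor_def Zd_def unit_cube_def) linarith

lemma vec_floor_unique:
  assumes "k \<in> Zd" "y - k \<in> unit_cube"
  shows "k = vec_floor y"
proof (rule vec_eq_iff[THEN iffD2], rule)
  fix i
  from assms obtain n where n: "k $ i = of_int n" by (auto simp: Zd_def elim: Ints_cases)
  have "0 \<le> y $ i - k $ i" "y $ i - k $ i < 1" using assms(2) by (auto simp: unit_cube_def)
  then have "\<lfloor>y $ i\<rfloor> = n" unfolding n by linarith
  then show "k $ i = vec_floor y $ i" by (simp add: vec_floor_def n)
qed

lemma unit_cube_borel [measurable]: "(unit_cube :: (real^'n) set) \<in> sets borel"
proof -
  have "unit_cube = (\<Inter>i. {y::real^'n. 0 \<le> y $ i} \<inter> {y. y $ i < 1})"
    by (auto simp: unit_cube_def)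
  also have "\<dots> \<in> sets borel"
    by (intro sets.countable_INT'') (auto intro!: sets.Int borel_closed borel_open closed_Collect_le open_Collect_less continuous_intros)
  finally show ?thesis .
qed

text \<open>The half-open cubes \<open>unit_cube + k\<close> partition the space, so at each point
  exactly one summand \<open>f k\<close> survives, the one with \<open>k = vec_floor y\<close>. This
  is the unfolding step for Poisson summation, and it also yields summability of the cube
  integrals.\<close>

lemma integral_tiling:
  fixes \<phi> :: "real^'n \<Rightarrow> 'b::{banach, second_countable_topology}"
  assumes int: "integrable lborel \<phi>"
  shows "((\<lambda>k. \<integral>y. indicator unit_cube y *\<^sub>R \<phi> (y + k) \<partial>lborel) has_sum (\<integral>y. \<phi> y \<partial>lborel)) Zd"
proof -
  define f where "f = (\<lambda>k y. indicator unit_cube (y - k) *\<^sub>R \<phi> y)"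
  have [measurable]: "\<phi> \<in> borel_measurable borel"
    using borel_measurable_integrable[OF int] by simp
  have [measurable]: "f k \<in> borel_measurable borel" for k
    unfolding f_def by measurable
  have fint: "integrable lborel (f k)" for k
    by (rule Bochner_Integration.integrable_bound[OF int]) (simp_all add: f_def indicator_def)
  have hs: "((\<lambda>k. f k y) has_sum \<phi> y) Zd" for y
  proof -
    have "((\<lambda>k. f k y) has_sum f (vec_floor y) y) Zd"
      by (rule has_sum_single) (auto simp: f_def indicator_def vec_floor dest: vec_floor_unique)
    then show ?thesis using vec_floor[of y] by (simp add: f_def)
  qed
  have ns: "((\<lambda>k. norm (f k y)) has_sum norm (\<phi> y)) Zd" for y
  proof -
    have "((\<lambda>k. norm (f k y)) has_sum norm (f (vec_floor y) y)) Zd"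
      by (rule has_sum_single) (auto simp: f_def indicator_def vec_floor dest: vec_floor_unique)
    then show ?thesis using vec_floor[of y] by (simp add: f_def)
  qed
  have "(\<lambda>k. \<integral>y. norm (f k y) \<partial>lborel) summable_on Zd"
  proof (rule nonneg_bdd_above_summable_on, simp, rule bdd_aboveI2)
    fix F :: "(real^'n) set" assume "F \<in> {F. F \<subseteq> Zd \<and> finite F}"
    then have F: "F \<subseteq> Zd" "finite F" by auto
    have "(\<Sum>k\<in>F. \<integral>y. norm (f k y) \<partial>lborel) = (\<integral>y. (\<Sum>k\<in>F. norm (f k y)) \<partial>lborel)"
      by (subst Bochner_Integration.integral_sum) (auto intro: fint)
    also have "\<dots> \<le> (\<integral>y. norm (\<phi> y) \<partial>lborel)"
    proof (rule integral_mono)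
      show "integrable lborel (\<lambda>y. \<Sum>k\<in>F. norm (f k y))"
        by (intro Bochner_Integration.integrable_sum integrable_norm fint)
      show "integrable lborel (\<lambda>y. norm (\<phi> y))" using int by simp
      show "(\<Sum>k\<in>F. norm (f k y)) \<le> norm (\<phi> y)" for y
        using has_sum_mono2[OF has_sum_finite[OF F(2)] ns[of y]] F(1) by auto
    qed
    finally show "(\<Sum>k\<in>F. \<integral>y. norm (f k y) \<partial>lborel) \<le> (\<integral>y. norm (\<phi> y) \<partial>lborel)" .
  qed
  note hsi = has_sum_integral(2)[OF countable_Zd fint has_sum_imp_summable[OF ns] this]
  have shift: "(\<integral>y. f k y \<partial>lborel) = (\<integral>y. indicator unit_cube y *\<^sub>R \<phi> (y + k) \<partial>lborel)" for k
  proof -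
    have shift: "(\<integral>y. f k y \<partial>lborel) = (\<integral>y. f k y \<partial>distr lborel borel ((+) k))"
      by (simp add: lborel_distr_plus)
    also have "\<dots> = (\<integral>y. f k (k + y) \<partial>lborel)"
      by (rule integral_distr) (auto simp: f_def)
    finally show ?thesis by (simp add: f_def add.commute)
  qed
  have "(\<lambda>y. \<Sum>\<^sub>\<infinity>k\<in>Zd. f k y) = \<phi>"
    using hs by (intro ext infsumI)
  with hsi have "((\<lambda>k. \<integral>y. f k y \<partial>lborel) has_sum (\<integral>y. \<phi> y \<partial>lborel)) Zd"
    by (simp only:)
  then show ?thesis
    by (simp only: shift)
qed

section \<open>Gaussian integrals and linear changes of variables\<close>

text \<open>Rescaling by \<open>c = sqrt (2 * t)\<close> turns the Gaussian into the standard normal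
  density, whose characteristic function is known; \<open>s\<close> is the frequency after the
  rescaling.\<close>

lemma gaussian_fourier_real:
  fixes t w :: real
  assumes t: "t > 0"
  shows "integrable lborel (\<lambda>x. of_real (exp (- (t * x\<^sup>2))) * cis (- (2 * pi * (w * x))))"
    and "(\<integral>x. of_real (exp (- (t * x\<^sup>2))) * cis (- (2 * pi * (w * x))) \<partial>lborel)
           = of_real (sqrt (pi / t) * exp (- (pi\<^sup>2 * w\<^sup>2 / t)))"
proof -
  define c where "c = sqrt (2 * t)"
  define s where "s = - (2 * pi * w) / c"
  have c: "c > 0" "c\<^sup>2 = 2 * t" using t by (auto simp: c_def)
  define f where "f x = std_normal_density x *\<^sub>R iexp (s * x)" for x
  have [measurable]: "f \<in> borel_measurable borel"
    unfolding f_def by measurable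
  have fint: "integrable lborel f"
    unfolding f_def
    by (rule Bochner_Integration.integrable_bound[OF integrable_normal_density[of 1 0]])
      (auto simp: norm_mult)
  have "complex_of_real (exp (- (s\<^sup>2) / 2)) = char std_normal_distribution s"
    by (simp add: char_std_normal_distribution)
  also have "\<dots> = (\<integral>x. f x \<partial>lborel)"
    unfolding char_def f_def by (subst integral_density) auto
  also have "\<dots> = c *\<^sub>R (\<integral>x. f (0 + c * x) \<partial>lborel)"
    using lborel_integral_real_affine[of c f 0] c by simp
  finally have 1: "complex_of_real (exp (- (s\<^sup>2) / 2)) = c *\<^sub>R (\<integral>x. f (0 + c * x) \<partial>lborel)" .
  have 2: "integrable lborel (\<lambda>x. f (0 + c * x))"
    using lborel_integrable_real_affine[OF fint, of c 0] c by simp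
  have eq: "of_real (exp (- (t * x\<^sup>2))) * cis (- (2 * pi * (w * x))) = of_real (sqrt (2 * pi)) * f (0 + c * x)" for x
  proof -
    have "s * (c * x) = - (2 * pi * (w * x))" using c(1) by (simp add: s_def)
    moreover have "(c * x)\<^sup>2 / 2 = t * x\<^sup>2" using c by (simp add: power_mult_distrib)
    ultimately show ?thesis
      by (simp add: f_def std_normal_density_def scaleR_conv_of_real cis_conv_exp)
  qed
  show "integrable lborel (\<lambda>x. of_real (exp (- (t * x\<^sup>2))) * cis (- (2 * pi * (w * x))))"
    unfolding eq using 2 by (intro integrable_mult_right) auto
  have "(\<integral>x. of_real (exp (- (t * x\<^sup>2))) * cis (- (2 * pi * (w * x))) \<partial>lborel)
    = of_real (sqrt (2 * pi)) * (\<integral>x. f (0 + c * x) \<partial>lborel)"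
    unfolding eq by (rule integral_mult_right_zero)
  also have "\<dots> = of_real (sqrt (2 * pi)) * (of_real (exp (- (s\<^sup>2) / 2)) / of_real c)"
    using 1 c by (simp add: scaleR_conv_of_real)
  also have "\<dots> = of_real (sqrt (2 * pi) / c * exp (- (s\<^sup>2) / 2))" by simp
  also have "sqrt (2 * pi) / c = sqrt (pi / t)"
    unfolding c_def by (simp add: real_sqrt_divide[symmetric])
  also have "- (s\<^sup>2) / 2 = - (pi\<^sup>2 * w\<^sup>2 / t)"
    using c t by (simp add: s_def power_divide power_mult_distrib)
  finally show "(\<integral>x. of_real (exp (- (t * x\<^sup>2))) * cis (- (2 * pi * (w * x))) \<partial>lborel)
           = of_real (sqrt (pi / t) * exp (- (pi\<^sup>2 * w\<^sup>2 / t)))" .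
qed

lemma cis_sum: "finite A \<Longrightarrow> cis (\<Sum>i\<in>A. f i) = (\<Prod>i\<in>A. cis (f i))"
  by (induction A rule: finite_induct) (auto simp: cis_mult[symmetric])

text \<open>Fubini in the form used twice below: for Gaussians on the whole space and for characters
  cut off to the unit cube, both of which factor over the coordinates.\<close>

lemma lborel_integral_prod:
  fixes h :: "'a::euclidean_space \<Rightarrow> real \<Rightarrow> complex"
  assumes hi: "\<And>b. b \<in> Basis \<Longrightarrow> integrable lborel (h b)"
    and [measurable]: "\<phi> \<in> borel_measurable borel"
    and prod: "\<And>z. \<phi> z = (\<Prod>b\<in>Basis. h b (z \<bullet> b))"
  shows "integrable lborel \<phi>"
    and "(\<integral>z. \<phi> z \<partial>lborel) = (\<Prod>b\<in>Basis. \<integral>x. h b x \<partial>lborel)"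
proof -
  let ?P = "\<Pi>\<^sub>M b\<in>(Basis::'a set). (lborel :: real measure)"
  let ?T = "\<lambda>f. \<Sum>b\<in>(Basis::'a set). f b *\<^sub>R b"
  interpret product_sigma_finite "\<lambda>b::'a. lborel :: real measure"
    by standard
  have [measurable]: "?T \<in> measurable ?P borel" by measurable
  have mT: "\<phi> (?T f) = (\<Prod>b\<in>Basis. h b (f b))" for f
    unfolding prod by (intro prod.cong refl) (simp add: inner_sum_left inner_Basis if_distrib cong: if_cong)
  have "integrable ?P (\<lambda>f. \<Prod>b\<in>Basis. h b (f b))"
    by (rule product_integrable_prod) (auto intro: hi)
  then show "integrable lborel \<phi>"
    by (subst lborel_eq, subst integrable_distr_eq) (auto simp: mT)
  have "(\<integral>z. \<phi> z \<partial>lborel) = (\<integral>f. \<phi> (?T f) \<partial>?P)"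
    by (subst lborel_eq, subst integral_distr) auto
  also have "\<dots> = (\<Prod>b\<in>Basis. \<integral>x. h b x \<partial>lborel)"
    unfolding mT by (rule product_integral_prod) (auto intro: hi)
  finally show "(\<integral>z. \<phi> z \<partial>lborel) = (\<Prod>b\<in>Basis. \<integral>x. h b x \<partial>lborel)" .
qed

lemma gaussian_fourier:
  fixes w :: "'a::euclidean_space"
  assumes t: "t > 0"
  shows "integrable lborel (\<lambda>z. of_real (exp (- (t * (norm z)\<^sup>2))) * cis (- (2 * pi * (w \<bullet> z))))"
      (is ?A)
    and "(\<integral>z. of_real (exp (- (t * (norm z)\<^sup>2))) * cis (- (2 * pi * (w \<bullet> z))) \<partial>lborel)
           = of_real ((pi / t) powr (real DIM('a) / 2) * exp (- (pi\<^sup>2 * (norm w)\<^sup>2 / t)))" (is ?B)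
proof -
  define h where "h = (\<lambda>b x. complex_of_real (exp (- (t * x\<^sup>2))) * cis (- (2 * pi * ((w \<bullet> b) * x))))"
  let ?m = "\<lambda>z. complex_of_real (exp (- (t * (norm z)\<^sup>2))) * cis (- (2 * pi * (w \<bullet> z)))"
  have nsq: "(norm z)\<^sup>2 = (\<Sum>b\<in>Basis. (z \<bullet> b)\<^sup>2)" for z :: 'a
    by (metis (no_types, lifting) euclidean_inner norm_eq_sqrt_inner inner_ge_zero real_sqrt_pow2 power2_eq_square sum.cong)
  have prod: "?m z = (\<Prod>b\<in>Basis. h b (z \<bullet> b))" for z :: 'a
  proof -
    have "(\<Prod>b\<in>Basis. h b (z \<bullet> b)) = of_real (exp (\<Sum>b\<in>Basis. - (t * (z \<bullet> b)\<^sup>2)))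
        * cis (\<Sum>b\<in>Basis. - (2 * pi * ((w \<bullet> b) * (z \<bullet> b))))"
      by (simp add: h_def prod.distrib exp_sum cis_sum)
    moreover have "(\<Sum>b\<in>Basis. - (t * (z \<bullet> b)\<^sup>2)) = - (t * (norm z)\<^sup>2)"
      by (simp add: nsq sum_negf sum_distrib_left)
    moreover have "(\<Sum>b\<in>Basis. - (2 * pi * ((w \<bullet> b) * (z \<bullet> b)))) = - (2 * pi * (w \<bullet> z))"
      by (subst euclidean_inner) (simp add: sum_negf sum_distrib_left)
    ultimately show ?thesis by simp
  qed
  have [measurable]: "?m \<in> borel_measurable borel"
    by (intro borel_measurable_continuous_onI continuous_intros)
  have hi: "integrable lborel (h b)" for b
    unfolding h_def by (rule gaussian_fourier_real[OF t])
  note p = lborel_integral_prod[OF hi _ prod]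
  show ?A by (rule p) measurable
  have "(\<integral>z. ?m z \<partial>lborel) = (\<Prod>b\<in>Basis. \<integral>x. h b x \<partial>lborel)"
    by (rule p) measurable
  also have "\<dots> = (\<Prod>b\<in>(Basis::'a set). complex_of_real (sqrt (pi / t) * exp (- (pi\<^sup>2 * (w \<bullet> b)\<^sup>2 / t))))"
    unfolding h_def by (simp only: gaussian_fourier_real[OF t])
  also have "\<dots> = of_real (\<Prod>b\<in>(Basis::'a set). sqrt (pi / t) * exp (- (pi\<^sup>2 * (w \<bullet> b)\<^sup>2 / t)))"
    by simp
  also have "(\<Prod>b\<in>(Basis::'a set). sqrt (pi / t) * exp (- (pi\<^sup>2 * (w \<bullet> b)\<^sup>2 / t)))
      = sqrt (pi / t) ^ DIM('a) * exp (\<Sum>b\<in>Basis. - (pi\<^sup>2 * (w \<bullet> b)\<^sup>2 / t))"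
    by (simp add: prod.distrib exp_sum)
  also have "(\<Sum>b\<in>Basis. - (pi\<^sup>2 * (w \<bullet> b)\<^sup>2 / t)) = - (pi\<^sup>2 * (norm w)\<^sup>2 / t)"
    by (simp add: nsq sum_negf sum_distrib_left sum_divide_distrib)
  also have "sqrt (pi / t) ^ DIM('a) = (pi / t) powr (real DIM('a) / 2)"
    using t by (simp add: powr_half_sqrt[symmetric] powr_powr powr_realpow[symmetric])
  finally show ?B .
qed

section \<open>Lebesgue measure under linear maps\<close>

lemma Basis_cart: "(Basis :: (real^'n) set) = range (\<lambda>i. axis i 1)"
  by (auto simp: Basis_vec_def)

lemma prod_Basis_cart:
  "(\<Prod>b\<in>(Basis :: (real^'n) set). f b) = (\<Prod>i\<in>UNIV. f (axis i 1))"
  unfolding Basis_cart by (subst prod.reindex) (auto simp: inj_on_def axis_eq_axis)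

lemma nn_integral_lborel_scale:
  fixes c :: "'n::finite \<Rightarrow> real" and h :: "real^'n \<Rightarrow> ennreal"
  assumes c: "\<And>i. c i \<noteq> 0" and [measurable]: "h \<in> borel_measurable borel"
  shows "(\<integral>\<^sup>+v. h v \<partial>lborel) = ennreal \<bar>\<Prod>i\<in>UNIV. c i\<bar> * (\<integral>\<^sup>+v. h (\<chi> i. c i * v $ i) \<partial>lborel)"
proof -
  define c' where "c' b = (\<chi> i. c i) \<bullet> b" for b :: "real^'n"
  have c'0: "c' b \<noteq> 0" if "b \<in> Basis" for b
    using that c by (auto simp: Basis_cart c'_def inner_axis)
  have T: "0 + (\<Sum>j\<in>Basis. (c' j * (v \<bullet> j)) *\<^sub>R j) = (\<chi> i. c i * v $ i)" for v
  proof (rule euclidean_eqI)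
    fix b :: "real^'n" assume b: "b \<in> Basis"
    then obtain i where i: "b = axis i 1" by (auto simp: Basis_cart)
    show "(0 + (\<Sum>j\<in>Basis. (c' j * (v \<bullet> j)) *\<^sub>R j)) \<bullet> b = (\<chi> i. c i * v $ i) \<bullet> b"
      using b by (simp add: inner_sum_left_Basis) (simp add: i c'_def inner_axis)
  qed
  have [measurable]: "(\<lambda>v::real^'n. \<chi> i. c i * v $ i) \<in> borel_measurable borel"
    by (intro borel_measurable_continuous_onI continuous_intros)
  have "(\<Prod>j\<in>(Basis :: (real^'n) set). \<bar>c' j\<bar>) = \<bar>\<Prod>i\<in>UNIV. c i\<bar>"
    by (simp add: prod_Basis_cart c'_def inner_axis abs_prod)
  then have "lborel = density (distr lborel borel (\<lambda>v::real^'n. \<chi> i. c i * v $ i)) (\<lambda>_. ennreal \<bar>\<Prod>i\<in>UNIV. c i\<bar>)"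
    using lborel_affine_euclidean[of c' 0, OF c'0] unfolding T by simp
  then have "(\<integral>\<^sup>+v. h v \<partial>lborel) = (\<integral>\<^sup>+v. h v
      \<partial>density (distr lborel borel (\<lambda>v::real^'n. \<chi> i. c i * v $ i)) (\<lambda>_. ennreal \<bar>\<Prod>i\<in>UNIV. c i\<bar>))"
    by simp
  also have "\<dots> = ennreal \<bar>\<Prod>i\<in>UNIV. c i\<bar> * (\<integral>\<^sup>+v. h (\<chi> i. c i * v $ i) \<partial>lborel)"
    by (subst nn_integral_density) (auto simp: nn_integral_distr nn_integral_cmult)
  finally show ?thesis .
qed

lemma lborel_distr_transpose:
  fixes m n :: "'n::finite"
  shows "distr lborel borel (\<lambda>v::real^'n. \<chi> i. v $ Transposition.transpose m n i) = lborel"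
    (is "distr _ _ ?h = _")
proof (rule lborel_eqI[symmetric])
  have [measurable]: "?h \<in> borel_measurable borel"
    by (intro borel_measurable_continuous_onI continuous_intros)
  fix l u :: "real^'n"
  assume le: "\<And>b. b \<in> Basis \<Longrightarrow> l \<bullet> b \<le> u \<bullet> b"
  have lu: "l $ i \<le> u $ i" for i
    using le[of "axis i 1"] by (simp add: inner_axis)
  have "?h -` box l u = box (?h l) (?h u)"
    by (auto simp: mem_box_cart) (metis transpose_involutory)+
  then have "emeasure (distr lborel borel ?h) (box l u) = emeasure lborel (box (?h l) (?h u))"
    by (subst emeasure_distr) auto
  also have "\<dots> = (\<Prod>b\<in>Basis. (?h u - ?h l) \<bullet> b)"
    by (rule emeasure_lborel_box) (auto simp: Basis_cart inner_axis lu)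
  also have "(\<Prod>b\<in>Basis. (?h u - ?h l) \<bullet> b) = (\<Prod>i\<in>UNIV. ((u - l) $ i))"
    unfolding prod_Basis_cart
    using prod.permute[OF permutes_swap_id[of m UNIV n], of "\<lambda>i. (u - l) $ i"] by (simp add: inner_axis o_def)
  finally show "emeasure (distr lborel borel ?h) (box l u) = (\<Prod>b\<in>Basis. (u - l) \<bullet> b)"
    by (simp add: prod_Basis_cart inner_axis)
qed simp

text \<open>Integrating over coordinate \<open>m\<close> first, with the others fixed, makes the
  shear a translation by the fixed value of coordinate \<open>n\<close>, and one-dimensional
  Lebesgue measure is translation invariant.\<close>

lemma nn_integral_lborel_shear:
  fixes m n :: "'n::finite" and h :: "real^'n \<Rightarrow> ennreal"
  assumes mn: "m \<noteq> n" and [measurable]: "h \<in> borel_measurable borel"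
  shows "(\<integral>\<^sup>+v. h (\<chi> i. if i = m then v $ m + v $ n else v $ i) \<partial>lborel) = (\<integral>\<^sup>+v. h v \<partial>lborel)"
proof -
  let ?s = "\<lambda>v::real^'n. \<chi> i. if i = m then v $ m + v $ n else v $ i"
  let ?B = "Basis :: (real^'n) set"
  let ?T = "\<lambda>f. \<Sum>b\<in>?B. f b *\<^sub>R b"
  interpret product_sigma_finite "\<lambda>b::real^'n. lborel :: real measure"
    by standard
  define a b where "a = (axis m 1 :: real^'n)" and "b = (axis n 1 :: real^'n)"
  have ab: "a \<in> ?B" "b \<in> ?B" "a \<noteq> b"
    using mn by (auto simp: a_def b_def axis_eq_axis)
  have B: "?B = insert a (?B - {a})" using ab by auto
  have [measurable]: "?s \<in> borel_measurable borel"
  proof (intro borel_measurable_continuous_onI continuous_on_vec_lambda)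
    show "continuous_on UNIV (\<lambda>v::real^'n. if i = m then v $ m + v $ n else v $ i)" for i
      by (cases "i = m") (auto intro!: continuous_intros)
  qed
  have Tn: "?T f $ i = f (axis i 1)" for f i
  proof -
    have "?T f $ i = ?T f \<bullet> axis i 1" by (simp add: inner_axis)
    also have "\<dots> = f (axis i 1)" by (subst inner_sum_left_Basis) auto
    finally show ?thesis .
  qed
  have sT: "?s (?T f) = ?T (f(a := f a + f b))" for f
    unfolding vec_eq_iff vec_lambda_beta Tn by (auto simp: a_def b_def axis_eq_axis)
  have meas[measurable]: "?T \<in> borel_measurable (\<Pi>\<^sub>M b\<in>?B. lborel)" by measurable
  have meas': "?T \<in> borel_measurable (\<Pi>\<^sub>M b\<in>insert a (?B - {a}). lborel)" using meas B by simp
  have red: "(\<integral>\<^sup>+v. H v \<partial>lborel) =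
      (\<integral>\<^sup>+x. (\<integral>\<^sup>+y. H (?T (x(a := y))) \<partial>lborel) \<partial>(\<Pi>\<^sub>M b\<in>?B - {a}. lborel))"
    if [measurable]: "H \<in> borel_measurable borel" for H :: "real^'n \<Rightarrow> ennreal"
  proof -
    have "(\<integral>\<^sup>+v. H v \<partial>lborel) = (\<integral>\<^sup>+f. H (?T f) \<partial>(\<Pi>\<^sub>M b\<in>?B. lborel))"
      by (subst lborel_eq, subst nn_integral_distr) auto
    also have "\<dots> = (\<integral>\<^sup>+f. H (?T f) \<partial>(\<Pi>\<^sub>M b\<in>insert a (?B - {a}). lborel))"
      using B by simp
    also have "\<dots> = (\<integral>\<^sup>+x. (\<integral>\<^sup>+y. H (?T (x(a := y))) \<partial>lborel) \<partial>(\<Pi>\<^sub>M b\<in>?B - {a}. lborel))"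
      by (rule product_nn_integral_insert) (auto intro!: measurable_compose[OF meas'])
    finally show ?thesis .
  qed
  have "(\<integral>\<^sup>+v. h (?s v) \<partial>lborel) =
      (\<integral>\<^sup>+x. (\<integral>\<^sup>+y. h (?T (x(a := x b + y))) \<partial>lborel) \<partial>(\<Pi>\<^sub>M b\<in>?B - {a}. lborel))"
  proof (subst red)
    show "(\<lambda>v. h (?s v)) \<in> borel_measurable borel" by measurable
    have "(x(a := y))(a := (x(a := y)) a + (x(a := y)) b) = x(a := x b + y)" for x :: "real^'n \<Rightarrow> real" and y
      using ab(3) by (auto simp: fun_eq_iff add.commute)
    then show "(\<integral>\<^sup>+x. (\<integral>\<^sup>+y. h (?s (?T (x(a := y)))) \<partial>lborel) \<partial>(\<Pi>\<^sub>M b\<in>?B - {a}. lborel)) =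
      (\<integral>\<^sup>+x. (\<integral>\<^sup>+y. h (?T (x(a := x b + y))) \<partial>lborel) \<partial>(\<Pi>\<^sub>M b\<in>?B - {a}. lborel))"
      by (simp only: sT)
  qed
  also have "\<dots> = (\<integral>\<^sup>+x. (\<integral>\<^sup>+y. h (?T (x(a := y))) \<partial>lborel) \<partial>(\<Pi>\<^sub>M b\<in>?B - {a}. lborel))"
  proof (rule nn_integral_cong)
    fix x
    have e: "?T (x(a := y)) = y *\<^sub>R a + (\<Sum>b\<in>?B - {a}. x b *\<^sub>R b)" for y
      by (subst sum.remove[OF _ ab(1)]) auto
    have [measurable]: "(\<lambda>y. h (?T (x(a := y)))) \<in> borel_measurable borel"
      unfolding e by measurable
    have "(\<integral>\<^sup>+y. h (?T (x(a := y))) \<partial>lborel) = (\<integral>\<^sup>+y. h (?T (x(a := y))) \<partial>distr lborel borel ((+) (x b)))"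
      by (simp add: lborel_distr_plus)
    also have "\<dots> = (\<integral>\<^sup>+y. h (?T (x(a := x b + y))) \<partial>lborel)"
      by (rule nn_integral_distr) auto
    finally show "(\<integral>\<^sup>+y. h (?T (x(a := x b + y))) \<partial>lborel) = (\<integral>\<^sup>+y. h (?T (x(a := y))) \<partial>lborel)"
      by simp
  qed
  also have "\<dots> = (\<integral>\<^sup>+v. h v \<partial>lborel)"
    by (rule red[symmetric]) simp
  finally show ?thesis .
qed

text \<open>Every linear map is a composition of diagonal maps, coordinate swaps, shears and maps
  with a vanishing row, and both sides are multiplicative under composition. Nonnegative integrals
  avoid any integrability question along the way.\<close>

lemma nn_integral_lborel_linear:
  fixes f :: "real^'n \<Rightarrow> real^'n" and h :: "real^'n \<Rightarrow> ennreal"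
  assumes "linear f" "det (matrix f) \<noteq> 0" "h \<in> borel_measurable borel"
  shows "(\<integral>\<^sup>+v. h v \<partial>lborel) = ennreal \<bar>det (matrix f)\<bar> * (\<integral>\<^sup>+v. h (f v) \<partial>lborel)"
proof -
  \<comment> \<open>The condition on the determinant sits inside \<open>P\<close>: a singular factor
    satisfies \<open>P\<close> vacuously, and a composition with nonzero determinant has no singular
    factor.\<close>
  define P where "P f \<longleftrightarrow> (det (matrix f) \<noteq> 0 \<longrightarrow> (\<forall>h\<in>borel_measurable borel.
    (\<integral>\<^sup>+v. h v \<partial>lborel) = ennreal \<bar>det (matrix f)\<bar> * (\<integral>\<^sup>+v. h (f v) \<partial>lborel)))"
    for f :: "real^'n \<Rightarrow> real^'n"
  have "P f"
  proof (rule induct_linear_elementary[OF \<open>linear f\<close>])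
    fix f g :: "real^'n \<Rightarrow> real^'n"
    assume lin: "linear f" "linear g" and P: "P f" "P g"
    have d: "det (matrix (f \<circ> g)) = det (matrix f) * det (matrix g)"
      using lin by (simp add: matrix_compose det_mul)
    have [measurable]: "f \<in> borel_measurable borel"
      using lin(1) by (intro borel_measurable_continuous_onI linear_continuous_on) (simp add: linear_conv_bounded_linear)
    show "P (f \<circ> g)"
      unfolding P_def
    proof (intro impI ballI)
      fix h :: "real^'n \<Rightarrow> ennreal" assume [measurable]: "h \<in> borel_measurable borel"
      assume "det (matrix (f \<circ> g)) \<noteq> 0"
      then have nz: "det (matrix f) \<noteq> 0" "det (matrix g) \<noteq> 0" using d by auto
      have "(\<integral>\<^sup>+v. h v \<partial>lborel) = ennreal \<bar>det (matrix f)\<bar> * (\<integral>\<^sup>+v. h (f v) \<partial>lborel)"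
        by (rule P(1)[unfolded P_def, rule_format, OF nz(1)]) measurable
      also have "(\<integral>\<^sup>+v. h (f v) \<partial>lborel) = ennreal \<bar>det (matrix g)\<bar> * (\<integral>\<^sup>+v. h (f (g v)) \<partial>lborel)"
        by (rule P(2)[unfolded P_def, rule_format, OF nz(2)]) measurable
      finally show "(\<integral>\<^sup>+v. h v \<partial>lborel) = ennreal \<bar>det (matrix (f \<circ> g))\<bar> * (\<integral>\<^sup>+v. h ((f \<circ> g) v) \<partial>lborel)"
        by (simp add: d abs_mult ennreal_mult mult.assoc)
    qed
  next
    fix f :: "real^'n \<Rightarrow> real^'n" and i
    assume "linear f" "\<And>x. f x $ i = 0"
    then have "row i (matrix f) = 0" by (simp add: row_def matrix_def vec_eq_iff)
    then show "P f" by (simp add: P_def det_zero_row)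
  next
    fix c :: "'n \<Rightarrow> real"
    let ?s = "\<lambda>x::real^'n. \<chi> i. c i * x $ i"
    have "det (matrix ?s) = (\<Prod>i\<in>UNIV. matrix ?s $ i $ i)"
      by (rule det_diagonal) (simp add: matrix_def axis_def)
    then have "det (matrix ?s) = (\<Prod>i\<in>UNIV. c i)"
      by (simp add: matrix_def axis_def)
    note det = this
    show "P ?s"
      unfolding P_def det
    proof (intro impI ballI)
      fix h :: "real^'n \<Rightarrow> ennreal" assume h: "h \<in> borel_measurable borel"
      assume "(\<Prod>i\<in>UNIV. c i) \<noteq> 0"
      then have "c i \<noteq> 0" for i by auto
      then show "(\<integral>\<^sup>+v. h v \<partial>lborel) = ennreal \<bar>\<Prod>i\<in>UNIV. c i\<bar> * (\<integral>\<^sup>+v. h (?s v) \<partial>lborel)"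
        using h by (rule nn_integral_lborel_scale)
    qed
  next
    fix m n :: 'n assume "m \<noteq> n"
    let ?s = "\<lambda>x::real^'n. \<chi> i. x $ Transposition.transpose m n i"
    have [measurable]: "?s \<in> borel_measurable borel"
      by (intro borel_measurable_continuous_onI continuous_intros)
    have "matrix ?s = (\<chi> i. mat 1 $ Transposition.transpose m n i)"
      by (auto simp: matrix_def axis_def mat_def vec_eq_iff)
    then have "det (matrix ?s) = of_int (sign (Transposition.transpose m n)) * det (mat 1 :: real^'n^'n)"
      by (simp only: det_permute_rows[OF permutes_swap_id] UNIV_I)
    then have "\<bar>det (matrix ?s)\<bar> = 1" by (simp add: sign_swap_id)
    moreover have "(\<integral>\<^sup>+v. h (?s v) \<partial>lborel) = (\<integral>\<^sup>+v. h v \<partial>lborel)"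
      if [measurable]: "h \<in> borel_measurable borel" for h :: "real^'n \<Rightarrow> ennreal"
      by (subst (2) lborel_distr_transpose[of m n, symmetric], subst nn_integral_distr) auto
    ultimately show "P ?s" by (simp add: P_def)
  next
    fix m n :: 'n assume mn: "m \<noteq> n"
    let ?s = "\<lambda>x::real^'n. \<chi> i. if i = m then x $ m + x $ n else x $ i"
    have "matrix ?s = (\<chi> k. if k = m then row m (mat 1) + 1 *s row n (mat 1) else row k (mat 1))"
      by (auto simp: matrix_def axis_def mat_def row_def vec_eq_iff)
    then have "det (matrix ?s) = 1"
      by (simp only: det_row_operation[OF mn] det_I)
    then show "P ?s" using nn_integral_lborel_shear[OF mn] by (simp add: P_def)
  qed
  then show ?thesis using assms(2,3) unfolding P_def by blast
qed

lemma lborel_distr_linear: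
  fixes V :: "real^'n^'n"
  assumes V: "det V = 1"
  shows "distr lborel borel ((*v) V) = lborel"
proof (rule measure_eqI)
  have [measurable]: "(*v) V \<in> borel_measurable borel"
    by (intro borel_measurable_continuous_onI matrix_vector_mult_linear_continuous_on)
  fix A assume "A \<in> sets (distr lborel borel ((*v) V))"
  then have [measurable]: "A \<in> sets borel" by simp
  have "emeasure lborel A = (\<integral>\<^sup>+v. indicator A v \<partial>lborel)" by simp
  also have "\<dots> = (\<integral>\<^sup>+v. indicator A (V *v v) \<partial>lborel)"
    using nn_integral_lborel_linear[of "(*v) V" "indicator A"] V by simp
  also have "\<dots> = (\<integral>\<^sup>+v. indicator A v \<partial>distr lborel borel ((*v) V))"
    by (subst nn_integral_distr) auto
  finally show "emeasure (distr lborel borel ((*v) V)) A = emeasure lborel A" by simp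
qed simp

text \<open>Substituting z = Vy turns the frequency w into its coordinates m, since w . Vy = m . y.
  As V preserves volume, no Jacobian factor appears; this is where the normalisation of the lattice
  enters Poisson summation.\<close>

lemma gaussian_fourier_linear:
  fixes V :: "real^'n^'n"
  assumes V: "det V = 1" and t: "t > 0" and m: "transpose V *v w = m"
  shows "integrable lborel (\<lambda>y. of_real (exp (- (t * (norm (V *v y))\<^sup>2))) * cis (- (2 * pi * (m \<bullet> y))))"
    and "(\<integral>y. of_real (exp (- (t * (norm (V *v y))\<^sup>2))) * cis (- (2 * pi * (m \<bullet> y))) \<partial>lborel)
           = of_real ((pi / t) powr (real CARD('n) / 2) * exp (- (pi\<^sup>2 * (norm w)\<^sup>2 / t)))"
proof -
  let ?m = "\<lambda>z. complex_of_real (exp (- (t * (norm z)\<^sup>2))) * cis (- (2 * pi * (w \<bullet> z)))"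
  have eq: "of_real (exp (- (t * (norm (V *v y))\<^sup>2))) * cis (- (2 * pi * (m \<bullet> y))) = ?m (V *v y)" for y
    unfolding m[symmetric] by (simp add: dot_lmul_matrix[symmetric])
  have [measurable]: "(*v) V \<in> measurable lborel borel"
    using borel_measurable_continuous_onI[OF matrix_vector_mult_linear_continuous_on, of V] by simp
  have [measurable]: "?m \<in> borel_measurable borel"
    by (intro borel_measurable_continuous_onI continuous_intros)
  show "integrable lborel (\<lambda>y. of_real (exp (- (t * (norm (V *v y))\<^sup>2))) * cis (- (2 * pi * (m \<bullet> y))))"
    unfolding eq using gaussian_fourier(1)[OF t, of w]
    by (subst (asm) lborel_distr_linear[OF V, symmetric], subst (asm) integrable_distr_eq) auto
  have "(\<integral>y. ?m (V *v y) \<partial>lborel) = (\<integral>z. ?m z \<partial>lborel)"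
    by (subst (2) lborel_distr_linear[OF V, symmetric], subst integral_distr) auto
  then show "(\<integral>y. of_real (exp (- (t * (norm (V *v y))\<^sup>2))) * cis (- (2 * pi * (m \<bullet> y))) \<partial>lborel)
           = of_real ((pi / t) powr (real CARD('n) / 2) * exp (- (pi\<^sup>2 * (norm w)\<^sup>2 / t)))"
    unfolding eq using gaussian_fourier(2)[OF t, of w] by simp
qed

section \<open>Uniqueness of Fourier coefficients on the torus\<close>

lemma unit_cube_bounds: "box 0 1 \<subseteq> (unit_cube :: (real^'n) set)" "(unit_cube :: (real^'n) set) \<subseteq> cbox 0 1"
  by (force simp: unit_cube_def mem_box_cart intro: less_imp_le)+

lemma emeasure_unit_cube_finite: "emeasure lborel (unit_cube :: (real^'n) set) < \<infinity>"
proof -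
  have "emeasure lborel (unit_cube :: (real^'n) set) \<le> emeasure lborel (cbox 0 (1 :: real^'n))"
    using unit_cube_bounds(2) by (rule emeasure_mono) simp
  also have "\<dots> < \<infinity>" by (rule emeasure_lborel_cbox_finite)
  finally show ?thesis .
qed

lemma integrable_indicator_unit_cube [simp]: "integrable lborel (indicator unit_cube :: real^'n \<Rightarrow> real)"
  using emeasure_unit_cube_finite by (intro integrable_real_indicator) auto

lemma integrable_unit_cube:
  fixes f :: "real^'n \<Rightarrow> 'b::{banach, second_countable_topology}"
  assumes [measurable]: "f \<in> borel_measurable borel" and B: "\<And>y. norm (f y) \<le> B"
  shows "integrable lborel (\<lambda>y. indicator unit_cube y *\<^sub>R f y)"
proof (rule Bochner_Integration.integrable_bound)
  show "integrable lborel (\<lambda>y. indicator unit_cube y *\<^sub>R B)"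
    by simp
  show "AE y in lborel. norm (indicator unit_cube y *\<^sub>R f y) \<le> norm (indicator unit_cube y *\<^sub>R B)"
    using B by (auto simp: indicator_def intro!: AE_I2 order_trans[OF B abs_ge_self])
qed measurable

text \<open>Orthogonality to all characters is bundled with boundedness and measurability, so that
  the class is stable under sums, scalars and multiplication by characters, hence under
  multiplication by polynomials in the characters.\<close>

definition zero_fourier :: "(real^'n \<Rightarrow> complex) \<Rightarrow> bool" where
  "zero_fourier K \<longleftrightarrow> K \<in> borel_measurable borel \<and> (\<exists>B. \<forall>y. norm (K y) \<le> B) \<and>
     (\<forall>m\<in>Zd. (\<integral>y. indicator unit_cube y *\<^sub>R (K y * cis (- (2 * pi * (m \<bullet> y)))) \<partial>lborel) = 0)"

lemma cis_measurable [measurable (raw)]: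
  "f \<in> borel_measurable M \<Longrightarrow> (\<lambda>x. cis (f x)) \<in> borel_measurable M"
  by (rule measurable_compose[of f M borel])
    (auto intro!: borel_measurable_continuous_onI continuous_intros)

lemma zero_fourier_integrable:
  assumes "zero_fourier K"
  shows "integrable lborel (\<lambda>y. indicator unit_cube y *\<^sub>R (K y * cis (- (2 * pi * (m \<bullet> y)))))"
proof -
  obtain B where B: "\<And>y. norm (K y) \<le> B" and [measurable]: "K \<in> borel_measurable borel"
    using assms by (auto simp: zero_fourier_def)
  show ?thesis
    by (rule integrable_unit_cube[of _ B]) (measurable, simp add: norm_mult B)
qed

lemma zero_fourier_add:
  assumes "zero_fourier K" "zero_fourier L"
  shows "zero_fourier (\<lambda>y. K y + L y)"
proof -
  obtain B C where B: "\<And>y. norm (K y) \<le> B" "\<And>y. norm (L y) \<le> C"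
    and [measurable]: "K \<in> borel_measurable borel" "L \<in> borel_measurable borel"
    using assms by (auto simp: zero_fourier_def)
  have "norm (K y + L y) \<le> B + C" for y
    using B by (intro order_trans[OF norm_triangle_ineq] add_mono)
  then show ?thesis
    using assms zero_fourier_integrable[OF assms(1)] zero_fourier_integrable[OF assms(2)]
    unfolding zero_fourier_def by (auto simp: distrib_right scaleR_add_right)
qed

lemma zero_fourier_cmult:
  assumes "zero_fourier K"
  shows "zero_fourier (\<lambda>y. K y * c)"
proof -
  obtain B where B: "\<And>y. norm (K y) \<le> B" and [measurable]: "K \<in> borel_measurable borel"
    using assms by (auto simp: zero_fourier_def)
  have "norm (K y * c) \<le> B * norm c" for y
    using B by (auto simp: norm_mult intro: mult_right_mono)
  moreover have "(\<integral>y. indicator unit_cube y *\<^sub>R (K y * c * cis (- (2 * pi * (m \<bullet> y)))) \<partial>lborel) = 0"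
    if "m \<in> Zd" for m
  proof -
    have "(\<integral>y. indicator unit_cube y *\<^sub>R (K y * c * cis (- (2 * pi * (m \<bullet> y)))) \<partial>lborel)
      = (\<integral>y. indicator unit_cube y *\<^sub>R (K y * cis (- (2 * pi * (m \<bullet> y)))) * c \<partial>lborel)"
      by (intro Bochner_Integration.integral_cong) (auto simp: mult_ac)
    also have "\<dots> = (\<integral>y. indicator unit_cube y *\<^sub>R (K y * cis (- (2 * pi * (m \<bullet> y)))) \<partial>lborel) * c"
      by (rule integral_mult_left_zero)
    also have "\<dots> = 0" using assms that by (simp add: zero_fourier_def)
    finally show ?thesis .
  qed
  ultimately show ?thesis unfolding zero_fourier_def by auto
qed

lemma zero_fourier_shift:
  assumes K: "zero_fourier K" and l: "l \<in> Zd"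
  shows "zero_fourier (\<lambda>y. K y * cis (2 * pi * (l \<bullet> y)))"
proof -
  have eq: "K y * cis (2 * pi * (l \<bullet> y)) * cis (- (2 * pi * (m \<bullet> y))) = K y * cis (- (2 * pi * ((m - l) \<bullet> y)))" for m y
    by (simp add: mult.assoc cis_mult algebra_simps inner_diff_left)
  have [measurable]: "K \<in> borel_measurable borel" using K by (simp add: zero_fourier_def)
  show ?thesis
    using K l unfolding zero_fourier_def eq by (auto simp: norm_mult)
qed

lemma zero_fourier_sum:
  assumes "finite I" "\<And>i. i \<in> I \<Longrightarrow> zero_fourier (K i)"
  shows "zero_fourier (\<lambda>y. \<Sum>i\<in>I. K i y)"
  using assms
proof (induction I rule: finite_induct)
  case empty
  then show ?case by (auto simp: zero_fourier_def)
next
  case (insert i I)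
  then show ?case by (simp add: zero_fourier_add)
qed

text \<open>Realises the torus as a compact subset of a Euclidean space, where Stone--Weierstrass
  speaks about ordinary polynomials; the real coordinates are cosines and sines.\<close>

definition torus_map :: "real^'n \<Rightarrow> complex^'n" where
  "torus_map y = (\<chi> i. cis (2 * pi * y $ i))"

text \<open>Induction over the polynomial with \<open>K\<close> arbitrary: in the case of a product
  the first factor is absorbed into \<open>K\<close> before the second one is applied.\<close>

lemma zero_fourier_poly:
  fixes p :: "complex^'n \<Rightarrow> real"
  assumes "real_polynomial_function p" "zero_fourier K"
  shows "zero_fourier (\<lambda>y. K y * of_real (p (torus_map y)))"
  using assms
proof (induction arbitrary: K rule: real_polynomial_function.induct)
  case (linear f)
  interpret f: bounded_linear f by fact
  have 1: "zero_fourier (\<lambda>y. K y * of_real (torus_map y \<bullet> b))" if "b \<in> Basis" for b :: "complex^'n"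
  proof -
    have "\<exists>i. b = axis i 1 \<or> b = axis i \<i>"
      using that by (auto simp: Basis_vec_def Basis_complex_def)
    then obtain i where i: "b = axis i 1 \<or> b = axis i \<i>" ..
    define e where "e = (axis i 1 :: real^'n)"
    have e: "e \<in> Zd" "- e \<in> Zd" "y \<bullet> e = y $ i" "e \<bullet> y = y $ i" for y
      by (auto simp: e_def inner_axis inner_axis')
    \<comment> \<open>\<open>A\<close> is \<open>K\<close> times the cosine and \<open>B\<close> is
      \<open>K\<close> times the sine of the i-th angle, each written through the two characters
      with frequencies \<open>e\<close> and \<open>- e\<close>.\<close>
    have A: "zero_fourier (\<lambda>y. (K y * cis (2 * pi * (e \<bullet> y)) + K y * cis (2 * pi * ((- e) \<bullet> y))) * (1/2))"
      by (intro zero_fourier_cmult zero_fourier_add zero_fourier_shift linear e)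
    have B: "zero_fourier (\<lambda>y. (K y * cis (2 * pi * (e \<bullet> y)) * (1 / (2 * \<i>))
        + K y * cis (2 * pi * ((- e) \<bullet> y)) * (- 1 / (2 * \<i>))))"
      by (intro zero_fourier_cmult zero_fourier_add zero_fourier_shift linear e)
    from i show ?thesis
    proof
      assume b: "b = axis i 1"
      have "of_real (torus_map y \<bullet> b) = (cis (2 * pi * (e \<bullet> y)) + cis (2 * pi * ((- e) \<bullet> y))) * (1/2)" for y
        by (simp add: b inner_axis torus_map_def e(4) complex_eq_iff)
      then have "K y * of_real (torus_map y \<bullet> b)
        = (K y * cis (2 * pi * (e \<bullet> y)) + K y * cis (2 * pi * ((- e) \<bullet> y))) * (1/2)" for y
        by (simp add: algebra_simps)
      with A show ?thesis by (simp only:)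
    next
      assume b: "b = axis i \<i>"
      have "of_real (torus_map y \<bullet> b) = cis (2 * pi * (e \<bullet> y)) * (1 / (2 * \<i>))
          + cis (2 * pi * ((- e) \<bullet> y)) * (- 1 / (2 * \<i>))" for y
        by (simp add: b inner_axis torus_map_def e(4) complex_eq_iff Re_divide Im_divide)
      then have "K y * of_real (torus_map y \<bullet> b)
        = (K y * cis (2 * pi * (e \<bullet> y)) * (1 / (2 * \<i>)) + K y * cis (2 * pi * ((- e) \<bullet> y)) * (- 1 / (2 * \<i>)))" for y
        by (simp only: distrib_left mult.assoc)
      with B show ?thesis by (simp only:)
    qed
  qed
  have "f z = (\<Sum>b\<in>Basis. (z \<bullet> b) * f b)" for z
  proof -
    have "f z = f (\<Sum>b\<in>Basis. (z \<bullet> b) *\<^sub>R b)" by (simp add: euclidean_representation)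
    also have "\<dots> = (\<Sum>b\<in>Basis. (z \<bullet> b) * f b)" by (simp only: f.sum f.scaleR real_scaleR_def)
    finally show ?thesis .
  qed
  from this[of "torus_map _"]
  have "K y * of_real (f (torus_map y)) = (\<Sum>b\<in>Basis. K y * of_real (torus_map y \<bullet> b) * of_real (f b))" for y
    by (simp only: of_real_sum of_real_mult sum_distrib_left mult.assoc)
  moreover have "zero_fourier (\<lambda>y. \<Sum>b\<in>Basis. K y * of_real (torus_map y \<bullet> b) * of_real (f b))"
    by (intro zero_fourier_sum zero_fourier_cmult 1) auto
  ultimately show ?case by simp
next
  case (const c)
  then show ?case by (rule zero_fourier_cmult)
next
  case (add f g)
  then show ?case by (simp add: distrib_left zero_fourier_add)
next
  case (mult f g)
  from mult.IH(2)[OF mult.IH(1)[OF mult.prems]] show ?case by (simp add: mult.assoc)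
qed

lemma torus_map_eq_iff: "torus_map y = torus_map z \<longleftrightarrow> y - z \<in> Zd"
proof -
  have "cis (2 * pi * a) = cis (2 * pi * b) \<longleftrightarrow> a - b \<in> \<int>" for a b
  proof -
    have "cis (2 * pi * a) = cis (2 * pi * b) \<longleftrightarrow> (\<exists>n::int. 2 * pi * a = 2 * pi * b + 2 * pi * n)"
      by (simp only: cis_conv_exp exp_eq) (simp add: complex_eq_iff algebra_simps)
    also have "\<dots> \<longleftrightarrow> (\<exists>n::int. a = b + n)"
    proof -
      have "2 * pi * a = 2 * pi * b + 2 * pi * n \<longleftrightarrow> a = b + n" for n :: real
      proof -
        have "2 * pi * a = 2 * pi * b + 2 * pi * n \<longleftrightarrow> 2 * pi * a = 2 * pi * (b + n)" by (simp add: algebra_simps)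
        also have "\<dots> \<longleftrightarrow> a = b + n" by (subst mult_cancel_left) simp
        finally show ?thesis .
      qed
      then show ?thesis by simp
    qed
    also have "\<dots> \<longleftrightarrow> a - b \<in> \<int>" by (auto simp: Ints_def algebra_simps image_iff)
    finally show ?thesis .
  qed
  then show ?thesis by (auto simp: torus_map_def vec_eq_iff Zd_def)
qed

lemma continuous_torus_map [continuous_intros]: "continuous_on S torus_map"
  unfolding torus_map_def by (intro continuous_intros)

text \<open>By Stone--Weierstrass the conjugate of \<open>H\<close> is uniformly approximated by polynomials in the
  characters, to which \<open>H\<close> is orthogonal; hence \<open>H\<close> is orthogonal to itself.\<close>

theorem fourier_coefficients_zero_imp_zero:
  fixes H :: "real^'n \<Rightarrow> complex"
  assumes cont: "continuous_on UNIV H"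
    and per: "\<And>y k. k \<in> Zd \<Longrightarrow> H (y + k) = H y"
    and coeff: "\<And>m. m \<in> Zd \<Longrightarrow> (\<integral>y. indicator unit_cube y *\<^sub>R (H y * cis (- (2 * pi * (m \<bullet> y)))) \<partial>lborel) = 0"
  shows "H y = 0"
proof -
  have red: "\<exists>q\<in>cbox 0 1. \<exists>k\<in>Zd. y = q + k" for y :: "real^'n"
    using vec_floor[of y] unit_cube_bounds(2) by (intro bexI[of _ "y - vec_floor y"] bexI[of _ "vec_floor y"]) auto
  have cC: "continuous_on (cbox 0 1) H" using cont continuous_on_subset by blast
  have "bounded (H ` cbox 0 1)"
    by (intro compact_imp_bounded compact_continuous_image cC compact_cbox)
  then obtain B where B': "\<And>y. y \<in> cbox 0 1 \<Longrightarrow> norm (H y) \<le> B"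
    by (auto simp: bounded_iff)
  have B: "norm (H y) \<le> B" for y
    using red[of y] B' per by auto
  have Hm [measurable]: "H \<in> borel_measurable borel"
    using cont by (rule borel_measurable_continuous_onI)
  have zH: "zero_fourier H"
    unfolding zero_fourier_def using B coeff by auto
  define T where "T = torus_map ` (cbox 0 1 :: (real^'n) set)"
  have "compact T"
    unfolding T_def by (intro compact_continuous_image continuous_intros compact_cbox)
  \<comment> \<open>The conjugate of \<open>H\<close> transported to the torus. The choice of a
    preimage in the closed cube is harmless, because two preimages differ by an integer vector and
    \<open>H\<close> is periodic.\<close>
  define G where "G z = cnj (H (inv_into (cbox 0 1) torus_map z))" for z
  have G: "G (torus_map y) = cnj (H y)" if "y \<in> cbox 0 1" for y
  proof -
    let ?y = "inv_into (cbox 0 1) torus_map (torus_map y)"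
    have "torus_map ?y = torus_map y" using that by (intro f_inv_into_f) auto
    then have "?y - y \<in> Zd" by (simp add: torus_map_eq_iff)
    from per[OF this, of y] show ?thesis by (simp add: G_def)
  qed
  \<comment> \<open>Quotient argument: the preimage under \<open>G\<close> of a closed set is the
    \<open>torus_map\<close>-image of a compact part of the cube, hence compact and closed.\<close>
  have "continuous_on T G"
    unfolding continuous_on_closed
  proof (intro allI impI)
    fix S assume "closedin (top_of_set (G ` T)) S"
    then obtain S' where S': "closed S'" "S = G ` T \<inter> S'" by (auto simp: closedin_closed)
    have "T \<inter> G -` S = torus_map ` (cbox 0 1 \<inter> (\<lambda>y. cnj (H y)) -` S')"
      unfolding T_def S'(2) by (auto simp: G)
    moreover have "compact (cbox 0 1 \<inter> (\<lambda>y. cnj (H y)) -` S')"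
      by (intro compact_Int_closed compact_cbox continuous_closed_vimage S')
        (use cont in \<open>auto simp: continuous_on_eq_continuous_at intro!: continuous_intros\<close>)
    ultimately have "compact (T \<inter> G -` S)"
      by (auto intro!: compact_continuous_image continuous_intros)
    then have "closed (T \<inter> G -` S)" by (rule compact_imp_closed)
    then show "closedin (top_of_set T) (T \<inter> G -` S)"
      by (rule closed_subset[rotated]) auto
  qed
  have small: "norm (\<integral>y. indicator unit_cube y *\<^sub>R (H y * cnj (H y)) \<partial>lborel) \<le> e * (B * measure lborel (unit_cube :: (real^'n) set))"
    if e: "e > 0" for e
  proof -
    obtain p where p: "polynomial_function p" "\<And>z. z \<in> T \<Longrightarrow> norm (G z - p z) < e"
      using Stone_Weierstrass_polynomial_function[OF \<open>compact T\<close> \<open>continuous_on T G\<close> e] by blast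
    have rp: "real_polynomial_function (\<lambda>z. Re (p z))" "real_polynomial_function (\<lambda>z. Im (p z))"
      using p(1) bounded_linear_Re bounded_linear_Im by (auto simp: polynomial_function_def o_def)
    have zp: "zero_fourier (\<lambda>y. H y * of_real (Re (p (torus_map y))) + H y * of_real (Im (p (torus_map y))) * \<i>)"
      by (intro zero_fourier_add zero_fourier_cmult zero_fourier_poly[OF rp(1)] zero_fourier_poly[OF rp(2)] zH)
    moreover have "H y * of_real (Re (p (torus_map y))) + H y * of_real (Im (p (torus_map y))) * \<i> = H y * p (torus_map y)" for y
      by (simp add: complex_eq_iff algebra_simps)
    ultimately have zp: "zero_fourier (\<lambda>y. H y * p (torus_map y))" by simp
    have i0: "(\<integral>y. indicator unit_cube y *\<^sub>R (H y * p (torus_map y)) \<partial>lborel) = 0"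
      using zp Zd_simps(1) unfolding zero_fourier_def by force
    have int0: "integrable lborel (\<lambda>y. indicator unit_cube y *\<^sub>R (H y * p (torus_map y)))"
      using zero_fourier_integrable[OF zp, of 0] by simp
    have int1: "integrable lborel (\<lambda>y. indicator unit_cube y *\<^sub>R (H y * cnj (H y)))"
    proof (rule integrable_unit_cube[of _ "B * B"])
      show "(\<lambda>y. H y * cnj (H y)) \<in> borel_measurable borel"
        by (intro borel_measurable_continuous_onI continuous_intros cont)
      show "norm (H y * cnj (H y)) \<le> B * B" for y
        using B[of y] by (simp add: norm_mult mult_mono')
    qed
    have "(\<integral>y. indicator unit_cube y *\<^sub>R (H y * cnj (H y)) \<partial>lborel) =
       (\<integral>y. indicator unit_cube y *\<^sub>R (H y * cnj (H y)) - indicator unit_cube y *\<^sub>R (H y * p (torus_map y)) \<partial>lborel)"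
      using int0 int1 by (simp add: i0)
    also have "norm \<dots> \<le> (\<integral>y. indicator (unit_cube :: (real^'n) set) y *\<^sub>R (B * e) \<partial>lborel)"
    proof (rule Bochner_Integration.integral_norm_bound_integral)
      show "integrable lborel (\<lambda>y::real^'n. indicator unit_cube y *\<^sub>R (B * e))"
        by simp
      fix y :: "real^'n"
      show "norm (indicator unit_cube y *\<^sub>R (H y * cnj (H y)) - indicator unit_cube y *\<^sub>R (H y * p (torus_map y))) \<le> indicator unit_cube y *\<^sub>R (B * e)"
      proof (cases "y \<in> unit_cube")
        case True
        then have y: "y \<in> cbox 0 1" using unit_cube_bounds(2) by auto
        have "norm (H y * (G (torus_map y) - p (torus_map y))) \<le> B * e"
          unfolding norm_mult using p(2)[of "torus_map y"] y B[of y]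
          by (intro mult_mono) (auto simp: T_def intro: order_trans[OF norm_ge_zero])
        then show ?thesis using True y by (simp add: G algebra_simps)
      qed auto
    qed (use int0 int1 in auto)
    also have "\<dots> = e * (B * measure lborel (unit_cube :: (real^'n) set))"
      using emeasure_unit_cube_finite by simp
    finally show ?thesis .
  qed
  have sq: "indicator unit_cube y *\<^sub>R (H y * cnj (H y)) = complex_of_real (indicator unit_cube y * (norm (H y))\<^sup>2)" for y
    using complex_norm_square[of "H y"] by (auto simp: indicator_def)
  have eq_0: "n = 0" if "n \<ge> 0" "c \<ge> 0" "\<And>e. e > 0 \<Longrightarrow> n \<le> e * c" for n c :: real
  proof (rule ccontr)
    assume "n \<noteq> 0"
    with that have n: "n > 0" by simp
    have "n \<le> n / (2 * (c + 1)) * c" using n that(2) by (intro that(3)) simp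
    also have "\<dots> = n * (c / (2 * (c + 1)))" by simp
    also have "\<dots> < n * 1" using that(2) by (intro mult_strict_left_mono n) (simp add: field_simps)
    finally show False by simp
  qed
  have "norm (\<integral>y. indicator unit_cube y *\<^sub>R (H y * cnj (H y)) \<partial>lborel) = 0"
    by (rule eq_0[OF _ _ small]) (use order_trans[OF norm_ge_zero B] in auto)
  then have "(\<integral>y. indicator unit_cube y * (norm (H y))\<^sup>2 \<partial>lborel) = 0"
    unfolding sq integral_complex_of_real by simp
  moreover have "integrable lborel (\<lambda>y. indicator unit_cube y * (norm (H y))\<^sup>2)"
    using integrable_unit_cube[of "\<lambda>y. (norm (H y))\<^sup>2" "B\<^sup>2"] B by (simp add: power_mono)
  ultimately have "AE y in lborel. indicator unit_cube y * (norm (H y))\<^sup>2 = 0"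
    by (subst (asm) integral_nonneg_eq_0_iff_AE) auto
  then have ae: "AE y in lborel. y \<in> unit_cube \<longrightarrow> H y = 0"
    by eventually_elim (auto simp: indicator_def split: if_splits)
  \<comment> \<open>By continuity the set where \<open>H\<close> does not vanish is open in the open
    cube; being null, it is empty. The boundary follows by closure and the remaining points by
    periodicity.\<close>
  define U where "U = {y. H y \<noteq> 0} \<inter> box 0 (1 :: real^'n)"
  have "open U"
    unfolding U_def by (intro open_Int open_box open_Collect_neq cont continuous_intros)
  have "AE y in lborel. y \<notin> U"
    using ae by eventually_elim (use unit_cube_bounds in \<open>auto simp: U_def\<close>)
  then have "U \<in> null_sets lborel"
    using \<open>open U\<close> by (simp add: AE_iff_null_sets)
  then have "negligible U" by (simp add: negligible_iff_null_sets null_sets_completionI)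
  then have "U = {}" using \<open>open U\<close> open_not_negligible by blast
  then have "\<And>y. y \<in> box 0 1 \<Longrightarrow> H y = 0" by (auto simp: U_def)
  moreover have "box 0 (1 :: real^'n) \<noteq> {}" by (simp add: interval_ne_empty_cart)
  then have "closure (box 0 (1 :: real^'n)) = cbox 0 1" by (rule closure_box)
  ultimately have "H y = 0" if "y \<in> cbox 0 1" for y
    using continuous_constant_on_closure[of "box 0 1" H 0 y] cC that by auto
  then show ?thesis using red[of y] per by auto
qed

section \<open>Poisson summation for Gaussians\<close>

lemma integral_cis_unit:
  fixes n :: real
  assumes n: "n \<in> \<int>"
  shows "integrable lborel (\<lambda>x. indicator {0..<1::real} x *\<^sub>R cis (2 * pi * (n * x)))"
    and "(\<integral>x. indicator {0..<1::real} x *\<^sub>R cis (2 * pi * (n * x)) \<partial>lborel) = (if n = 0 then 1 else 0)"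
proof -
  have "integrable lborel (indicator {0..<1::real} :: real \<Rightarrow> real)"
    by (intro integrable_real_indicator) auto
  then show "integrable lborel (\<lambda>x. indicator {0..<1::real} x *\<^sub>R cis (2 * pi * (n * x)))"
    by (rule Bochner_Integration.integrable_bound) (auto simp: indicator_def)
  have "(\<integral>x. indicator {0..<1::real} x *\<^sub>R cis (2 * pi * (n * x)) \<partial>lborel)
    = (\<integral>x. indicator {0..1::real} x *\<^sub>R cis (2 * pi * (n * x)) \<partial>lborel)"
    using AE_lborel_singleton[of "1::real"]
    by (intro integral_cong_AE) (auto simp: indicator_def elim!: eventually_mono)
  also have "\<dots> = (if n = 0 then 1 else 0)"
  proof (cases "n = 0")
    case False
    define F where "F x = cis (2 * pi * (n * x)) / (\<i> * (2 * pi * n))" for x :: real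
    have "(F has_vector_derivative cis (2 * pi * (n * x))) (at x within S)" for x S
      unfolding F_def cis_conv_exp using False
      by (auto intro!: derivative_eq_intros has_vector_derivative_real_field simp: field_simps)
    then have "(\<integral>x. indicator {0..1::real} x *\<^sub>R cis (2 * pi * (n * x)) \<partial>lborel) = F 1 - F 0"
      by (intro integral_FTC_Icc) (auto intro!: continuous_intros)
    also have "\<dots> = 0"
      using n cis_multiple_2pi[of n] by (simp add: F_def)
    finally show ?thesis using False by simp
  qed simp
  finally show "(\<integral>x. indicator {0..<1::real} x *\<^sub>R cis (2 * pi * (n * x)) \<partial>lborel) = (if n = 0 then 1 else 0)" .
qed

lemma integral_character_unit_cube:
  assumes m: "m \<in> (Zd :: (real^'n) set)"
  shows "(\<integral>y. indicator unit_cube y *\<^sub>R cis (2 * pi * (m \<bullet> y)) \<partial>lborel) = (if m = 0 then 1 else 0)"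
proof -
  define h where "h = (\<lambda>b x. indicator {0..<1::real} x *\<^sub>R cis (2 * pi * ((m \<bullet> b) * x)))"
  have mb: "m \<bullet> b \<in> \<int>" if "b \<in> Basis" for b
    using that m by (auto simp: Basis_cart inner_axis Zd_def)
  have ind: "indicator unit_cube y = (\<Prod>b\<in>Basis. indicator {0..<1::real} (y \<bullet> b) :: real)" for y :: "real^'n"
    unfolding prod_Basis_cart by (auto simp: inner_axis indicator_def unit_cube_def)
  have "indicator unit_cube y *\<^sub>R cis (2 * pi * (m \<bullet> y)) = (\<Prod>b\<in>Basis. h b (y \<bullet> b))" for y
  proof -
    have "(\<Prod>b\<in>Basis. h b (y \<bullet> b)) = of_real (\<Prod>b\<in>Basis. indicator {0..<1::real} (y \<bullet> b))
        * cis (\<Sum>b\<in>Basis. 2 * pi * ((m \<bullet> b) * (y \<bullet> b)))"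
      by (simp add: h_def prod.distrib cis_sum scaleR_conv_of_real)
    also have "(\<Sum>b\<in>Basis. 2 * pi * ((m \<bullet> b) * (y \<bullet> b))) = 2 * pi * (m \<bullet> y)"
      by (subst euclidean_inner) (simp add: sum_distrib_left)
    finally show ?thesis by (simp only: ind scaleR_conv_of_real)
  qed
  then have "(\<integral>y. indicator unit_cube y *\<^sub>R cis (2 * pi * (m \<bullet> y)) \<partial>lborel) = (\<Prod>b\<in>Basis. \<integral>x. h b x \<partial>lborel)"
    by (intro lborel_integral_prod(2)) (auto simp: h_def intro: integral_cis_unit mb)
  also have "\<dots> = (\<Prod>b\<in>(Basis :: (real^'n) set). if m \<bullet> b = 0 then 1 else 0)"
    unfolding h_def by (intro prod.cong refl integral_cis_unit mb)
  also have "\<dots> = (if m = 0 then 1 else 0)"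
    using euclidean_all_zero_iff[of m] by auto
  finally show ?thesis .
qed

lemma measure_unit_cube: "measure lborel (unit_cube :: (real^'n) set) = 1"
proof -
  have "complex_of_real (measure lborel (unit_cube :: (real^'n) set)) = 1"
    using integral_character_unit_cube[of "0 :: real^'n"] by (simp add: scaleR_conv_of_real)
  then show ?thesis by (simp only: of_real_eq_1_iff)
qed

lemma norm_sum_sq_le: "(norm (a + b))\<^sup>2 \<le> 2 * (norm a)\<^sup>2 + 2 * (norm b)\<^sup>2" for a b :: "'a::real_normed_vector"
proof -
  have "(norm (a + b))\<^sup>2 \<le> (norm a + norm b)\<^sup>2" by (intro power_mono norm_triangle_ineq) auto
  also have "\<dots> \<le> 2 * (norm a)\<^sup>2 + 2 * (norm b)\<^sup>2"
    using sum_squares_bound[of "norm a" "norm b"] by (simp add: power2_sum)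
  finally show ?thesis .
qed

text \<open>Comparison with cube integrals: for y in the unit cube |y+k|^2 is at most 2d + 2|k|^2,
  so the k-th term is at most exp(sd) times the Gaussian with exponent s/2 at y+k. Halving the
  exponent pays for the displacement, and the cube integrals sum to one Gaussian integral.\<close>

lemma summable_gaussian_Zd:
  assumes s: "s > 0"
  shows "(\<lambda>k::real^'n. exp (- (s * (norm k)\<^sup>2))) summable_on Zd"
proof -
  have d: "(norm q)\<^sup>2 \<le> real CARD('n)" if "q \<in> unit_cube" for q :: "real^'n"
  proof -
    have "(norm q)\<^sup>2 = (\<Sum>i\<in>UNIV. (q $ i)\<^sup>2)" by (simp add: norm_vec_def L2_set_def sum_nonneg)
    also have "\<dots> \<le> (\<Sum>i\<in>(UNIV :: 'n set). 1)"
      using that by (intro sum_mono power_le_one) (auto simp: unit_cube_def less_imp_le)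
    finally show ?thesis by simp
  qed
  define \<phi> where "\<phi> z = exp (- (s / 2 * (norm z)\<^sup>2))" for z :: "real^'n"
  have \<phi>m [measurable]: "\<phi> \<in> borel_measurable borel" unfolding \<phi>_def by measurable
  have "integrable lborel (\<lambda>z. norm (complex_of_real (\<phi> z) * cis (- (2 * pi * ((0 :: real^'n) \<bullet> z)))))"
    unfolding \<phi>_def using s by (intro integrable_norm gaussian_fourier) auto
  then have int: "integrable lborel \<phi>" by (simp add: norm_mult \<phi>_def[abs_def])
  define C where "C = exp (s * real CARD('n))"
  have "(\<lambda>k. \<integral>y. indicator unit_cube y *\<^sub>R \<phi> (y + k) \<partial>lborel) summable_on Zd"
    using integral_tiling[OF int] by (rule has_sum_imp_summable)
  then have "(\<lambda>k. C * (\<integral>y. indicator unit_cube y *\<^sub>R \<phi> (y + k) \<partial>lborel)) summable_on Zd"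
    by (rule summable_on_cmult_right)
  then show ?thesis
  proof (rule summable_on_comparison_test)
    fix k :: "real^'n"
    have "exp (- (s * (norm k)\<^sup>2)) = (\<integral>y. indicator (unit_cube :: (real^'n) set) y *\<^sub>R exp (- (s * (norm k)\<^sup>2)) \<partial>lborel)"
      by (simp add: measure_unit_cube)
    also have "\<dots> \<le> (\<integral>y. C * (indicator unit_cube y *\<^sub>R \<phi> (y + k)) \<partial>lborel)"
    proof (rule integral_mono)
      show "integrable lborel (\<lambda>y. indicator (unit_cube :: (real^'n) set) y *\<^sub>R exp (- (s * (norm k)\<^sup>2)))" by simp
      show "integrable lborel (\<lambda>y. C * (indicator unit_cube y *\<^sub>R \<phi> (y + k)))"
        using s by (intro integrable_mult_right integrable_unit_cube[of _ 1]) (auto simp: \<phi>_def)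
      fix y :: "real^'n"
      show "indicator unit_cube y *\<^sub>R exp (- (s * (norm k)\<^sup>2)) \<le> C * (indicator unit_cube y *\<^sub>R \<phi> (y + k))"
      proof (cases "y \<in> unit_cube")
        case True
        have "(norm (y + k))\<^sup>2 \<le> 2 * real CARD('n) + 2 * (norm k)\<^sup>2"
          using norm_sum_sq_le[of y k] d[OF True] by simp
        then have "s / 2 * (norm (y + k))\<^sup>2 \<le> s / 2 * (2 * real CARD('n) + 2 * (norm k)\<^sup>2)"
          using s by (intro mult_left_mono) auto
        then have "- (s * (norm k)\<^sup>2) \<le> s * real CARD('n) + - (s / 2 * (norm (y + k))\<^sup>2)"
          by (simp add: algebra_simps)
        then show ?thesis using True by (simp add: C_def \<phi>_def exp_add[symmetric])
      qed simp
    qed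
    also have "\<dots> = C * (\<integral>y. indicator unit_cube y *\<^sub>R \<phi> (y + k) \<partial>lborel)" by simp
    finally show "exp (- (s * (norm k)\<^sup>2)) \<le> C * (\<integral>y. indicator unit_cube y *\<^sub>R \<phi> (y + k) \<partial>lborel)" .
  qed simp
qed

lemma matrix_norm_lower_bound:
  fixes A :: "real^'n^'n"
  assumes "invertible A"
  obtains c where "c > 0" "\<And>y. c * norm y \<le> norm (A *v y)"
proof -
  have "inj ((*v) A)" using assms by (simp add: inj_matrix_vector_mult)
  then obtain B where "B > 0" "\<And>x. B * norm x \<le> norm (A *v x)"
    using linear_inj_bounded_below_pos[OF matrix_vector_mul_linear] by blast
  then show ?thesis using that by blast
qed

text \<open>A summable majorant that is uniform for y in a ball, as the Weierstrass test for
  continuity in y requires. It comes from |k|^2/2 - R^2 <= |y+k|^2 together with a lower bound for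
  \<open>A\<close>.\<close>

lemma gaussian_translate_bound:
  fixes A :: "real^'n^'n"
  assumes A: "invertible A" and s: "s > 0"
  shows "\<exists>M. M summable_on Zd \<and>
    (\<forall>k y. norm y \<le> R \<longrightarrow> exp (- (s * (norm (A *v (y + k)))\<^sup>2)) \<le> M k)"
proof -
  obtain c where c: "c > 0" "\<And>y. c * norm y \<le> norm (A *v y)"
    using matrix_norm_lower_bound[OF A] by blast
  define M where "M k = exp (s * c\<^sup>2 * R\<^sup>2) * exp (- (s * c\<^sup>2 / 2 * (norm k)\<^sup>2))" for k :: "real^'n"
  show ?thesis
  proof (intro exI[of _ M] conjI allI impI)
    show "M summable_on Zd"
      unfolding M_def using s c by (intro summable_on_cmult_right summable_gaussian_Zd) simp
    fix k y :: "real^'n" assume y: "norm y \<le> R"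
    have "(norm k)\<^sup>2 \<le> 2 * (norm (y + k))\<^sup>2 + 2 * (norm y)\<^sup>2"
      using norm_sum_sq_le[of "y + k" "- y"] by simp
    also have "(norm y)\<^sup>2 \<le> R\<^sup>2" using y by (intro power_mono) auto
    finally have 1: "(norm k)\<^sup>2 / 2 - R\<^sup>2 \<le> (norm (y + k))\<^sup>2" by simp
    have "s * c\<^sup>2 * ((norm k)\<^sup>2 / 2 - R\<^sup>2) \<le> s * c\<^sup>2 * (norm (y + k))\<^sup>2"
      using s by (intro mult_left_mono 1) auto
    also have "\<dots> = s * (c * norm (y + k))\<^sup>2" by (simp add: power_mult_distrib)
    also have "\<dots> \<le> s * (norm (A *v (y + k)))\<^sup>2"
      using s c by (intro mult_left_mono power_mono) auto
    finally show "exp (- (s * (norm (A *v (y + k)))\<^sup>2)) \<le> M k"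
      by (simp add: M_def exp_add[symmetric] algebra_simps)
  qed
qed

lemma summable_gaussian_translate:
  fixes A :: "real^'n^'n"
  assumes A: "invertible A" and s: "s > 0"
  shows "(\<lambda>k. exp (- (s * (norm (A *v (y + k)))\<^sup>2))) summable_on Zd"
proof -
  obtain M where "M summable_on Zd"
    "\<forall>k z. norm z \<le> norm y \<longrightarrow> exp (- (s * (norm (A *v (z + k)))\<^sup>2)) \<le> M k"
    using gaussian_translate_bound[OF A s, of "norm y"] by (elim exE conjE)
  then show ?thesis by - (rule summable_on_comparison_test[of M], auto)
qed

lemma continuous_on_infsum:
  fixes f :: "'i \<Rightarrow> 'a::topological_space \<Rightarrow> 'b::banach"
  assumes "\<And>i. i \<in> I \<Longrightarrow> continuous_on S (f i)" "M summable_on I"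
    and "\<And>i y. i \<in> I \<Longrightarrow> y \<in> S \<Longrightarrow> norm (f i y) \<le> M i"
  shows "continuous_on S (\<lambda>y. \<Sum>\<^sub>\<infinity>i\<in>I. f i y)"
proof (rule uniform_limit_theorem)
  show "uniform_limit S (\<lambda>F y. \<Sum>i\<in>F. f i y) (\<lambda>y. \<Sum>\<^sub>\<infinity>i\<in>I. f i y) (finite_subsets_at_top I)"
    using assms by (intro Weierstrass_m_test_general) auto
  show "\<forall>\<^sub>F F in finite_subsets_at_top I. continuous_on S (\<lambda>y. \<Sum>i\<in>F. f i y)"
    using eventually_finite_subsets_at_top_weakI[of I "\<lambda>F. continuous_on S (\<lambda>y. \<Sum>i\<in>F. f i y)"]
    by (auto intro!: continuous_on_sum assms)
qed simp

lemma cis_2pi_Zd: "k \<in> Zd \<Longrightarrow> l \<in> Zd \<Longrightarrow> cis (2 * pi * (k \<bullet> l)) = 1"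
  using cis_multiple_2pi[of "k \<bullet> l"] inner_Zd[of k l] by simp

text \<open>Both sides are continuous and periodic in y, so equality of Fourier coefficients
  suffices. On the left, summing the integrals over the cube translates gives the Gaussian transform
  at \<open>W *v m\<close>; on the right, orthogonality of the characters selects one
  coefficient.\<close>

theorem poisson_gaussian_Zd:
  fixes V W :: "real^'n^'n"
  assumes V: "det V = 1" and W: "transpose V ** W = mat 1" and t: "t > 0"
  shows "of_real (\<Sum>\<^sub>\<infinity>k\<in>Zd. exp (- (t * (norm (V *v (y + k)))\<^sup>2))) =
    of_real ((pi / t) powr (real CARD('n) / 2)) *
    (\<Sum>\<^sub>\<infinity>m\<in>Zd. cis (2 * pi * (m \<bullet> y)) * of_real (exp (- (pi\<^sup>2 / t * (norm (W *v m))\<^sup>2))))"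
proof -
  have iV: "invertible V" using V by (simp add: invertible_det_nz)
  have iW: "invertible W"
    using W by (meson invertible_right_inverse invertible_left_inverse matrix_left_right_inverse)
  define c where "c = complex_of_real ((pi / t) powr (real CARD('n) / 2))"
  define b where "b m = complex_of_real (exp (- (pi\<^sup>2 / t * (norm (W *v m))\<^sup>2)))" for m :: "real^'n"
  define \<phi> where "\<phi> z = complex_of_real (exp (- (t * (norm (V *v z))\<^sup>2)))" for z :: "real^'n"
  have nb: "(\<lambda>m. norm (b m)) summable_on Zd"
    using summable_gaussian_translate[OF iW, of "pi\<^sup>2 / t" 0] t by (simp add: b_def)
  have n\<phi>: "(\<lambda>k. norm (\<phi> (y + k))) summable_on Zd" for y
    using summable_gaussian_translate[OF iV t, of y] by (simp add: \<phi>_def)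
  have cont\<phi>: "continuous_on S \<phi>" for S
    unfolding \<phi>_def by (intro continuous_intros linear_continuous_on matrix_vector_mul_bounded_linear)
  then have [measurable]: "\<phi> \<in> borel_measurable borel" by (rule borel_measurable_continuous_onI)
  define F where "F y = (\<Sum>\<^sub>\<infinity>k\<in>Zd. \<phi> (y + k))" for y
  define G where "G y = (\<Sum>\<^sub>\<infinity>m\<in>Zd. cis (2 * pi * (m \<bullet> y)) * b m)" for y
  have contF: "continuous_on UNIV F"
  proof -
    have "continuous_on (ball 0 (real n)) F" for n
    proof -
      obtain M where M: "M summable_on Zd"
        "\<forall>k z. norm z \<le> real n \<longrightarrow> exp (- (t * (norm (V *v (z + k)))\<^sup>2)) \<le> M k"
        using gaussian_translate_bound[OF iV t, of "real n"] by (elim exE conjE)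
      show ?thesis
        unfolding F_def
      proof (rule continuous_on_infsum[OF _ M(1)])
        show "continuous_on (ball 0 (real n)) (\<lambda>z. \<phi> (z + k))" for k
          by (rule continuous_on_compose2[OF cont\<phi>[of UNIV]]) (auto intro!: continuous_intros)
        show "norm (\<phi> (z + k)) \<le> M k" if "z \<in> ball 0 (real n)" for k z
          using M(2) that by (simp add: \<phi>_def less_imp_le)
      qed
    qed
    then have "continuous_on (\<Union>n. ball 0 (real n)) F"
      by (intro continuous_on_open_UN) auto
    moreover have "(\<Union>n. ball (0::real^'n) (real n)) = UNIV"
      using reals_Archimedean2 by (auto simp: set_eq_iff)
    ultimately show ?thesis by simp
  qed
  have contG: "continuous_on UNIV G"
    unfolding G_def
    by (rule continuous_on_infsum[OF _ nb]) (auto simp: norm_mult intro!: continuous_intros)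
  have perF: "F (y + k) = F y" if k: "k \<in> Zd" for y k
  proof -
    have "F (y + k) = (\<Sum>\<^sub>\<infinity>l\<in>Zd. \<phi> (y + (k + l)))" by (simp add: F_def add.assoc)
    also have "\<dots> = F y"
      unfolding F_def
      by (rule infsum_reindex_bij_witness[of _ "\<lambda>l. l - k" "\<lambda>l. k + l"]) (use k in auto)
    finally show ?thesis .
  qed
  have perG: "G (y + k) = G y" if k: "k \<in> Zd" for y k
    unfolding G_def
  proof (rule infsum_cong)
    fix m :: "real^'n" assume "m \<in> Zd"
    then show "cis (2 * pi * (m \<bullet> (y + k))) * b m = cis (2 * pi * (m \<bullet> y)) * b m"
      using cis_2pi_Zd[of m k] k by (simp add: inner_add_right distrib_left flip: cis_mult)
  qed
  have coeffF: "integrable lborel (\<lambda>y. indicator unit_cube y *\<^sub>R (F y * cis (- (2 * pi * (m \<bullet> y)))))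
      \<and> (\<integral>y. indicator unit_cube y *\<^sub>R (F y * cis (- (2 * pi * (m \<bullet> y)))) \<partial>lborel) = c * b m" if m: "m \<in> Zd" for m
  proof -
    define g where "g z = \<phi> z * cis (- (2 * pi * (m \<bullet> z)))" for z
    have m': "transpose V *v (W *v m) = m" by (simp add: matrix_vector_mul_assoc W)
    note gf = gaussian_fourier_linear[OF V t m']
    have gint: "integrable lborel g" using gf(1) by (simp add: g_def[abs_def] \<phi>_def)
    have [measurable]: "g \<in> borel_measurable borel" using gint by simp
    have gval: "(\<integral>z. g z \<partial>lborel) = c * b m"
      using gf(2) by (simp add: g_def[abs_def] \<phi>_def c_def b_def)
    define f where "f k y = indicator unit_cube y *\<^sub>R g (y + k)" for k y
    have ng: "norm (g z) = norm (\<phi> z)" for z by (simp add: g_def norm_mult)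
    have 1: "integrable lborel (f k)" for k
      unfolding f_def by (rule integrable_unit_cube[of _ 1]) (use t in \<open>auto simp: ng \<phi>_def\<close>)
    have 2: "(\<lambda>k. norm (f k y)) summable_on Zd" for y
      using n\<phi>[of y] by (cases "y \<in> unit_cube") (auto simp: f_def ng)
    have "(\<lambda>k. \<integral>y. indicator unit_cube y *\<^sub>R norm (g (y + k)) \<partial>lborel) summable_on Zd"
      using integral_tiling[OF integrable_norm[OF gint]] by (rule has_sum_imp_summable)
    then have 3: "(\<lambda>k. \<integral>y. norm (f k y) \<partial>lborel) summable_on Zd"
      by (simp add: f_def)
    note hs = has_sum_integral[OF countable_Zd 1 2 3]
    have pt: "(\<Sum>\<^sub>\<infinity>k\<in>Zd. f k y) = indicator unit_cube y *\<^sub>R (F y * cis (- (2 * pi * (m \<bullet> y))))" for y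
    proof -
      have "(\<Sum>\<^sub>\<infinity>k\<in>Zd. f k y) = (\<Sum>\<^sub>\<infinity>k\<in>Zd. \<phi> (y + k) * (indicator unit_cube y * cis (- (2 * pi * (m \<bullet> y)))))"
      proof (rule infsum_cong)
        fix k :: "real^'n" assume "k \<in> Zd"
        then have "cis (- (2 * pi * (m \<bullet> k))) = 1"
          using cis_2pi_Zd[of "m" "- k"] m by simp
        moreover have "cis (- (2 * pi * (m \<bullet> (y + k)))) = cis (- (2 * pi * (m \<bullet> y))) * cis (- (2 * pi * (m \<bullet> k)))"
          by (simp add: inner_add_right distrib_left cis_mult)
        ultimately show "f k y = \<phi> (y + k) * (indicator unit_cube y * cis (- (2 * pi * (m \<bullet> y))))"
          by (simp add: f_def g_def indicator_def)
      qed
      also have "\<dots> = F y * (indicator unit_cube y * cis (- (2 * pi * (m \<bullet> y))))"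
        unfolding F_def by (rule infsum_cmult_left')
      finally show ?thesis by (simp add: indicator_def)
    qed
    have "((\<lambda>k. \<integral>y. f k y \<partial>lborel) has_sum (\<integral>z. g z \<partial>lborel)) Zd"
      unfolding f_def by (rule integral_tiling[OF gint])
    then have "(\<integral>y. (\<Sum>\<^sub>\<infinity>k\<in>Zd. f k y) \<partial>lborel) = (\<integral>z. g z \<partial>lborel)"
      using hs(2) has_sum_unique by blast
    then show ?thesis using hs(1) unfolding pt gval by simp
  qed
  have coeffG: "integrable lborel (\<lambda>y. indicator unit_cube y *\<^sub>R (G y * cis (- (2 * pi * (m \<bullet> y)))))
      \<and> (\<integral>y. indicator unit_cube y *\<^sub>R (G y * cis (- (2 * pi * (m \<bullet> y)))) \<partial>lborel) = b m" if m: "m \<in> Zd" for m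
  proof -
    define f where "f l y = b l * (indicator unit_cube y *\<^sub>R cis (2 * pi * ((l - m) \<bullet> y)))" for l y
    have 0: "integrable lborel (\<lambda>y. indicator unit_cube y *\<^sub>R cis (2 * pi * (l \<bullet> y)))" for l :: "real^'n"
      by (rule integrable_unit_cube[of _ 1]) auto
    have 1: "integrable lborel (f l)" for l
      unfolding f_def by (intro integrable_mult_right 0)
    have nf: "norm (f l y) = norm (b l) * indicator unit_cube y" for l y
      by (simp add: f_def norm_mult)
    have 2: "(\<lambda>l. norm (f l y)) summable_on Zd" for y
      unfolding nf by (intro summable_on_cmult_left nb)
    have 3: "(\<lambda>l. \<integral>y. norm (f l y) \<partial>lborel) summable_on Zd"
      unfolding nf using nb by (simp add: measure_unit_cube)
    note hs = has_sum_integral[OF countable_Zd 1 2 3]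
    have pt: "(\<Sum>\<^sub>\<infinity>l\<in>Zd. f l y) = indicator unit_cube y *\<^sub>R (G y * cis (- (2 * pi * (m \<bullet> y))))" for y
    proof -
      have "f l y = cis (2 * pi * (l \<bullet> y)) * b l * (indicator unit_cube y * cis (- (2 * pi * (m \<bullet> y))))" for l
        by (simp add: f_def indicator_def inner_diff_left right_diff_distrib cis_mult)
      then have "(\<Sum>\<^sub>\<infinity>l\<in>Zd. f l y) = G y * (indicator unit_cube y * cis (- (2 * pi * (m \<bullet> y))))"
        unfolding G_def by (simp only: infsum_cmult_left')
      then show ?thesis by (simp add: indicator_def)
    qed
    have val: "(\<integral>y. f l y \<partial>lborel) = (if l = m then b m else 0)" if "l \<in> Zd" for l
      unfolding f_def integral_mult_right_zero using integral_character_unit_cube[of "l - m"] that m by simp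
    have "((\<lambda>l. if l = m then b m else 0) has_sum (if m = m then b m else 0)) Zd"
      by (rule has_sum_single) (use m in auto)
    then have "((\<lambda>l. \<integral>y. f l y \<partial>lborel) has_sum b m) Zd"
      by (subst has_sum_cong[OF val]) auto
    then have "(\<integral>y. (\<Sum>\<^sub>\<infinity>l\<in>Zd. f l y) \<partial>lborel) = b m"
      using hs(2) has_sum_unique by blast
    then show ?thesis using hs(1) unfolding pt by simp
  qed
  have "F y - c * G y = 0"
  proof (rule fourier_coefficients_zero_imp_zero)
    show "continuous_on UNIV (\<lambda>y. F y - c * G y)"
      by (intro continuous_intros contF contG)
    show "F (y + k) - c * G (y + k) = F y - c * G y" if "k \<in> Zd" for y k
      using that by (simp add: perF perG)
    fix m :: "real^'n" assume m: "m \<in> Zd"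
    have "(\<integral>y. indicator unit_cube y *\<^sub>R ((F y - c * G y) * cis (- (2 * pi * (m \<bullet> y)))) \<partial>lborel)
      = (\<integral>y. indicator unit_cube y *\<^sub>R (F y * cis (- (2 * pi * (m \<bullet> y))))
          - c * (indicator unit_cube y *\<^sub>R (G y * cis (- (2 * pi * (m \<bullet> y))))) \<partial>lborel)"
      by (intro Bochner_Integration.integral_cong) (auto simp: algebra_simps)
    also have "\<dots> = (\<integral>y. indicator unit_cube y *\<^sub>R (F y * cis (- (2 * pi * (m \<bullet> y)))) \<partial>lborel)
        - (\<integral>y. c * (indicator unit_cube y *\<^sub>R (G y * cis (- (2 * pi * (m \<bullet> y))))) \<partial>lborel)"
      by (intro Bochner_Integration.integral_diff integrable_mult_right conjunct1[OF coeffF] conjunct1[OF coeffG] m)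
    also have "\<dots> = c * b m - c * b m"
      using coeffF[OF m] coeffG[OF m] by (simp only: integral_mult_right_zero)
    finally show "(\<integral>y. indicator unit_cube y *\<^sub>R ((F y - c * G y) * cis (- (2 * pi * (m \<bullet> y)))) \<partial>lborel) = 0"
      by simp
  qed
  moreover have "F y = of_real (\<Sum>\<^sub>\<infinity>k\<in>Zd. exp (- (t * (norm (V *v (y + k)))\<^sup>2)))"
    unfolding F_def \<phi>_def
    by (intro infsumI has_sum_of_real has_sum_infsum summable_gaussian_translate[OF iV t])
  ultimately show ?thesis by (simp add: c_def G_def b_def)
qed

text \<open>Summability leaves only finitely many indices with \<open>r i\<close> below a given
  value. It stands in for discreteness of the lattice, both for shortest dual vectors and for the
  distance of a point to the lattice.\<close>

lemma exists_min_of_summable: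
  fixes r :: "'i \<Rightarrow> real"
  assumes sum: "(\<lambda>i. exp (- r i)) summable_on I" and ne: "I \<noteq> {}"
  obtains i0 where "i0 \<in> I" "\<And>i. i \<in> I \<Longrightarrow> r i0 \<le> r i"
proof -
  from ne obtain i1 where i1: "i1 \<in> I" by auto
  define J where "J = {i \<in> I. r i \<le> r i1}"
  have "finite J"
  proof (rule ccontr)
    define S where "S = (\<Sum>\<^sub>\<infinity>i\<in>I. exp (- r i))"
    define e where "e = exp (- r i1)"
    assume "infinite J"
    \<comment> \<open>The cardinality is chosen so that already \<open>card F\<close> terms, each at
      least \<open>e\<close>, exceed the total sum \<open>S\<close>.\<close>
    then obtain F where F: "finite F" "card F = Suc (nat \<lceil>S / e\<rceil>)" "F \<subseteq> J"
      using infinite_arbitrarily_large by blast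
    have "S < real (card F) * e"
    proof -
      have "S / e < real (card F)" unfolding F(2) by linarith
      then show ?thesis by (simp add: e_def divide_less_eq)
    qed
    also have "\<dots> \<le> (\<Sum>i\<in>F. exp (- r i))"
      using F(3) sum_bounded_below[of F e "\<lambda>i. exp (- r i)"] by (auto simp: J_def e_def)
    also have "\<dots> \<le> S"
      unfolding S_def using F by (intro finite_sum_le_infsum sum) (auto simp: J_def)
    finally show False by simp
  qed
  moreover have "i1 \<in> J" using i1 by (simp add: J_def)
  ultimately obtain i0 where i0: "i0 \<in> J" "\<And>i. i \<in> J \<Longrightarrow> r i0 \<le> r i"
    using ex_min_if_finite[of "r ` J"] by (auto simp: not_less)
  show thesis
  proof (rule that[of i0])
    show "i0 \<in> I" using i0 by (simp add: J_def)
    show "r i0 \<le> r i" if "i \<in> I" for i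
      using i0(2)[of i] i0(2)[of i1] that i1 by (cases "r i \<le> r i1") (auto simp: J_def)
  qed
qed

section \<open>The lattice, its dual, and Poisson summation between them\<close>

lemma lattice_of_eq: "lattice_of V = (*v) V ` Zd"
  by (auto simp: lattice_of_def Zd_def)

text \<open>Since w . Vk equals the product of \<open>transpose V *v w\<close> with k, testing
  against the unit vectors shows that w is dual exactly when \<open>transpose V *v w\<close> is
  integral. Hence \<open>W\<close> is the inverse transpose.\<close>

lemma inverse_transpose_exists:
  fixes V :: "real^'n^'n"
  assumes V: "det V = 1"
  shows "\<exists>W. transpose V ** W = mat 1 \<and> invertible W \<and> dual_lattice V = (*v) W ` Zd"
proof -
  have "invertible (transpose V)" using V by (simp add: invertible_det_nz det_transpose)
  then obtain W where W: "transpose V ** W = mat 1" "W ** transpose V = mat 1"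
    by (auto simp: invertible_def)
  have adj: "w \<bullet> (V *v k) = (transpose V *v w) \<bullet> k" for w k
    by (simp add: dot_lmul_matrix)
  have 1: "w \<in> dual_lattice V \<longleftrightarrow> transpose V *v w \<in> Zd" for w
  proof
    assume w: "w \<in> dual_lattice V"
    have "(transpose V *v w) $ i \<in> \<int>" for i
    proof -
      have "w \<bullet> (V *v axis i 1) \<in> \<int>"
        using w by (auto simp: dual_lattice_def lattice_of_eq)
      then show ?thesis unfolding adj by (simp add: inner_axis)
    qed
    then show "transpose V *v w \<in> Zd" by (simp add: Zd_def)
  next
    assume "transpose V *v w \<in> Zd"
    then show "w \<in> dual_lattice V"
      by (auto simp: dual_lattice_def lattice_of_eq adj intro: inner_Zd)
  qed
  have "dual_lattice V = (*v) W ` Zd"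
  proof (intro set_eqI iffI)
    fix w assume "w \<in> dual_lattice V"
    moreover have "w = W *v (transpose V *v w)"
      by (simp only: matrix_vector_mul_assoc W matrix_vector_mul_lid)
    ultimately show "w \<in> (*v) W ` Zd" unfolding 1 by (rule image_eqI[rotated])
  next
    fix w assume "w \<in> (*v) W ` Zd"
    then obtain m where m: "m \<in> Zd" "w = W *v m" by auto
    have "transpose V *v w = m"
      by (simp only: m matrix_vector_mul_assoc W matrix_vector_mul_lid)
    then show "w \<in> dual_lattice V" using m by (simp only: 1)
  qed
  then show ?thesis using W by (auto simp: invertible_def)
qed

text \<open>Times (t/pi)^(d/2) this is the heat kernel at u of the torus R^d modulo the lattice, at
  time 1/(4t). Only t > 0 is meaningful, hence the indicators that accompany it later.\<close>

definition theta :: "real^'n^'n \<Rightarrow> real^'n \<Rightarrow> real \<Rightarrow> real" where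
  "theta V u t = (\<Sum>\<^sub>\<infinity>v\<in>lattice_of V. exp (- (t * (norm (u + v))\<^sup>2)))"

lemma countable_lattice: "countable (lattice_of V)"
  by (simp add: lattice_of_eq countable_Zd)

lemma inj_on_matrix_vector_mult:
  assumes "invertible (A :: real^'n^'n)"
  shows "inj_on ((*v) A) S"
  using assms inj_matrix_vector_mult inj_on_subset by blast

context
  fixes V :: "real^'n^'n"
  assumes V: "det V = 1"
begin

lemma countable_dual: "countable (dual_lattice V)"
  using inverse_transpose_exists[OF V] countable_Zd by (metis countable_image)

lemma summable_theta:
  assumes t: "t > 0"
  shows "(\<lambda>v. exp (- (t * (norm (u + v))\<^sup>2))) summable_on lattice_of V"
proof -
  have iV: "invertible V" using V by (simp add: invertible_det_nz)
  then obtain V' where V': "V ** V' = mat 1" by (auto simp: invertible_def)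
  have "u + V *v k = V *v (V' *v u + k)" for k
    by (simp add: matrix_vector_right_distrib matrix_vector_mul_assoc V')
  then show ?thesis
    unfolding lattice_of_eq summable_on_reindex[OF inj_on_matrix_vector_mult[OF iV]] o_def
    using summable_gaussian_translate[OF iV t] by simp
qed

lemma summable_dual:
  assumes s: "s > 0"
  shows "(\<lambda>w. exp (- (s * (norm w)\<^sup>2))) summable_on dual_lattice V"
proof -
  obtain W :: "real^'n^'n" where W: "invertible W" "dual_lattice V = (*v) W ` Zd"
    using inverse_transpose_exists[OF V] by blast
  show ?thesis
    unfolding W summable_on_reindex[OF inj_on_matrix_vector_mult[OF W(1)]] o_def
    using summable_gaussian_translate[OF W(1) s, of 0] by simp
qed

theorem poisson_gaussian:
  assumes t: "t > 0"
  shows "of_real (theta V u t) = of_real ((pi / t) powr (real CARD('n) / 2)) *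
    (\<Sum>\<^sub>\<infinity>w\<in>dual_lattice V. cis (2 * pi * (w \<bullet> u)) * of_real (exp (- (pi\<^sup>2 / t * (norm w)\<^sup>2))))"
proof -
  obtain W where W: "transpose V ** W = mat 1" "invertible W" "dual_lattice V = (*v) W ` Zd"
    using inverse_transpose_exists[OF V] by blast
  have iV: "invertible V" using V by (simp add: invertible_det_nz)
  then obtain V' where V': "V ** V' = mat 1" by (auto simp: invertible_def)
  define y where "y = V' *v u"
  have u: "u = V *v y" by (simp add: y_def matrix_vector_mul_assoc V')
  have "theta V u t = (\<Sum>\<^sub>\<infinity>k\<in>Zd. exp (- (t * (norm (V *v (y + k)))\<^sup>2)))"
    unfolding theta_def lattice_of_eq infsum_reindex[OF inj_on_matrix_vector_mult[OF iV]] o_def u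
    by (simp add: matrix_vector_right_distrib)
  moreover have "(\<Sum>\<^sub>\<infinity>w\<in>dual_lattice V. cis (2 * pi * (w \<bullet> u)) * of_real (exp (- (pi\<^sup>2 / t * (norm w)\<^sup>2))))
    = (\<Sum>\<^sub>\<infinity>m\<in>Zd. cis (2 * pi * (m \<bullet> y)) * complex_of_real (exp (- (pi\<^sup>2 / t * (norm (W *v m))\<^sup>2))))"
  proof -
    have "(W *v m) \<bullet> (V *v y) = m \<bullet> y" for m
    proof -
      have "(W *v m) \<bullet> (V *v y) = (transpose V *v (W *v m)) \<bullet> y" by (simp add: dot_lmul_matrix)
      then show ?thesis by (simp add: matrix_vector_mul_assoc W)
    qed
    then show ?thesis
      unfolding W(3) infsum_reindex[OF inj_on_matrix_vector_mult[OF W(2)]] o_def u by simp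
  qed
  ultimately show ?thesis using poisson_gaussian_Zd[OF V W(1) t, of y] by simp
qed

text \<open>Condition (W2) is conditional on a shortest nonzero dual vector, so it can be exploited
  only once one is known to exist.\<close>

lemma dual_minimal_vector:
  obtains w0 where "w0 \<in> dual_lattice V - {0}" "\<And>w. w \<in> dual_lattice V - {0} \<Longrightarrow> norm w0 \<le> norm w"
proof -
  obtain W :: "real^'n^'n" where W: "invertible W" "dual_lattice V = (*v) W ` Zd"
    using inverse_transpose_exists[OF V] by blast
  have "(\<lambda>w. exp (- ((norm w)\<^sup>2))) summable_on dual_lattice V - {0}"
    by (rule summable_on_subset_banach[of _ "dual_lattice V"]) (use summable_dual[of 1] in auto)
  moreover have "dual_lattice V - {0} \<noteq> {}"
  proof -
    define e where "e = (axis undefined 1 :: real^'n)"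
    have "e \<noteq> 0" by (simp add: e_def axis_eq_0_iff)
    then have "W *v e \<noteq> 0"
      using inj_on_matrix_vector_mult[OF W(1), of UNIV] by (metis injD matrix_vector_mult_0_right)
    moreover have "W *v e \<in> dual_lattice V" by (simp add: W(2) e_def)
    ultimately show ?thesis by blast
  qed
  ultimately obtain w0 where "w0 \<in> dual_lattice V - {0}"
    "\<And>w. w \<in> dual_lattice V - {0} \<Longrightarrow> (norm w0)\<^sup>2 \<le> (norm w)\<^sup>2"
    using exists_min_of_summable by metis
  then show thesis using that by (meson norm_ge_zero power2_le_imp_le)
qed

text \<open>The constant is the attained minimum of |u+v|^2, which is positive because u + v = 0
  would put u into the lattice. It supplies the rate c of every exponential bound below.\<close>

lemma lattice_distance:
  assumes u: "u \<notin> lattice_of V"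
  obtains c where "c > 0" "\<And>v. v \<in> lattice_of V \<Longrightarrow> c \<le> (norm (u + v))\<^sup>2"
proof -
  have 0: "0 \<in> lattice_of V" by (auto simp: lattice_of_eq intro!: image_eqI[of _ _ 0])
  have neg: "- v \<in> lattice_of V" if "v \<in> lattice_of V" for v
    using that by (auto simp: lattice_of_eq linear_neg[OF matrix_vector_mul_linear, symmetric])
  obtain v0 where v0: "v0 \<in> lattice_of V"
    "\<And>v. v \<in> lattice_of V \<Longrightarrow> (norm (u + v0))\<^sup>2 \<le> (norm (u + v))\<^sup>2"
    using exists_min_of_summable[of "\<lambda>v. (norm (u + v))\<^sup>2" "lattice_of V"] summable_theta[of 1 u] 0 by auto
  have "u + v0 \<noteq> 0" using neg[OF v0(1)] u by (metis add_eq_0_iff neg_equal_iff_equal minus_minus)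
  then show thesis using that[of "(norm (u + v0))\<^sup>2"] v0 by auto
qed

lemma ustar_not_in_lattice: "ustar V \<notin> lattice_of V"
proof
  assume "ustar V \<in> lattice_of V"
  then obtain k where k: "k \<in> Zd" "ustar V = V *v k" by (auto simp: lattice_of_eq)
  have iV: "invertible V" using V by (simp add: invertible_det_nz)
  have "ustar V = V *v (\<chi> i. 1/2)"
    by (simp add: ustar_def vec_eq_iff matrix_vector_mult_def column_def sum_divide_distrib sum_distrib_left)
  with k have "k = (\<chi> i. 1/2)" using inj_on_matrix_vector_mult[OF iV, of UNIV] by (auto dest: injD)
  then have "(1/2 :: real) \<in> \<int>" using k(1) by (auto simp: Zd_def)
  then obtain n where "(1/2 :: real) = of_int n" by (auto elim: Ints_cases)
  then have "2 * n = 1" by linarith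
  then show False by presburger
qed

end

section \<open>Regularized theta functions\<close>

lemma theta_nonneg: "theta V u t \<ge> 0"
  unfolding theta_def by (intro infsum_nonneg) simp

text \<open>This is the function h of the overview. The first indicator makes it a Borel function on
  the whole line, so that it can be integrated directly against Borel measures there; the open right
  end of the second makes it right-continuous at 1.\<close>

definition regularized_theta :: "real^'n^'n \<Rightarrow> real^'n \<Rightarrow> real \<Rightarrow> real" where
  "regularized_theta V u t =
     indicator {0<..} t * theta V u t - indicator {0<..<1} t * (pi / t) powr (real CARD('n) / 2)"

text \<open>For t < 1 dividing the nonnegative difference |w|^2 - |w0|^2 by t only enlarges it.
  Relative to the shortest vector, every dual term thus carries a factor free of t and summable over
  w, and (W2) for \<open>w0\<close> controls the whole dual series.\<close>

lemma gaussian_relative_bound: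
  fixes w w0 :: "'a::real_normed_vector"
  assumes "norm w0 \<le> norm w" "0 < t" "t < 1"
  shows "exp (- (pi\<^sup>2 * (norm w)\<^sup>2 / t))
    \<le> exp (- (pi\<^sup>2 * (norm w0)\<^sup>2 / t)) * exp (- (pi\<^sup>2 * ((norm w)\<^sup>2 - (norm w0)\<^sup>2)))"
proof -
  have "0 \<le> pi\<^sup>2 * ((norm w)\<^sup>2 - (norm w0)\<^sup>2)"
    using assms by (intro mult_nonneg_nonneg) (auto intro: power_mono)
  then have "pi\<^sup>2 * ((norm w)\<^sup>2 - (norm w0)\<^sup>2) \<le> pi\<^sup>2 * ((norm w)\<^sup>2 - (norm w0)\<^sup>2) / t"
    using assms by (simp add: pos_le_divide_eq mult_left_le)
  then show ?thesis
    by (simp add: exp_add[symmetric] diff_divide_distrib right_diff_distrib)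
qed

context
  fixes V :: "real^'n^'n"
  assumes V: "det V = 1"
begin

text \<open>In each term the exponent t is split as a + (t - a), and |u+v|^2 >= c is used on the
  second piece.\<close>

lemma theta_decay:
  assumes c: "\<And>v. v \<in> lattice_of V \<Longrightarrow> c \<le> (norm (u + v))\<^sup>2" and a: "a > 0" "a \<le> t"
  shows "theta V u t \<le> exp (- (c * (t - a))) * theta V u a"
proof -
  have "theta V u t \<le> (\<Sum>\<^sub>\<infinity>v\<in>lattice_of V. exp (- (c * (t - a))) * exp (- (a * (norm (u + v))\<^sup>2)))"
    unfolding theta_def
  proof (rule infsum_mono)
    show "(\<lambda>v. exp (- (t * (norm (u + v))\<^sup>2))) summable_on lattice_of V"
      using a by (intro summable_theta[OF V]) auto
    show "(\<lambda>v. exp (- (c * (t - a))) * exp (- (a * (norm (u + v))\<^sup>2))) summable_on lattice_of V"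
      using a by (intro summable_on_cmult_right summable_theta[OF V]) auto
    fix v assume v: "v \<in> lattice_of V"
    have "c * (t - a) \<le> (norm (u + v))\<^sup>2 * (t - a)"
      using c[OF v] a by (intro mult_right_mono) auto
    then show "exp (- (t * (norm (u + v))\<^sup>2)) \<le> exp (- (c * (t - a))) * exp (- (a * (norm (u + v))\<^sup>2))"
      by (simp add: exp_add[symmetric] algebra_simps)
  qed
  also have "\<dots> = exp (- (c * (t - a))) * theta V u a"
    unfolding theta_def by (rule infsum_cmult_right')
  finally show ?thesis .
qed

lemma continuous_theta: "continuous_on {0<..} (theta V u)"
proof -
  have "continuous_on {inverse (real (Suc n))<..} (theta V u)" for n
    unfolding theta_def
  proof (rule continuous_on_infsum)
    show "(\<lambda>v. exp (- (inverse (real (Suc n)) * (norm (u + v))\<^sup>2))) summable_on lattice_of V"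
      by (intro summable_theta[OF V]) simp
    show "norm (exp (- (t * (norm (u + v))\<^sup>2))) \<le> exp (- (inverse (real (Suc n)) * (norm (u + v))\<^sup>2))"
      if "t \<in> {inverse (real (Suc n))<..}" for t v
      using that by (auto intro: mult_right_mono less_imp_le)
  qed (intro continuous_intros)
  then have "continuous_on (\<Union>n. {inverse (real (Suc n))<..}) (theta V u)"
    by (intro continuous_on_open_UN) auto
  moreover have "(\<Union>n. {inverse (real (Suc n))<..}) = {0<..}"
  proof (intro set_eqI iffI)
    fix x assume "x \<in> (\<Union>n. {inverse (real (Suc n))<..})"
    then obtain n where "inverse (real (Suc n)) < x" by auto
    moreover have "0 < inverse (real (Suc n))" by simp
    ultimately show "x \<in> {0<..}" unfolding greaterThan_iff by (rule less_trans[rotated])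
  qed (use reals_Archimedean in auto)
  ultimately show ?thesis by simp
qed

lemma regularized_theta_measurable [measurable]:
  "regularized_theta V u \<in> borel_measurable borel"
proof -
  have "(\<lambda>t. indicator {0<..} t *\<^sub>R theta V u t) \<in> borel_measurable borel"
    by (intro borel_measurable_continuous_on_indicator continuous_theta) simp
  then show ?thesis unfolding regularized_theta_def[abs_def] by (simp, measurable)
qed

lemma theta_dual_expansion:
  assumes t: "t > 0"
  shows "((\<lambda>w. cis (2 * pi * (w \<bullet> u)) * of_real ((pi / t) powr (real CARD('n) / 2) * exp (- (pi\<^sup>2 * (norm w)\<^sup>2 / t))))
      has_sum of_real (theta V u t - (pi / t) powr (real CARD('n) / 2))) (dual_lattice V - {0})"
proof -
  let ?a = "\<lambda>w. cis (2 * pi * (w \<bullet> u)) * complex_of_real (exp (- (pi\<^sup>2 / t * (norm w)\<^sup>2)))"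
  let ?c = "(pi / t) powr (real CARD('n) / 2)"
  have "(\<lambda>w. norm (?a w)) summable_on dual_lattice V"
    using summable_dual[OF V, of "pi\<^sup>2 / t"] t by (simp add: norm_mult)
  then have s: "?a summable_on dual_lattice V" by (rule abs_summable_summable)
  have 0: "0 \<in> dual_lattice V" by (auto simp: dual_lattice_def)
  have "(?a has_sum (infsum ?a (dual_lattice V))) (dual_lattice V)"
    using s by (rule has_sum_infsum)
  moreover have "(?a has_sum ?a 0) {0}" using has_sum_finite[of "{0}" ?a] by simp
  ultimately have "(?a has_sum (infsum ?a (dual_lattice V) - ?a 0)) (dual_lattice V - {0})"
    by (rule has_sum_Diff) (use 0 in auto)
  then have "((\<lambda>w. complex_of_real ?c * ?a w) has_sum (complex_of_real ?c * (infsum ?a (dual_lattice V) - ?a 0))) (dual_lattice V - {0})"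
    by (rule has_sum_cmult_right)
  moreover have "complex_of_real ?c * (infsum ?a (dual_lattice V) - ?a 0) = of_real (theta V u t - ?c)"
    using poisson_gaussian[OF V t, of u] by (simp add: right_diff_distrib)
  ultimately show ?thesis by (simp add: mult_ac)
qed

lemma summable_dual_relative:
  assumes w0: "w0 \<in> dual_lattice V - {0}"
  shows "(\<lambda>w. exp (- (pi\<^sup>2 * ((norm w)\<^sup>2 - (norm w0)\<^sup>2)))) summable_on dual_lattice V - {0}"
proof -
  have "(\<lambda>w. exp (pi\<^sup>2 * (norm w0)\<^sup>2) * exp (- (pi\<^sup>2 * (norm w)\<^sup>2))) summable_on dual_lattice V - {0}"
    by (rule summable_on_subset_banach[of _ "dual_lattice V"], rule summable_on_cmult_right,
        rule summable_dual[OF V]) auto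
  then show ?thesis by (simp add: exp_add[symmetric] algebra_simps)
qed

lemma theta_small_time:
  assumes w0: "w0 \<in> dual_lattice V - {0}" "\<And>w. w \<in> dual_lattice V - {0} \<Longrightarrow> norm w0 \<le> norm w"
    and t: "0 < t" "t < 1"
  shows "\<bar>theta V u t - (pi / t) powr (real CARD('n) / 2)\<bar> \<le>
    (pi / t) powr (real CARD('n) / 2) * exp (- (pi\<^sup>2 * (norm w0)\<^sup>2 / t)) *
    (\<Sum>\<^sub>\<infinity>w\<in>dual_lattice V - {0}. exp (- (pi\<^sup>2 * ((norm w)\<^sup>2 - (norm w0)\<^sup>2))))"
proof -
  let ?c = "(pi / t) powr (real CARD('n) / 2)"
  let ?a = "\<lambda>w. cis (2 * pi * (w \<bullet> u)) * complex_of_real (?c * exp (- (pi\<^sup>2 * (norm w)\<^sup>2 / t)))"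
  let ?b = "\<lambda>w. ?c * exp (- (pi\<^sup>2 * (norm w0)\<^sup>2 / t)) * exp (- (pi\<^sup>2 * ((norm w)\<^sup>2 - (norm w0)\<^sup>2)))"
  have le: "norm (?a w) \<le> ?b w" if "w \<in> dual_lattice V - {0}" for w
    using mult_left_mono[OF gaussian_relative_bound[OF w0(2)[OF that] t], of ?c]
    by (simp add: norm_mult mult.assoc)
  have sb: "?b summable_on dual_lattice V - {0}"
    by (intro summable_on_cmult_right summable_dual_relative w0)
  have sa: "(\<lambda>w. norm (?a w)) summable_on dual_lattice V - {0}"
    by (rule summable_on_comparison_test[OF sb le]) auto
  have "norm (complex_of_real (theta V u t - ?c)) = norm (infsum ?a (dual_lattice V - {0}))"
    using infsumI[OF theta_dual_expansion[OF t(1), of u]] by simp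
  also have "\<dots> \<le> (\<Sum>\<^sub>\<infinity>w\<in>dual_lattice V - {0}. norm (?a w))"
    by (rule norm_infsum_bound[OF sa])
  also have "\<dots> \<le> (\<Sum>\<^sub>\<infinity>w\<in>dual_lattice V - {0}. ?b w)"
    by (rule infsum_mono[OF sa sb le])
  also have "\<dots> = ?c * exp (- (pi\<^sup>2 * (norm w0)\<^sup>2 / t)) *
    (\<Sum>\<^sub>\<infinity>w\<in>dual_lattice V - {0}. exp (- (pi\<^sup>2 * ((norm w)\<^sup>2 - (norm w0)\<^sup>2))))"
    by (rule infsum_cmult_right')
  finally show ?thesis unfolding norm_of_real .
qed

text \<open>The true smallness is exponential in -1/t; a linear bound already gives boundedness and
  the limit 0. The phases of the dual series have modulus 1, so one \<open>K\<close> serves all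
  points u and differences of two theta functions can be estimated.\<close>

lemma theta_small_time_linear:
  "\<exists>K. \<forall>u. \<forall>t\<in>{0<..<1}. \<bar>theta V u t - (pi / t) powr (real CARD('n) / 2)\<bar> \<le> K * t"
proof -
  obtain w0 where w0: "w0 \<in> dual_lattice V - {0}" "\<And>w. w \<in> dual_lattice V - {0} \<Longrightarrow> norm w0 \<le> norm w"
    using dual_minimal_vector[OF V] by blast
  define a where "a = pi\<^sup>2 * (norm w0)\<^sup>2"
  have a: "a > 0" using w0(1) by (simp add: a_def)
  define S where "S = (\<Sum>\<^sub>\<infinity>w\<in>dual_lattice V - {0}. exp (- (pi\<^sup>2 * ((norm w)\<^sup>2 - (norm w0)\<^sup>2))))"
  have S: "S \<ge> 0" unfolding S_def by (intro infsum_nonneg) simp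
  define d where "d = CARD('n)"
  \<comment> \<open>The power (pi/t)^(d/2) costs at most pi^d / t^d, and the term of order d+1 of
    the exponential series bounds exp(-a/t) by (d+1)! t^(d+1) / a^(d+1). One power of t is left
    over.\<close>
  define K where "K = pi ^ d * fact (Suc d) / a ^ Suc d"
  have "(pi / t) powr (real d / 2) * exp (- (a / t)) \<le> K * t" if t: "0 < t" "t < 1" for t
  proof -
    have "1 \<le> pi / t" using t pi_gt3 by (simp add: pos_le_divide_eq)
    then have "(pi / t) powr (real d / 2) \<le> (pi / t) powr (real d)" by (intro powr_mono) auto
    also have "\<dots> = pi ^ d / t ^ d" using t by (simp add: powr_realpow power_divide)
    finally have 1: "(pi / t) powr (real d / 2) \<le> pi ^ d / t ^ d" .
    have "(a / t) ^ Suc d / fact (Suc d) \<le> exp (a / t)"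
      using a t sum_le_suminf[OF summable_exp[of "a / t"], of "{Suc d}"]
      by (simp add: exp_def scaleR_conv_of_real divide_inverse mult.commute)
    then have "inverse (exp (a / t)) \<le> inverse ((a / t) ^ Suc d / fact (Suc d))"
      using a t by (intro le_imp_inverse_le) (auto intro!: divide_pos_pos mult_pos_pos)
    also have "\<dots> = fact (Suc d) * t ^ Suc d / a ^ Suc d"
      by (simp only: power_divide inverse_divide divide_divide_eq_right)
    finally have 2: "exp (- (a / t)) \<le> fact (Suc d) * t ^ Suc d / a ^ Suc d"
      by (simp only: exp_minus)
    have "(pi / t) powr (real d / 2) * exp (- (a / t)) \<le> pi ^ d / t ^ d * (fact (Suc d) * t ^ Suc d / a ^ Suc d)"
      using t by (intro mult_mono 1 2) auto
    also have "\<dots> = K * t" using t by (simp add: K_def)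
    finally show ?thesis .
  qed
  then have "\<bar>theta V u t - (pi / t) powr (real CARD('n) / 2)\<bar> \<le> (K * S) * t" if "t \<in> {0<..<1}" for u t
  proof -
    have t: "0 < t" "t < 1" using that by auto
    have "\<bar>theta V u t - (pi / t) powr (real CARD('n) / 2)\<bar> \<le> (pi / t) powr (real d / 2) * exp (- (a / t)) * S"
      using theta_small_time[OF w0 t, of u] by (simp add: a_def S_def d_def)
    also have "\<dots> \<le> K * t * S"
      using S t by (intro mult_right_mono \<open>\<And>t. 0 < t \<Longrightarrow> t < 1 \<Longrightarrow> _\<close>) auto
    finally show ?thesis by (simp add: mult_ac)
  qed
  then show ?thesis by blast
qed

lemma regularized_theta_bound:
  assumes c: "\<And>v. v \<in> lattice_of V \<Longrightarrow> c \<le> (norm (u + v))\<^sup>2" and c0: "c > 0" and a: "a > 0"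
  shows "\<exists>C. \<forall>t\<ge>a. \<bar>regularized_theta V u t\<bar> \<le> C * exp (- (c * t))"
proof -
  define P where "P = (pi / a) powr (real CARD('n) / 2)"
  \<comment> \<open>The first summand is the constant of \<open>theta_decay\<close>. In the second,
    \<open>P\<close> bounds the subtracted power for t >= a, and \<open>exp c\<close> compensates
    \<open>exp (- (c * t))\<close> on t < 1, the only range where that power is present.\<close>
  define C where "C = exp (c * a) * theta V u a + P * exp c"
  have "\<bar>regularized_theta V u t\<bar> \<le> C * exp (- (c * t))" if t: "t \<ge> a" for t
  proof -
    have "theta V u t \<le> exp (c * a) * theta V u a * exp (- (c * t))"
      using theta_decay[OF c a t] by (simp add: exp_add[symmetric] exp_diff algebra_simps exp_minus field_simps)
    moreover have "indicator {0<..<1} t * (pi / t) powr (real CARD('n) / 2) \<le> P * exp c * exp (- (c * t))"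
    proof (cases "t < 1")
      case True
      have "(pi / t) powr (real CARD('n) / 2) \<le> P * 1"
        unfolding P_def using a t by (simp add: powr_mono2 divide_left_mono)
      also have "\<dots> \<le> P * exp (c - c * t)"
        using True c0 by (intro mult_left_mono) (auto simp: P_def mult_left_le)
      finally show ?thesis using True a t by (simp add: exp_diff exp_minus field_simps)
    qed (simp add: P_def)
    moreover have "0 \<le> indicator {0<..<1} t * (pi / t) powr (real CARD('n) / 2)" by simp
    moreover have "regularized_theta V u t = theta V u t - indicator {0<..<1} t * (pi / t) powr (real CARD('n) / 2)"
      using a t by (simp add: regularized_theta_def)
    moreover note theta_nonneg[of V u t]
    moreover have "C * exp (- (c * t)) = exp (c * a) * theta V u a * exp (- (c * t)) + P * exp c * exp (- (c * t))"
      by (simp add: C_def distrib_right)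
    moreover have "0 \<le> exp (c * a) * theta V u a * exp (- (c * t))" "0 \<le> P * exp c * exp (- (c * t))"
      by (simp_all add: theta_nonneg P_def)
    ultimately show ?thesis by linarith
  qed
  then show ?thesis by blast
qed

text \<open>The function jumps by pi^(d/2) at 1, but points slightly to the right of t always lie on
  the same branch as t.\<close>

lemma regularized_theta_right_continuous:
  assumes t: "t > 0"
  shows "(regularized_theta V u \<longlongrightarrow> regularized_theta V u t) (at_right t)"
proof -
  have th: "(theta V u \<longlongrightarrow> theta V u t) (at_right t)"
    using continuous_theta[of u] t
    by (auto simp: continuous_on_eq_continuous_at isCont_def intro: filterlim_at_split[THEN iffD1, THEN conjunct2])
  show ?thesis
  proof (cases "t < 1")
    case True
    have "((\<lambda>s. theta V u s - (pi / s) powr (real CARD('n) / 2)) \<longlongrightarrow> theta V u t - (pi / t) powr (real CARD('n) / 2)) (at_right t)"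
      using t by (intro tendsto_intros th) auto
    moreover have "\<forall>\<^sub>F s in at_right t. theta V u s - (pi / s) powr (real CARD('n) / 2) = regularized_theta V u s"
      using eventually_at_right_real[OF True] by eventually_elim (use t in \<open>auto simp: regularized_theta_def\<close>)
    ultimately show ?thesis
      using t True by (auto simp: regularized_theta_def intro: Lim_transform_eventually)
  next
    case False
    have "\<forall>\<^sub>F s in at_right t. theta V u s = regularized_theta V u s"
      using eventually_at_right_less[of t] by eventually_elim (use t False in \<open>auto simp: regularized_theta_def\<close>)
    then show ?thesis
      using t False th by (auto simp: regularized_theta_def intro: Lim_transform_eventually)
  qed
qed

text \<open>The singular term (pi/t)^(d/2) is the same for both points and cancels, so the
  exponential bound reaches down to t = 0, where the difference even vanishes.\<close>

lemma theta_diff_bound: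
  assumes c: "\<And>v. v \<in> lattice_of V \<Longrightarrow> c \<le> (norm (u + v))\<^sup>2" "\<And>v. v \<in> lattice_of V \<Longrightarrow> c \<le> (norm (u' + v))\<^sup>2"
    and c0: "c > 0"
  shows "\<exists>C. \<forall>t>0. \<bar>theta V u t - theta V u' t\<bar> \<le> C * exp (- (c * t))"
    and "((\<lambda>t. theta V u t - theta V u' t) \<longlongrightarrow> 0) (at_right 0)"
proof -
  obtain K where "\<forall>u. \<forall>t\<in>{0<..<1}. \<bar>theta V u t - (pi / t) powr (real CARD('n) / 2)\<bar> \<le> K * t"
    using theta_small_time_linear by (elim exE)
  then have K: "\<bar>theta V u t - (pi / t) powr (real CARD('n) / 2)\<bar> \<le> K * t" if "0 < t" "t < 1" for u t
    using that by simp
  have small: "\<bar>theta V u t - theta V u' t\<bar> \<le> 2 * K * t" if "0 < t" "t < 1" for t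
    using K[OF that, of u] K[OF that, of u'] by linarith
  obtain C1 where C1: "\<And>t. t \<ge> 1 \<Longrightarrow> \<bar>regularized_theta V u t\<bar> \<le> C1 * exp (- (c * t))"
    using regularized_theta_bound[OF c(1) c0, of 1] by auto
  obtain C2 where C2: "\<And>t. t \<ge> 1 \<Longrightarrow> \<bar>regularized_theta V u' t\<bar> \<le> C2 * exp (- (c * t))"
    using regularized_theta_bound[OF c(2) c0, of 1] by auto
  define C where "C = \<bar>C1\<bar> + \<bar>C2\<bar> + 2 * \<bar>K\<bar> * exp c"
  have "\<bar>theta V u t - theta V u' t\<bar> \<le> C * exp (- (c * t))" if t: "t > 0" for t
  proof (cases "t < 1")
    case True
    have "\<bar>theta V u t - theta V u' t\<bar> \<le> 2 * \<bar>K\<bar> * t"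
      using small[OF t True] t by (smt (verit) mult_right_mono)
    also have "\<dots> \<le> 2 * \<bar>K\<bar> * 1" using True by (intro mult_left_mono) auto
    also have "\<dots> \<le> 2 * \<bar>K\<bar> * exp (c - c * t)"
      using True c0 by (intro mult_left_mono) (auto simp: mult_left_le)
    also have "\<dots> = 2 * \<bar>K\<bar> * exp c * exp (- (c * t))" by (simp add: exp_diff exp_minus field_simps)
    also have "\<dots> \<le> C * exp (- (c * t))"
      unfolding C_def by (intro mult_right_mono) auto
    finally show ?thesis .
  next
    case False
    then have "\<bar>theta V u t - theta V u' t\<bar> \<le> \<bar>regularized_theta V u t\<bar> + \<bar>regularized_theta V u' t\<bar>"
      by (simp add: regularized_theta_def)
    also have "\<dots> \<le> C1 * exp (- (c * t)) + C2 * exp (- (c * t))"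
      using False by (intro add_mono C1 C2) auto
    also have "\<dots> = (C1 + C2) * exp (- (c * t))" by (simp add: distrib_right)
    also have "\<dots> \<le> C * exp (- (c * t))"
      unfolding C_def by (intro mult_right_mono) (auto intro: add_increasing2)
    finally show ?thesis .
  qed
  then show "\<exists>C. \<forall>t>0. \<bar>theta V u t - theta V u' t\<bar> \<le> C * exp (- (c * t))" by blast
  show "((\<lambda>t. theta V u t - theta V u' t) \<longlongrightarrow> 0) (at_right 0)"
  proof (rule Lim_null_comparison)
    show "\<forall>\<^sub>F t in at_right 0. norm (theta V u t - theta V u' t) \<le> 2 * K * t"
      using eventually_at_right_real[of 0 "1::real"] by (auto elim!: eventually_mono intro: small)
    have "((\<lambda>t. 2 * K * t) \<longlongrightarrow> 2 * K * 0) (at_right (0::real))" by (intro tendsto_intros)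
    then show "((\<lambda>t. 2 * K * t) \<longlongrightarrow> 0) (at_right (0::real))" by simp
  qed
qed

end

section \<open>Laplace transforms of measures on the half-line\<close>

definition laplace :: "real measure \<Rightarrow> real \<Rightarrow> real" where
  "laplace M s = (\<integral>t. exp (- (s * t)) \<partial>M)"

text \<open>Total mass may be infinite, as \<open>g a\<close> may be infinite at the origin; only
  the exponentially damped measures are finite. The almost-everywhere clause says that the measure
  lives on the open half-line.\<close>

definition laplace_finite :: "real measure \<Rightarrow> bool" where
  "laplace_finite M \<longleftrightarrow> sets M = sets borel \<and> (AE t in M. 0 < t) \<and> (\<forall>s>0. integrable M (\<lambda>t. exp (- (s * t))))"

lemma laplace_finiteD:
  assumes "laplace_finite M"
  shows "sets M = sets borel" "AE t in M. 0 < t" "s > 0 \<Longrightarrow> integrable M (\<lambda>t. exp (- (s * t)))"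
  using assms by (auto simp: laplace_finite_def)

lemma laplace_nonneg: "laplace M s \<ge> 0"
  unfolding laplace_def by (rule Bochner_Integration.integral_nonneg) simp

lemma laplace_antimono:
  assumes M: "laplace_finite M" and s: "0 < s" "s \<le> s'"
  shows "laplace M s' \<le> laplace M s"
  unfolding laplace_def
proof (rule integral_mono_AE)
  show "AE t in M. exp (- (s' * t)) \<le> exp (- (s * t))"
    using laplace_finiteD(2)[OF M] by eventually_elim (use s in \<open>auto intro: mult_right_mono\<close>)
qed (use s in \<open>auto intro!: laplace_finiteD(3)[OF M]\<close>)

text \<open>Markov's inequality with exp(-t) bounds the mass of the half-line up to n.
  Sigma-finiteness is what the product measures and Fubini rely on.\<close>

lemma laplace_finite_sigma_finite:
  assumes M: "laplace_finite M"
  shows "sigma_finite_measure M"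
proof
  note [measurable_cong] = laplace_finiteD(1)[OF M]
  have sp: "space M = UNIV" using laplace_finiteD(1)[OF M] by (metis sets_eq_imp_space_eq space_borel)
  define A where "A n = {..real n}" for n
  have "emeasure M (A n) \<noteq> \<infinity>" for n
  proof -
    have "emeasure M (A n) = (\<integral>\<^sup>+t. indicator (A n) t \<partial>M)"
      by (simp add: A_def laplace_finiteD(1)[OF M])
    also have "\<dots> \<le> (\<integral>\<^sup>+t. ennreal (exp (real n) * exp (- (1 * t))) \<partial>M)"
      by (intro nn_integral_mono) (auto simp: A_def indicator_def exp_add[symmetric] ennreal_1[symmetric] simp del: ennreal_1 intro!: ennreal_leI)
    also have "\<dots> < \<infinity>"
      using integrable_mult_right[OF laplace_finiteD(3)[OF M, of 1], of "exp (real n)"]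
      unfolding integrable_iff_bounded by (simp only: real_norm_def abs_mult abs_exp_cancel)
    finally show ?thesis by simp
  qed
  then show "\<exists>A. countable A \<and> A \<subseteq> sets M \<and> \<Union> A = space M \<and> (\<forall>a\<in>A. emeasure M a \<noteq> \<infinity>)"
    by (intro exI[of _ "range A"]) (auto simp: A_def laplace_finiteD(1)[OF M] sp intro: real_arch_simple)
qed

lemma integrable_pair_exp:
  assumes M: "laplace_finite M" and N: "laplace_finite N" and c: "c > 0"
  shows "integrable (M \<Otimes>\<^sub>M N) (\<lambda>(t, s). exp (- (c * (t + s))))"
    and "(\<integral>(t, s). exp (- (c * (t + s))) \<partial>(M \<Otimes>\<^sub>M N)) = laplace M c * laplace N c"
proof -
  interpret M: sigma_finite_measure M by (rule laplace_finite_sigma_finite[OF M])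
  interpret N: sigma_finite_measure N by (rule laplace_finite_sigma_finite[OF N])
  interpret pair_sigma_finite M N ..
  note [measurable_cong] = laplace_finiteD(1)[OF M] laplace_finiteD(1)[OF N]
  have e: "exp (- (c * (t + s))) = exp (- (c * t)) * exp (- (c * s))" for t s
    by (simp add: exp_add[symmetric] algebra_simps)
  have i: "integrable (M \<Otimes>\<^sub>M N) (\<lambda>z. exp (- (c * fst z)) * exp (- (c * snd z)))"
  proof (rule Fubini_integrable)
    show "integrable M (\<lambda>t. \<integral>s. norm (exp (- (c * fst (t, s))) * exp (- (c * snd (t, s)))) \<partial>N)"
      using laplace_finiteD(3)[OF M c] by simp
    show "AE t in M. integrable N (\<lambda>s. exp (- (c * fst (t, s))) * exp (- (c * snd (t, s))))"
      using laplace_finiteD(3)[OF N c] by simp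
  qed measurable
  then show "integrable (M \<Otimes>\<^sub>M N) (\<lambda>(t, s). exp (- (c * (t + s))))"
    by (simp add: e case_prod_unfold)
  have "(\<integral>z. exp (- (c * fst z)) * exp (- (c * snd z)) \<partial>(M \<Otimes>\<^sub>M N))
      = (\<integral>t. \<integral>s. exp (- (c * t)) * exp (- (c * s)) \<partial>N \<partial>M)"
    using integral_fst'[OF i] by simp
  then show "(\<integral>(t, s). exp (- (c * (t + s))) \<partial>(M \<Otimes>\<^sub>M N)) = laplace M c * laplace N c"
    by (simp add: e case_prod_unfold laplace_def)
qed

lemma AE_pair_pos:
  assumes M: "laplace_finite M" and N: "laplace_finite N" and a: "AE t in M. a \<le> t"
  shows "AE z in M \<Otimes>\<^sub>M N. a \<le> fst z \<and> 0 < snd z"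
proof -
  interpret M: sigma_finite_measure M by (rule laplace_finite_sigma_finite[OF M])
  interpret N: sigma_finite_measure N by (rule laplace_finite_sigma_finite[OF N])
  interpret pair_sigma_finite M N ..
  note [measurable_cong] = laplace_finiteD(1)[OF M] laplace_finiteD(1)[OF N]
  have "AE t in M. AE s in N. a \<le> fst (t, s) \<and> 0 < snd (t, s)"
    using a by eventually_elim (use laplace_finiteD(2)[OF N] in auto)
  then show ?thesis
    by (subst AE_pair_iff[symmetric]) auto
qed

lemma integrable_pair_exp_bounded:
  assumes M: "laplace_finite M" and N: "laplace_finite N" and c: "c > 0"
    and a: "AE t in M. a \<le> t" and [measurable]: "H \<in> borel_measurable borel"
    and H: "\<And>t. t \<ge> a \<Longrightarrow> \<bar>H t\<bar> \<le> C * exp (- (c * t))"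
  shows "integrable (M \<Otimes>\<^sub>M N) (\<lambda>(t, s). H (t + s))"
proof (rule Bochner_Integration.integrable_bound)
  note [measurable_cong] = laplace_finiteD(1)[OF M] laplace_finiteD(1)[OF N]
  show "integrable (M \<Otimes>\<^sub>M N) (\<lambda>z. C * (\<lambda>(t, s). exp (- (c * (t + s)))) z)"
    by (intro integrable_mult_right integrable_pair_exp M N c)
  show "AE z in M \<Otimes>\<^sub>M N. norm ((\<lambda>(t, s). H (t + s)) z) \<le> norm (C * (\<lambda>(t, s). exp (- (c * (t + s)))) z)"
    using AE_pair_pos[OF M N a]
    by eventually_elim (auto simp: case_prod_beta intro!: order_trans[OF H abs_ge_self])
  show "(\<lambda>(t, s). H (t + s)) \<in> borel_measurable (M \<Otimes>\<^sub>M N)" by measurable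
qed

text \<open>Concentration at 0, extracted from the transforms at c and 2c. Subtracting
  \<open>l * exp (- (c * t))\<close>, whose integral tends to l, leaves a function \<omega> that
  vanishes at 0. Away from 0, \<omega> is dominated by a multiple of exp(-ct) - exp(-2ct), whose
  integral is a difference of two transforms and tends to 1 - 1.\<close>

lemma tendsto_laplace_integral:
  fixes \<nu> :: "real \<Rightarrow> real measure"
  assumes \<nu>: "\<And>a. a > 0 \<Longrightarrow> laplace_finite (\<nu> a)"
    and lim: "\<And>s. s > 0 \<Longrightarrow> ((\<lambda>a. laplace (\<nu> a) s) \<longlongrightarrow> 1) (at_right 0)"
    and [measurable]: "\<psi> \<in> borel_measurable borel" and c: "c > 0"
    and bd: "\<And>t. t > 0 \<Longrightarrow> \<bar>\<psi> t\<bar> \<le> C * exp (- (c * t))"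
    and l: "(\<psi> \<longlongrightarrow> l) (at_right 0)"
  shows "((\<lambda>a. \<integral>t. \<psi> t \<partial>\<nu> a) \<longlongrightarrow> l) (at_right 0)"
proof -
  define \<omega> where "\<omega> t = \<psi> t - l * exp (- (c * t))" for t
  define C' where "C' = \<bar>C\<bar> + \<bar>l\<bar>"
  have C': "C' \<ge> 0" by (simp add: C'_def)
  have \<omega>bd: "\<bar>\<omega> t\<bar> \<le> C' * exp (- (c * t))" if "t > 0" for t
  proof -
    have "\<bar>\<omega> t\<bar> \<le> \<bar>\<psi> t\<bar> + \<bar>l\<bar> * exp (- (c * t))"
      unfolding \<omega>_def by (rule order_trans[OF abs_triangle_ineq4]) (simp add: abs_mult)
    also have "\<dots> \<le> \<bar>C\<bar> * exp (- (c * t)) + \<bar>l\<bar> * exp (- (c * t))"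
      using bd[OF that] by (intro add_mono order_trans[OF bd[OF that]] mult_right_mono) auto
    finally show ?thesis by (simp add: C'_def distrib_right)
  qed
  have [measurable]: "\<omega> \<in> borel_measurable borel" unfolding \<omega>_def by measurable
  have int: "integrable (\<nu> a) \<psi>" "integrable (\<nu> a) \<omega>" if "a > 0" for a
  proof -
    note [measurable_cong] = laplace_finiteD(1)[OF \<nu>[OF that]]
    have dom: "integrable (\<nu> a) f"
      if [measurable]: "f \<in> borel_measurable borel" and "\<And>t. t > 0 \<Longrightarrow> \<bar>f t\<bar> \<le> K * exp (- (c * t))" for f :: "real \<Rightarrow> real" and K
    proof (rule Bochner_Integration.integrable_bound)
      show "integrable (\<nu> a) (\<lambda>t. K * exp (- (c * t)))"
        by (intro integrable_mult_right laplace_finiteD(3)[OF \<nu>[OF \<open>a > 0\<close>] c])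
      show "AE t in \<nu> a. norm (f t) \<le> norm (K * exp (- (c * t)))"
        using laplace_finiteD(2)[OF \<nu>[OF \<open>a > 0\<close>]]
        by eventually_elim (use that in \<open>auto intro: order_trans[OF _ abs_ge_self]\<close>)
    qed measurable
    show "integrable (\<nu> a) \<psi>" "integrable (\<nu> a) \<omega>"
      by (rule dom[of _ C], simp, rule bd, simp) (rule dom[of _ C'], simp, rule \<omega>bd, simp)
  qed
  have "((\<lambda>a. \<integral>t. \<omega> t \<partial>\<nu> a) \<longlongrightarrow> 0) (at_right 0)"
  proof (rule tendstoI)
    fix e :: real assume e: "e > 0"
    have "(\<omega> \<longlongrightarrow> l - l * exp (- (c * 0))) (at_right 0)"
      unfolding \<omega>_def by (intro tendsto_intros l)
    \<comment> \<open>The weight is attached so that the bound near 0 integrates to e/2 times the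
      transform at c, a quantity that tends to e/2.\<close>
    then have "((\<lambda>t. \<omega> t * exp (c * t)) \<longlongrightarrow> 0 * exp (c * 0)) (at_right 0)"
      by (intro tendsto_intros) simp
    then have "\<forall>\<^sub>F t in at_right 0. dist (\<omega> t * exp (c * t)) 0 < e / 2"
      using e by (intro tendstoD) auto
    then obtain \<delta> where \<delta>: "\<delta> > 0" "\<And>t. 0 < t \<Longrightarrow> t < \<delta> \<Longrightarrow> \<bar>\<omega> t * exp (c * t)\<bar> < e / 2"
      by (auto simp: eventually_at_right_field dist_real_def)
    \<comment> \<open>Chosen so that C' = K (1 - exp(-c \<delta>)); for t >= \<delta> this turns C'
      exp(-ct) into at most K (exp(-ct) - exp(-2ct)).\<close>
    define K where "K = C' / (1 - exp (- (c * \<delta>)))"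
    have K: "K \<ge> 0" "1 - exp (- (c * \<delta>)) > 0" using c \<delta> C' by (auto simp: K_def)
    have pt: "\<bar>\<omega> t\<bar> \<le> e / 2 * exp (- (c * t)) + K * (exp (- (c * t)) - exp (- (2 * c * t)))" if t: "t > 0" for t
    proof -
      have E: "exp (- (c * t)) - exp (- (2 * c * t)) = exp (- (c * t)) * (1 - exp (- (c * t)))"
        by (simp add: right_diff_distrib exp_add[symmetric])
      show ?thesis
      proof (cases "t < \<delta>")
        case True
        have "\<bar>\<omega> t\<bar> = \<bar>\<omega> t * exp (c * t)\<bar> * exp (- (c * t))"
          by (simp add: abs_mult exp_minus)
        also have "\<dots> \<le> e / 2 * exp (- (c * t))"
          using \<delta>(2)[OF t True] by (intro mult_right_mono) auto
        also have "\<dots> \<le> e / 2 * exp (- (c * t)) + K * (exp (- (c * t)) - exp (- (2 * c * t)))"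
          unfolding E using K c t by simp
        finally show ?thesis .
      next
        case False
        have "\<bar>\<omega> t\<bar> \<le> C' * exp (- (c * t))" by (rule \<omega>bd[OF t])
        also have "\<dots> = K * (exp (- (c * t)) * (1 - exp (- (c * \<delta>))))" using K(2) c \<delta>(1) by (simp add: K_def)
        also have "\<dots> \<le> K * (exp (- (c * t)) * (1 - exp (- (c * t))))"
          using False c K by (intro mult_left_mono) auto
        also have "\<dots> \<le> e / 2 * exp (- (c * t)) + K * (exp (- (c * t)) - exp (- (2 * c * t)))"
          unfolding E using e by simp
        finally show ?thesis .
      qed
    qed
    have le: "\<bar>\<integral>t. \<omega> t \<partial>\<nu> a\<bar> \<le> e / 2 * laplace (\<nu> a) c + K * (laplace (\<nu> a) c - laplace (\<nu> a) (2 * c))"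
      if a: "a > 0" for a
    proof -
      have i: "integrable (\<nu> a) (\<lambda>t. exp (- (c * t)))" "integrable (\<nu> a) (\<lambda>t. exp (- (2 * c * t)))"
        using c by (auto intro!: laplace_finiteD(3)[OF \<nu>[OF a]])
      have "\<bar>\<integral>t. \<omega> t \<partial>\<nu> a\<bar> \<le> (\<integral>t. \<bar>\<omega> t\<bar> \<partial>\<nu> a)" by (rule integral_abs_bound)
      also have "\<dots> \<le> (\<integral>t. e / 2 * exp (- (c * t)) + K * (exp (- (c * t)) - exp (- (2 * c * t))) \<partial>\<nu> a)"
      proof (rule integral_mono_AE)
        show "AE t in \<nu> a. \<bar>\<omega> t\<bar> \<le> e / 2 * exp (- (c * t)) + K * (exp (- (c * t)) - exp (- (2 * c * t)))"
          using laplace_finiteD(2)[OF \<nu>[OF a]] by eventually_elim (rule pt)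
      qed (use int(2)[OF a] i in auto)
      also have "\<dots> = e / 2 * laplace (\<nu> a) c + K * (laplace (\<nu> a) c - laplace (\<nu> a) (2 * c))"
        using i by (simp add: laplace_def)
      finally show ?thesis .
    qed
    have "((\<lambda>a. e / 2 * laplace (\<nu> a) c + K * (laplace (\<nu> a) c - laplace (\<nu> a) (2 * c))) \<longlongrightarrow> e / 2 * 1 + K * (1 - 1)) (at_right 0)"
      using c by (intro tendsto_intros lim) auto
    then have "\<forall>\<^sub>F a in at_right 0. e / 2 * laplace (\<nu> a) c + K * (laplace (\<nu> a) c - laplace (\<nu> a) (2 * c)) < e"
      by (rule order_tendstoD(2)) (use e in simp)
    then show "\<forall>\<^sub>F a in at_right 0. dist (\<integral>t. \<omega> t \<partial>\<nu> a) 0 < e"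
      using eventually_at_right_less[of 0]
      by eventually_elim (auto intro: le_less_trans[OF le])
  qed
  moreover have "((\<lambda>a. l * laplace (\<nu> a) c) \<longlongrightarrow> l * 1) (at_right 0)"
    by (intro tendsto_intros lim c)
  ultimately have "((\<lambda>a. (\<integral>t. \<omega> t \<partial>\<nu> a) + l * laplace (\<nu> a) c) \<longlongrightarrow> 0 + l * 1) (at_right 0)"
    by (rule tendsto_add)
  moreover have "\<forall>\<^sub>F a in at_right 0. (\<integral>t. \<omega> t \<partial>\<nu> a) + l * laplace (\<nu> a) c = (\<integral>t. \<psi> t \<partial>\<nu> a)"
    using eventually_at_right_less[of 0]
  proof eventually_elim
    case (elim a)
    then show ?case
      unfolding \<omega>_def laplace_def using int(1)[of a] laplace_finiteD(3)[OF \<nu>, of a c] c by simp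
  qed
  ultimately show ?thesis by (auto intro: Lim_transform_eventually)
qed

text \<open>The two conclusions are the limit and the decay that
  \<open>tendsto_laplace_integral\<close> asks of the inner integral as a function of s. Dominated
  convergence needs H only from the right, since the shifts s are positive.\<close>

lemma tendsto_shifted_integral:
  assumes M: "laplace_finite M" and c: "c > 0" and a: "a > 0" "AE t in M. a \<le> t"
    and [measurable]: "H \<in> borel_measurable borel"
    and H: "\<And>t. t \<ge> a \<Longrightarrow> \<bar>H t\<bar> \<le> C * exp (- (c * t))"
    and rc: "\<And>t. t > 0 \<Longrightarrow> (H \<longlongrightarrow> H t) (at_right t)"
  shows "((\<lambda>s. \<integral>t. H (t + s) \<partial>M) \<longlongrightarrow> (\<integral>t. H t \<partial>M)) (at_right 0)"
    and "s > 0 \<Longrightarrow> \<bar>\<integral>t. H (t + s) \<partial>M\<bar> \<le> \<bar>C\<bar> * laplace M c * exp (- (c * s))"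
proof -
  note [measurable_cong] = laplace_finiteD(1)[OF M]
  have bd: "\<bar>H (t + s)\<bar> \<le> \<bar>C\<bar> * exp (- (c * t)) * exp (- (c * s))" if "t \<ge> a" "s > 0" for t s
  proof -
    have "\<bar>H (t + s)\<bar> \<le> C * exp (- (c * (t + s)))" using that by (intro H) auto
    also have "\<dots> \<le> \<bar>C\<bar> * exp (- (c * (t + s)))" by (intro mult_right_mono) auto
    finally show ?thesis by (simp add: exp_add[symmetric] algebra_simps mult.assoc)
  qed
  have i: "integrable M (\<lambda>t. \<bar>C\<bar> * exp (- (c * t)))"
    by (intro integrable_mult_right laplace_finiteD(3)[OF M c])
  show "((\<lambda>s. \<integral>t. H (t + s) \<partial>M) \<longlongrightarrow> (\<integral>t. H t \<partial>M)) (at_right 0)"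
    unfolding tendsto_at_iff_sequentially o_def
  proof (intro allI impI)
    fix X :: "nat \<Rightarrow> real"
    assume X: "\<forall>i. X i \<in> {0<..} - {0}" "X \<longlonglongrightarrow> 0"
    show "(\<lambda>i. \<integral>t. H (t + X i) \<partial>M) \<longlonglongrightarrow> (\<integral>t. H t \<partial>M)"
    proof (rule integral_dominated_convergence[OF _ _ i])
      show "AE t in M. (\<lambda>i. H (t + X i)) \<longlonglongrightarrow> H t"
        using a(2)
      proof eventually_elim
        case (elim t)
        have "(\<lambda>i. t + X i) \<longlonglongrightarrow> t + 0" by (intro tendsto_intros X)
        moreover have "\<forall>i. t + X i \<in> {t<..} - {t}" using X(1) by auto
        ultimately show ?case
          using rc[of t] a(1) elim unfolding tendsto_at_iff_sequentially o_def by auto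
      qed
      show "AE t in M. norm (H (t + X i)) \<le> \<bar>C\<bar> * exp (- (c * t))" for i
        using a(2)
      proof eventually_elim
        case (elim t)
        have "X i > 0" using X(1) by auto
        have "\<bar>H (t + X i)\<bar> \<le> \<bar>C\<bar> * exp (- (c * t)) * exp (- (c * X i))"
          by (rule bd[OF elim \<open>X i > 0\<close>])
        also have "\<dots> \<le> \<bar>C\<bar> * exp (- (c * t)) * 1"
          using c \<open>X i > 0\<close> by (intro mult_left_mono) auto
        finally show ?case by simp
      qed
    qed measurable
  qed
  assume s: "s > 0"
  have "\<bar>\<integral>t. H (t + s) \<partial>M\<bar> \<le> (\<integral>t. \<bar>H (t + s)\<bar> \<partial>M)" by (rule integral_abs_bound)
  also have "\<dots> \<le> (\<integral>t. \<bar>C\<bar> * exp (- (c * t)) * exp (- (c * s)) \<partial>M)"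
  proof (rule integral_mono_AE)
    show AE: "AE t in M. \<bar>H (t + s)\<bar> \<le> \<bar>C\<bar> * exp (- (c * t)) * exp (- (c * s))"
      using a(2) by eventually_elim (rule bd[OF _ s])
    show i': "integrable M (\<lambda>t. \<bar>C\<bar> * exp (- (c * t)) * exp (- (c * s)))"
      using i by (rule integrable_mult_left)
    show "integrable M (\<lambda>t. \<bar>H (t + s)\<bar>)"
      by (rule Bochner_Integration.integrable_bound[OF i']) (use AE in \<open>auto elim!: eventually_mono\<close>)
  qed
  also have "\<dots> = \<bar>C\<bar> * laplace M c * exp (- (c * s))" by (simp add: laplace_def)
  finally show "\<bar>\<integral>t. H (t + s) \<partial>M\<bar> \<le> \<bar>C\<bar> * laplace M c * exp (- (c * s))" .
qed

section \<open>Lattice sums against Laplace transforms\<close>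

lemma density_indicator:
  fixes f :: "'a \<Rightarrow> 'b::{banach, second_countable_topology}"
  assumes A: "A \<in> sets M" and f: "f \<in> borel_measurable M"
  shows "integrable (density M (indicator A)) f \<longleftrightarrow> set_integrable M A f"
    and "(\<integral>x. f x \<partial>density M (indicator A)) = set_lebesgue_integral M A f"
proof -
  have e: "density M (indicator A) = density M (\<lambda>x. ennreal (indicator A x))"
    by (simp add: ennreal_indicator)
  show "integrable (density M (indicator A)) f \<longleftrightarrow> set_integrable M A f"
    unfolding e set_integrable_def by (rule integrable_density[OF f]) (use A in auto)
  show "(\<integral>x. f x \<partial>density M (indicator A)) = set_lebesgue_integral M A f"
    unfolding e set_lebesgue_integral_def by (rule integral_density[OF f]) (use A in auto)
qed

context
  fixes V :: "real^'n^'n"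
  assumes V: "det V = 1"
begin

lemma sum_laplace_eq_theta:
  assumes N: "laplace_finite N" and u: "u \<notin> lattice_of V"
    and sum: "(\<lambda>v. laplace N ((norm (u + v))\<^sup>2)) summable_on lattice_of V"
  shows "integrable N (\<lambda>s. indicator {0<..} s * theta V u s)"
    and "(\<Sum>\<^sub>\<infinity>v\<in>lattice_of V. laplace N ((norm (u + v))\<^sup>2)) = (\<integral>s. indicator {0<..} s * theta V u s \<partial>N)"
proof -
  note [measurable_cong] = laplace_finiteD(1)[OF N]
  obtain c where c: "c > 0" "\<And>v. v \<in> lattice_of V \<Longrightarrow> c \<le> (norm (u + v))\<^sup>2"
    using lattice_distance[OF V u] by blast
  \<comment> \<open>For s <= 0 the unmodified exponentials are not summable over the lattice. The
    indicator makes the series converge at every point and changes the integrands on a null set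
    only.\<close>
  define f where "f v s = indicator {0<..} s * exp (- ((norm (u + v))\<^sup>2 * s))" for v s
  have [measurable]: "f v \<in> borel_measurable borel" for v unfolding f_def by measurable
  have ae: "AE s in N. f v s = exp (- ((norm (u + v))\<^sup>2 * s))" for v
    using laplace_finiteD(2)[OF N] by eventually_elim (simp add: f_def)
  have pos: "(norm (u + v))\<^sup>2 > 0" if "v \<in> lattice_of V" for v
    using c(1) c(2)[OF that] by linarith
  have 1: "integrable N (f v)" if "v \<in> lattice_of V" for v
    using laplace_finiteD(3)[OF N pos[OF that]] ae[of v] by (subst integrable_cong_AE) auto
  have nf: "norm (f v s) = f v s" for v s by (simp add: f_def)
  have 2: "(\<lambda>v. norm (f v s)) summable_on lattice_of V" for s
    using summable_theta[OF V, of s u] by (cases "s > 0") (auto simp: f_def mult.commute)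
  have L: "(\<integral>s. f v s \<partial>N) = laplace N ((norm (u + v))\<^sup>2)" for v
    unfolding laplace_def using ae by (intro integral_cong_AE) auto
  have 3: "(\<lambda>v. \<integral>s. norm (f v s) \<partial>N) summable_on lattice_of V"
    unfolding nf L by (rule sum)
  note hs = has_sum_integral[OF countable_lattice 1 2 3]
  have pt: "(\<Sum>\<^sub>\<infinity>v\<in>lattice_of V. f v s) = indicator {0<..} s * theta V u s" for s
    unfolding f_def theta_def by (subst infsum_cmult_right') (simp add: mult.commute)
  show "integrable N (\<lambda>s. indicator {0<..} s * theta V u s)" using hs(1) unfolding pt .
  show "(\<Sum>\<^sub>\<infinity>v\<in>lattice_of V. laplace N ((norm (u + v))\<^sup>2)) = (\<integral>s. indicator {0<..} s * theta V u s \<partial>N)"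
    using hs(2) unfolding pt L by (rule infsumI)
qed

text \<open>A product of transforms is the integral of exp(-|u+v|^2 (t+s)) over the product measure,
  so lattice sum and background become integrals of functions of t+s over the same space and can be
  subtracted under the integral. The variable of \<open>N\<close> is left outermost, since the later
  limit acts on it.\<close>

lemma sum_laplace_minus_convolution:
  assumes M: "laplace_finite M" and N: "laplace_finite N" and a: "a > 0" "AE t in M. a \<le> t"
    and u: "u \<notin> lattice_of V"
    and sum: "(\<lambda>v. laplace N ((norm (u + v))\<^sup>2)) summable_on lattice_of V"
  shows "(\<lambda>v. laplace M ((norm (u + v))\<^sup>2) * laplace N ((norm (u + v))\<^sup>2)) summable_on lattice_of V"
    and "(\<Sum>\<^sub>\<infinity>v\<in>lattice_of V. laplace M ((norm (u + v))\<^sup>2) * laplace N ((norm (u + v))\<^sup>2))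
      - set_lebesgue_integral (convolution M N) {0<..<1} (\<lambda>t. pi powr (real CARD('n) / 2) / t powr (real CARD('n) / 2))
      = (\<integral>s. \<integral>t. regularized_theta V u (t + s) \<partial>M \<partial>N)"
proof -
  interpret M: sigma_finite_measure M by (rule laplace_finite_sigma_finite[OF M])
  interpret N: sigma_finite_measure N by (rule laplace_finite_sigma_finite[OF N])
  interpret pair_sigma_finite M N ..
  note [measurable_cong] = laplace_finiteD(1)[OF M] laplace_finiteD(1)[OF N]
  obtain c where c: "c > 0" "\<And>v. v \<in> lattice_of V \<Longrightarrow> c \<le> (norm (u + v))\<^sup>2"
    using lattice_distance[OF V u] by blast
  have pos: "(norm (u + v))\<^sup>2 > 0" if "v \<in> lattice_of V" for v
    using c(1) c(2)[OF that] by linarith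
  show s1: "(\<lambda>v. laplace M ((norm (u + v))\<^sup>2) * laplace N ((norm (u + v))\<^sup>2)) summable_on lattice_of V"
  proof (rule summable_on_comparison_test)
    \<comment> \<open>Transforms decrease, so that of \<open>M\<close> is at most its value at c on
      all the points |u+v|^2; the sum is then carried by \<open>N\<close>.\<close>
    show "(\<lambda>v. laplace M c * laplace N ((norm (u + v))\<^sup>2)) summable_on lattice_of V"
      by (intro summable_on_cmult_right sum)
    show "laplace M ((norm (u + v))\<^sup>2) * laplace N ((norm (u + v))\<^sup>2) \<le> laplace M c * laplace N ((norm (u + v))\<^sup>2)"
      if "v \<in> lattice_of V" for v
      using c that by (intro mult_right_mono laplace_antimono[OF M] laplace_nonneg) auto
  qed (simp add: laplace_nonneg)
  define f where "f v z = indicator {0<..} (fst z + snd z) * exp (- ((norm (u + v))\<^sup>2 * (fst z + snd z)))" for v and z :: "real \<times> real"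
  have [measurable]: "f v \<in> borel_measurable (M \<Otimes>\<^sub>M N)" for v unfolding f_def by measurable
  have aez: "AE z in M \<Otimes>\<^sub>M N. a \<le> fst z \<and> 0 < snd z" by (rule AE_pair_pos[OF M N a(2)])
  have ae: "AE z in M \<Otimes>\<^sub>M N. f v z = (\<lambda>(t, s). exp (- ((norm (u + v))\<^sup>2 * (t + s)))) z" for v
    using aez by eventually_elim (use a(1) in \<open>auto simp: f_def case_prod_beta\<close>)
  have [measurable]: "(\<lambda>(t, s). exp (- (b * (t + s)))) \<in> borel_measurable (M \<Otimes>\<^sub>M N)" for b :: real
    by measurable
  have 1: "integrable (M \<Otimes>\<^sub>M N) (f v)" if "v \<in> lattice_of V" for v
    using integrable_pair_exp(1)[OF M N pos[OF that]] ae[of v] by (subst integrable_cong_AE) auto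
  have nf: "norm (f v z) = f v z" for v z by (simp add: f_def)
  have 2: "(\<lambda>v. norm (f v z)) summable_on lattice_of V" for z
    using summable_theta[OF V, of "fst z + snd z" u] by (cases "fst z + snd z > 0") (auto simp: f_def mult.commute)
  have L: "(\<integral>z. f v z \<partial>(M \<Otimes>\<^sub>M N)) = laplace M ((norm (u + v))\<^sup>2) * laplace N ((norm (u + v))\<^sup>2)"
    if "v \<in> lattice_of V" for v
    unfolding integrable_pair_exp(2)[OF M N pos[OF that], symmetric]
    using ae by (intro integral_cong_AE) auto
  have 3: "(\<lambda>v. \<integral>z. norm (f v z) \<partial>(M \<Otimes>\<^sub>M N)) summable_on lattice_of V"
    unfolding nf using s1 by (subst summable_on_cong[OF L]) auto
  note hs = has_sum_integral[OF countable_lattice 1 2 3]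
  have pt: "(\<Sum>\<^sub>\<infinity>v\<in>lattice_of V. f v z) = indicator {0<..} (fst z + snd z) * theta V u (fst z + snd z)" for z
    unfolding f_def theta_def by (subst infsum_cmult_right') (simp add: mult.commute)
  have i1: "integrable (M \<Otimes>\<^sub>M N) (\<lambda>z. indicator {0<..} (fst z + snd z) * theta V u (fst z + snd z))"
    using hs(1) unfolding pt .
  have e1: "(\<Sum>\<^sub>\<infinity>v\<in>lattice_of V. laplace M ((norm (u + v))\<^sup>2) * laplace N ((norm (u + v))\<^sup>2))
      = (\<integral>z. indicator {0<..} (fst z + snd z) * theta V u (fst z + snd z) \<partial>(M \<Otimes>\<^sub>M N))"
    using infsumI[OF hs(2)] unfolding pt by (subst infsum_cong[OF L[symmetric]]) auto
  obtain C where C: "\<And>t. t \<ge> a \<Longrightarrow> \<bar>regularized_theta V u t\<bar> \<le> C * exp (- (c * t))"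
    using regularized_theta_bound[OF V c(2) c(1) a(1)] by blast
  note meas = regularized_theta_measurable[OF V, of u]
  have i2: "integrable (M \<Otimes>\<^sub>M N) (\<lambda>(t, s). regularized_theta V u (t + s))"
    by (rule integrable_pair_exp_bounded[OF M N c(1) a(2) meas C])
  \<comment> \<open>The background density is the indicator-weighted theta minus its regularization;
    integrability of these two over the product measure makes the background integral
    finite.\<close>
  define k where "k t = indicator {0<..<1} t *\<^sub>R (pi powr (real CARD('n) / 2) / t powr (real CARD('n) / 2))" for t :: real
  have k: "k t = indicator {0<..} t * theta V u t - regularized_theta V u t" for t
    by (auto simp: k_def regularized_theta_def powr_divide indicator_def)
  have [measurable]: "k \<in> borel_measurable borel" unfolding k_def by measurable
  have "set_lebesgue_integral (convolution M N) {0<..<1} (\<lambda>t. pi powr (real CARD('n) / 2) / t powr (real CARD('n) / 2))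
    = (\<integral>t. k t \<partial>convolution M N)"
    by (simp add: set_lebesgue_integral_def k_def)
  also have "\<dots> = (\<integral>z. k (fst z + snd z) \<partial>(M \<Otimes>\<^sub>M N))"
    unfolding convolution_def by (subst integral_distr) (auto simp: case_prod_unfold)
  also have "\<dots> = (\<integral>z. indicator {0<..} (fst z + snd z) * theta V u (fst z + snd z) \<partial>(M \<Otimes>\<^sub>M N))
     - (\<integral>z. regularized_theta V u (fst z + snd z) \<partial>(M \<Otimes>\<^sub>M N))"
    unfolding k using i1 i2 by (intro Bochner_Integration.integral_diff) (auto simp: case_prod_unfold)
  finally have "(\<Sum>\<^sub>\<infinity>v\<in>lattice_of V. laplace M ((norm (u + v))\<^sup>2) * laplace N ((norm (u + v))\<^sup>2))
      - set_lebesgue_integral (convolution M N) {0<..<1} (\<lambda>t. pi powr (real CARD('n) / 2) / t powr (real CARD('n) / 2))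
    = (\<integral>(t, s). regularized_theta V u (t + s) \<partial>(M \<Otimes>\<^sub>M N))"
    unfolding e1 by (simp add: case_prod_unfold)
  also have "\<dots> = (\<integral>s. \<integral>t. regularized_theta V u (t + s) \<partial>M \<partial>N)"
    by (rule integral_snd[OF i2, symmetric])
  finally show "(\<Sum>\<^sub>\<infinity>v\<in>lattice_of V. laplace M ((norm (u + v))\<^sup>2) * laplace N ((norm (u + v))\<^sup>2))
      - set_lebesgue_integral (convolution M N) {0<..<1} (\<lambda>t. pi powr (real CARD('n) / 2) / t powr (real CARD('n) / 2))
      = (\<integral>s. \<integral>t. regularized_theta V u (t + s) \<partial>M \<partial>N)" .
qed

lemma tendsto_sum_laplace_minus_convolution:
  fixes \<nu> :: "real \<Rightarrow> real measure"
  assumes M: "laplace_finite M" and a: "\<alpha> > 0" "AE t in M. \<alpha> \<le> t"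
    and u: "u \<notin> lattice_of V"
    and \<nu>: "\<And>a. a > 0 \<Longrightarrow> laplace_finite (\<nu> a)"
    and lim: "\<And>s. s > 0 \<Longrightarrow> ((\<lambda>a. laplace (\<nu> a) s) \<longlongrightarrow> 1) (at_right 0)"
    and sum: "\<And>a. a > 0 \<Longrightarrow> (\<lambda>v. laplace (\<nu> a) ((norm (u + v))\<^sup>2)) summable_on lattice_of V"
  shows "((\<lambda>a. (\<Sum>\<^sub>\<infinity>v\<in>lattice_of V. laplace M ((norm (u + v))\<^sup>2) * laplace (\<nu> a) ((norm (u + v))\<^sup>2))
      - set_lebesgue_integral (convolution M (\<nu> a)) {0<..<1} (\<lambda>t. pi powr (real CARD('n) / 2) / t powr (real CARD('n) / 2)))
      \<longlongrightarrow> (\<integral>t. regularized_theta V u t \<partial>M)) (at_right 0)"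
proof -
  interpret M: sigma_finite_measure M by (rule laplace_finite_sigma_finite[OF M])
  note [measurable_cong] = laplace_finiteD(1)[OF M]
  note [measurable] = regularized_theta_measurable[OF V]
  obtain c where c: "c > 0" "\<And>v. v \<in> lattice_of V \<Longrightarrow> c \<le> (norm (u + v))\<^sup>2"
    using lattice_distance[OF V u] by blast
  obtain C where C: "\<And>t. t \<ge> \<alpha> \<Longrightarrow> \<bar>regularized_theta V u t\<bar> \<le> C * exp (- (c * t))"
    using regularized_theta_bound[OF V c(2) c(1) a(1)] by blast
  note sh = tendsto_shifted_integral[OF M c(1) a regularized_theta_measurable[OF V] C regularized_theta_right_continuous[OF V]]
  have "((\<lambda>a. \<integral>s. (\<integral>t. regularized_theta V u (t + s) \<partial>M) \<partial>\<nu> a) \<longlongrightarrow> (\<integral>t. regularized_theta V u t \<partial>M)) (at_right 0)"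
    by (rule tendsto_laplace_integral[OF \<nu> lim _ c(1) sh(2) sh(1)]) measurable
  moreover have "\<forall>\<^sub>F a in at_right 0. (\<integral>s. (\<integral>t. regularized_theta V u (t + s) \<partial>M) \<partial>\<nu> a)
    = (\<Sum>\<^sub>\<infinity>v\<in>lattice_of V. laplace M ((norm (u + v))\<^sup>2) * laplace (\<nu> a) ((norm (u + v))\<^sup>2))
      - set_lebesgue_integral (convolution M (\<nu> a)) {0<..<1} (\<lambda>t. pi powr (real CARD('n) / 2) / t powr (real CARD('n) / 2))"
    using eventually_at_right_less[of "0::real"]
    by eventually_elim (rule sum_laplace_minus_convolution(2)[OF M \<nu> a u sum, symmetric])
  ultimately show ?thesis by (rule Lim_transform_eventually)
qed

text \<open>Either sum alone diverges. The difference is the integral of the difference of two theta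
  functions, which tends to 0 at 0+, so for fixed \<alpha> the contribution of
  \<open>fstar \<alpha>\<close> disappears in the inner limit.\<close>

lemma tendsto_sum_laplace_diff:
  fixes \<nu> :: "real \<Rightarrow> real measure"
  assumes u: "u \<notin> lattice_of V" "u' \<notin> lattice_of V"
    and \<nu>: "\<And>a. a > 0 \<Longrightarrow> laplace_finite (\<nu> a)"
    and lim: "\<And>s. s > 0 \<Longrightarrow> ((\<lambda>a. laplace (\<nu> a) s) \<longlongrightarrow> 1) (at_right 0)"
    and sum: "\<And>a. a > 0 \<Longrightarrow> (\<lambda>v. laplace (\<nu> a) ((norm (u + v))\<^sup>2)) summable_on lattice_of V"
      "\<And>a. a > 0 \<Longrightarrow> (\<lambda>v. laplace (\<nu> a) ((norm (u' + v))\<^sup>2)) summable_on lattice_of V"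
  shows "((\<lambda>a. (\<Sum>\<^sub>\<infinity>v\<in>lattice_of V. laplace (\<nu> a) ((norm (u + v))\<^sup>2))
      - (\<Sum>\<^sub>\<infinity>v\<in>lattice_of V. laplace (\<nu> a) ((norm (u' + v))\<^sup>2))) \<longlongrightarrow> 0) (at_right 0)"
proof -
  obtain c1 where c1: "c1 > 0" "\<And>v. v \<in> lattice_of V \<Longrightarrow> c1 \<le> (norm (u + v))\<^sup>2"
    using lattice_distance[OF V u(1)] by blast
  obtain c2 where c2: "c2 > 0" "\<And>v. v \<in> lattice_of V \<Longrightarrow> c2 \<le> (norm (u' + v))\<^sup>2"
    using lattice_distance[OF V u(2)] by blast
  define c where "c = min c1 c2"
  have c: "c > 0" "\<And>v. v \<in> lattice_of V \<Longrightarrow> c \<le> (norm (u + v))\<^sup>2" "\<And>v. v \<in> lattice_of V \<Longrightarrow> c \<le> (norm (u' + v))\<^sup>2"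
    using c1 c2 by (auto simp: c_def min_le_iff_disj)
  define \<psi> where "\<psi> s = indicator {0<..} s * theta V u s - indicator {0<..} s * theta V u' s" for s
  obtain C where C: "\<And>t. t > 0 \<Longrightarrow> \<bar>theta V u t - theta V u' t\<bar> \<le> C * exp (- (c * t))"
    using theta_diff_bound(1)[OF V c(2,3,1)] by blast
  have m: "(\<lambda>s. indicator {0<..} s * theta V w s) \<in> borel_measurable borel" for w
    using borel_measurable_continuous_on_indicator[OF _ continuous_theta[OF V, of w]] by simp
  have [measurable]: "\<psi> \<in> borel_measurable borel"
    unfolding \<psi>_def by (intro borel_measurable_diff m)
  have "((\<lambda>t. theta V u t - theta V u' t) \<longlongrightarrow> 0) (at_right 0)"
    by (rule theta_diff_bound(2)[OF V c(2,3,1)])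
  then have l: "(\<psi> \<longlongrightarrow> 0) (at_right 0)"
    by (rule Lim_transform_eventually)
      (use eventually_at_right_less[of "0::real"] in \<open>auto simp: \<psi>_def elim!: eventually_mono\<close>)
  have "((\<lambda>a. \<integral>s. \<psi> s \<partial>\<nu> a) \<longlongrightarrow> 0) (at_right 0)"
    by (rule tendsto_laplace_integral[OF \<nu> lim _ c(1) _ l, of C]) (auto simp: \<psi>_def C)
  moreover have "\<forall>\<^sub>F a in at_right 0. (\<integral>s. \<psi> s \<partial>\<nu> a) = (\<Sum>\<^sub>\<infinity>v\<in>lattice_of V. laplace (\<nu> a) ((norm (u + v))\<^sup>2))
      - (\<Sum>\<^sub>\<infinity>v\<in>lattice_of V. laplace (\<nu> a) ((norm (u' + v))\<^sup>2))"
    using eventually_at_right_less[of "0::real"]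
  proof eventually_elim
    case (elim a)
    note s1 = sum_laplace_eq_theta[OF \<nu>[OF elim] u(1) sum(1)[OF elim]]
    note s2 = sum_laplace_eq_theta[OF \<nu>[OF elim] u(2) sum(2)[OF elim]]
    show ?case unfolding s1(2) s2(2) \<psi>_def
      by (rule Bochner_Integration.integral_diff[OF s1(1) s2(1)])
  qed
  ultimately show ?thesis by (rule Lim_transform_eventually)
qed

end

section \<open>The periodic kernel\<close>

text \<open>What (W1) and (W2) provide for each part of the signed measure separately, with |q|^2
  replaced by an arbitrary s > 0.\<close>

definition kernel_part :: "real^'n^'n \<Rightarrow> real measure \<Rightarrow> bool" where
  "kernel_part V P \<longleftrightarrow> sets P = sets borel \<and>
     (\<forall>\<alpha>>0. \<forall>s>0. set_integrable P {\<alpha>..} (\<lambda>t. exp (- (s * t)))) \<and>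
     (\<forall>w0\<in>dual_lattice V - {0}. (\<forall>w\<in>dual_lattice V - {0}. norm w0 \<le> norm w) \<longrightarrow>
        set_integrable P {0<..<1} (\<lambda>t. t powr (- real CARD('n) / 2) * exp (- (pi\<^sup>2 * (norm w0)\<^sup>2 / t))))"

lemma laplace_finite_restrict:
  assumes P: "kernel_part V P" and \<alpha>: "\<alpha> > 0"
  shows "laplace_finite (density P (indicator {\<alpha>..}))"
    and "AE t in density P (indicator {\<alpha>..}). \<alpha> \<le> t"
proof -
  have sP [measurable_cong]: "sets P = sets borel" using P by (simp add: kernel_part_def)
  have A: "{\<alpha>..} \<in> sets P" by simp
  show ae: "AE t in density P (indicator {\<alpha>..}). \<alpha> \<le> t"
    by (subst AE_density) (auto simp: indicator_def)
  have "integrable (density P (indicator {\<alpha>..})) (\<lambda>t. exp (- (s * t)))" if "s > 0" for s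
    using P that \<alpha> by (subst density_indicator(1)[OF A]) (auto simp: kernel_part_def)
  moreover have "AE t in density P (indicator {\<alpha>..}). 0 < t"
    using ae by eventually_elim (use \<alpha> in auto)
  ultimately show "laplace_finite (density P (indicator {\<alpha>..}))"
    by (simp add: laplace_finite_def sP)
qed

context
  fixes V :: "real^'n^'n" and P :: "real measure" and u :: "real^'n"
  assumes V: "det V = 1" and P: "kernel_part V P" and u: "u \<notin> lattice_of V"
begin

lemma kernel_part_sets: "sets P = sets borel"
  using P by (simp add: kernel_part_def)

text \<open>For t >= 1 the exponent |u+v|^2 t is at least |u+v|^2/2 + ct/2: one half gives
  summability over the lattice, the other integrability against \<open>P\<close>.\<close>

lemma has_sum_large_time:
  "set_integrable P {1..} (regularized_theta V u)"
  "((\<lambda>v. set_lebesgue_integral P {1..} (\<lambda>t. exp (- ((norm (u + v))\<^sup>2 * t))))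
      has_sum set_lebesgue_integral P {1..} (regularized_theta V u)) (lattice_of V)"
proof -
  note [measurable_cong] = kernel_part_sets
  note [measurable] = regularized_theta_measurable[OF V]
  define M where "M = density P (indicator {1..})"
  have M: "laplace_finite M" and ae: "AE t in M. 1 \<le> t"
    unfolding M_def by (rule laplace_finite_restrict[OF P]; simp)+
  note [measurable_cong] = laplace_finiteD(1)[OF M]
  obtain c where c: "c > 0" "\<And>v. v \<in> lattice_of V \<Longrightarrow> c \<le> (norm (u + v))\<^sup>2"
    using lattice_distance[OF V u] by blast
  have A: "{1..} \<in> sets P" by simp
  have L: "laplace M s = set_lebesgue_integral P {1..} (\<lambda>t. exp (- (s * t)))" for s
    unfolding laplace_def M_def by (rule density_indicator(2)[OF A]) measurable
  have s: "(\<lambda>v. laplace M ((norm (u + v))\<^sup>2)) summable_on lattice_of V"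
  proof (rule summable_on_comparison_test)
    show "(\<lambda>v. exp (- (1/2 * (norm (u + v))\<^sup>2)) * laplace M (c / 2)) summable_on lattice_of V"
      by (intro summable_on_cmult_left summable_theta[OF V]) simp
    fix v assume v: "v \<in> lattice_of V"
    have pos: "(norm (u + v))\<^sup>2 > 0" using c(1) c(2)[OF v] by linarith
    have "laplace M ((norm (u + v))\<^sup>2) \<le> (\<integral>t. exp (- (1/2 * (norm (u + v))\<^sup>2)) * exp (- (c / 2 * t)) \<partial>M)"
      unfolding laplace_def
    proof (rule integral_mono_AE)
      show "AE t in M. exp (- ((norm (u + v))\<^sup>2 * t)) \<le> exp (- (1/2 * (norm (u + v))\<^sup>2)) * exp (- (c / 2 * t))"
        using ae
      proof eventually_elim
        case (elim t)
        have "(norm (u + v))\<^sup>2 * 1 \<le> (norm (u + v))\<^sup>2 * t" using elim by (intro mult_left_mono) auto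
        moreover have "c * t \<le> (norm (u + v))\<^sup>2 * t" using elim c(2)[OF v] by (intro mult_right_mono) auto
        ultimately have "1/2 * (norm (u + v))\<^sup>2 + c / 2 * t \<le> (norm (u + v))\<^sup>2 * t" by simp
        then show ?case by (simp add: exp_add[symmetric])
      qed
      show "integrable M (\<lambda>t. exp (- ((norm (u + v))\<^sup>2 * t)))" by (rule laplace_finiteD(3)[OF M pos])
      show "integrable M (\<lambda>t. exp (- (1/2 * (norm (u + v))\<^sup>2)) * exp (- (c / 2 * t)))"
        using c(1) by (intro integrable_mult_right laplace_finiteD(3)[OF M]) simp
    qed
    also have "\<dots> = exp (- (1/2 * (norm (u + v))\<^sup>2)) * laplace M (c / 2)"
      unfolding laplace_def by (rule integral_mult_right_zero)
    finally show "laplace M ((norm (u + v))\<^sup>2) \<le> exp (- (1/2 * (norm (u + v))\<^sup>2)) * laplace M (c / 2)" .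
  qed (rule laplace_nonneg)
  note th = sum_laplace_eq_theta[OF V M u s]
  have [measurable]: "(\<lambda>t. indicator {0<..} t * theta V u t) \<in> borel_measurable M" using th(1) by simp
  have eq: "AE t in M. regularized_theta V u t = indicator {0<..} t * theta V u t"
    using ae by eventually_elim (simp add: regularized_theta_def)
  have "integrable M (regularized_theta V u)"
    using th(1) eq by (subst integrable_cong_AE) auto
  then show "set_integrable P {1..} (regularized_theta V u)"
    unfolding M_def by (subst (asm) density_indicator(1)[OF A]) auto
  have "(\<integral>t. indicator {0<..} t * theta V u t \<partial>M) = (\<integral>t. regularized_theta V u t \<partial>M)"
    using eq by (intro integral_cong_AE) auto
  also have "\<dots> = set_lebesgue_integral P {1..} (regularized_theta V u)"
    unfolding M_def by (rule density_indicator(2)[OF A]) measurable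
  finally have "(\<Sum>\<^sub>\<infinity>v\<in>lattice_of V. laplace M ((norm (u + v))\<^sup>2)) = set_lebesgue_integral P {1..} (regularized_theta V u)"
    using th(2) by simp
  then show "((\<lambda>v. set_lebesgue_integral P {1..} (\<lambda>t. exp (- ((norm (u + v))\<^sup>2 * t))))
      has_sum set_lebesgue_integral P {1..} (regularized_theta V u)) (lattice_of V)"
    using has_sum_infsum[OF s] by (simp add: L)
qed

text \<open>Each dual term is at most \<open>r w * G t\<close>, with \<open>r\<close> summable by
  the comparison with the shortest vector and \<open>G\<close> integrable by (W2). This product
  majorant justifies exchanging sum and integral.\<close>

lemma has_sum_small_time:
  "set_integrable P {0<..<1} (regularized_theta V u)"
  "((\<lambda>w. cis (2 * pi * (w \<bullet> u)) * complex_of_real (set_lebesgue_integral P {0<..<1}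
        (\<lambda>t. (pi / t) powr (real CARD('n) / 2) * exp (- (pi\<^sup>2 * (norm w)\<^sup>2 / t)))))
      has_sum of_real (set_lebesgue_integral P {0<..<1} (regularized_theta V u))) (dual_lattice V - {0})"
proof -
  note [measurable_cong] = kernel_part_sets
  note [measurable] = regularized_theta_measurable[OF V]
  obtain w0 where w0: "w0 \<in> dual_lattice V - {0}" "\<And>w. w \<in> dual_lattice V - {0} \<Longrightarrow> norm w0 \<le> norm w"
    using dual_minimal_vector[OF V] by blast
  let ?c = "\<lambda>t. (pi / t) powr (real CARD('n) / 2)"
  define r where "r w = exp (- (pi\<^sup>2 * ((norm w)\<^sup>2 - (norm w0)\<^sup>2)))" for w :: "real^'n"
  have r: "r summable_on dual_lattice V - {0}" "\<And>w. r w \<ge> 0"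
    unfolding r_def by (rule summable_dual_relative[OF V w0(1)]) simp
  define G where "G t = indicator {0<..<1} t * (?c t * exp (- (pi\<^sup>2 * (norm w0)\<^sup>2 / t)))" for t
  have G0: "G t \<ge> 0" for t by (simp add: G_def)
  have "set_integrable P {0<..<1} (\<lambda>t. t powr (- real CARD('n) / 2) * exp (- (pi\<^sup>2 * (norm w0)\<^sup>2 / t)))"
    using P w0 unfolding kernel_part_def by blast
  then have "integrable P (\<lambda>t. pi powr (real CARD('n) / 2) *
      (indicator {0<..<1} t *\<^sub>R (t powr (- real CARD('n) / 2) * exp (- (pi\<^sup>2 * (norm w0)\<^sup>2 / t)))))"
    unfolding set_integrable_def by (rule integrable_mult_right)
  moreover have "pi powr (real CARD('n) / 2) *
      (indicator {0<..<1} t *\<^sub>R (t powr (- real CARD('n) / 2) * exp (- (pi\<^sup>2 * (norm w0)\<^sup>2 / t)))) = G t" for t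
  proof -
    have "- real CARD('n) / 2 = - (real CARD('n) / 2)" by simp
    then have "t powr (- real CARD('n) / 2) = 1 / t powr (real CARD('n) / 2)"
      by (simp only: powr_minus_divide)
    then show ?thesis by (simp add: G_def indicator_def powr_divide)
  qed
  ultimately have Gi: "integrable P G" by (simp only:)
  define f where "f w t = cis (2 * pi * (w \<bullet> u)) *
    complex_of_real (indicator {0<..<1} t * (?c t * exp (- (pi\<^sup>2 * (norm w)\<^sup>2 / t))))" for w t
  have [measurable]: "f w \<in> borel_measurable borel" for w unfolding f_def by measurable
  have nf: "norm (f w t) \<le> r w * G t" if w: "w \<in> dual_lattice V - {0}" for w t
  proof (cases "t \<in> {0<..<1}")
    case True
    have "?c t * exp (- (pi\<^sup>2 * (norm w)\<^sup>2 / t)) \<le> ?c t * (exp (- (pi\<^sup>2 * (norm w0)\<^sup>2 / t)) * r w)"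
      unfolding r_def using gaussian_relative_bound[OF w0(2)[OF w], of t] True by (intro mult_left_mono) auto
    then show ?thesis using True by (simp add: f_def G_def norm_mult mult_ac)
  qed (simp add: f_def G_def)
  have 1: "integrable P (f w)" if w: "w \<in> dual_lattice V - {0}" for w
  proof (rule Bochner_Integration.integrable_bound)
    show "integrable P (\<lambda>t. r w * G t)" by (intro integrable_mult_right Gi)
    show "f w \<in> borel_measurable P" by measurable
    show "AE t in P. norm (f w t) \<le> norm (r w * G t)"
      using nf[OF w] by (auto intro: order_trans[OF _ abs_ge_self])
  qed
  have 2: "(\<lambda>w. norm (f w t)) summable_on dual_lattice V - {0}" for t
    by (rule summable_on_comparison_test[OF summable_on_cmult_left[OF r(1)] nf]) auto
  have 3: "(\<lambda>w. \<integral>t. norm (f w t) \<partial>P) summable_on dual_lattice V - {0}"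
  proof (rule summable_on_comparison_test)
    show "(\<lambda>w. r w * (\<integral>t. G t \<partial>P)) summable_on dual_lattice V - {0}"
      by (intro summable_on_cmult_left r)
    fix w assume w: "w \<in> dual_lattice V - {0}"
    have "(\<integral>t. norm (f w t) \<partial>P) \<le> (\<integral>t. r w * G t \<partial>P)"
      by (intro integral_mono integrable_norm 1 integrable_mult_right Gi nf w)
    then show "(\<integral>t. norm (f w t) \<partial>P) \<le> r w * (\<integral>t. G t \<partial>P)" by simp
  qed simp
  have "countable (dual_lattice V - {0})" using countable_dual[OF V] by (rule countable_subset[rotated]) auto
  note hs = has_sum_integral[OF this 1 2 3]
  have pt: "(\<Sum>\<^sub>\<infinity>w\<in>dual_lattice V - {0}. f w t) = complex_of_real (indicator {0<..<1} t *\<^sub>R regularized_theta V u t)" for t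
  proof (cases "t \<in> {0<..<1}")
    case True
    then show ?thesis
      using infsumI[OF theta_dual_expansion[OF V, of t u]] by (simp add: f_def regularized_theta_def)
  qed (simp add: f_def)
  have "integrable P (\<lambda>t. Re (complex_of_real (indicator {0<..<1} t *\<^sub>R regularized_theta V u t)))"
    using hs(1) unfolding pt by (rule integrable_Re)
  then show "set_integrable P {0<..<1} (regularized_theta V u)"
    by (simp add: set_integrable_def)
  have "(\<integral>t. f w t \<partial>P) = cis (2 * pi * (w \<bullet> u)) * complex_of_real (set_lebesgue_integral P {0<..<1}
        (\<lambda>t. ?c t * exp (- (pi\<^sup>2 * (norm w)\<^sup>2 / t))))" for w
    unfolding f_def set_lebesgue_integral_def integral_mult_right_zero integral_complex_of_real by simp
  then show "((\<lambda>w. cis (2 * pi * (w \<bullet> u)) * complex_of_real (set_lebesgue_integral P {0<..<1}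
        (\<lambda>t. ?c t * exp (- (pi\<^sup>2 * (norm w)\<^sup>2 / t)))))
      has_sum of_real (set_lebesgue_integral P {0<..<1} (regularized_theta V u))) (dual_lattice V - {0})"
    using hs(2) unfolding pt integral_complex_of_real set_lebesgue_integral_def by simp
qed

lemma regularized_theta_integrable:
  "set_integrable P {0<..} (regularized_theta V u)"
  "set_lebesgue_integral P {0<..} (regularized_theta V u) =
     set_lebesgue_integral P {1..} (regularized_theta V u) + set_lebesgue_integral P {0<..<1} (regularized_theta V u)"
proof -
  note [measurable_cong] = kernel_part_sets
  have U: "{0<..} = {1..} \<union> {0<..<1::real}" by auto
  show "set_integrable P {0<..} (regularized_theta V u)"
    unfolding U by (intro set_integrable_Un has_sum_large_time(1) has_sum_small_time(1)) auto
  show "set_lebesgue_integral P {0<..} (regularized_theta V u) =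
     set_lebesgue_integral P {1..} (regularized_theta V u) + set_lebesgue_integral P {0<..<1} (regularized_theta V u)"
    unfolding U by (intro set_integral_Un has_sum_large_time(1) has_sum_small_time(1)) auto
qed

lemma tendsto_restricted_integral:
  "((\<lambda>\<alpha>. \<integral>t. regularized_theta V u t \<partial>density P (indicator {\<alpha>..}))
     \<longlongrightarrow> set_lebesgue_integral P {0<..} (regularized_theta V u)) (at_right 0)"
proof -
  note [measurable_cong] = kernel_part_sets
  note [measurable] = regularized_theta_measurable[OF V]
  have eq: "(\<integral>t. regularized_theta V u t \<partial>density P (indicator {\<alpha>..}))
      = (\<integral>t. indicator {\<alpha>..} t *\<^sub>R regularized_theta V u t \<partial>P)" for \<alpha>
    by (subst density_indicator(2)) (auto simp: set_lebesgue_integral_def)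
  show ?thesis
    unfolding eq set_lebesgue_integral_def tendsto_at_iff_sequentially o_def
  proof (intro allI impI)
    fix X :: "nat \<Rightarrow> real"
    assume X: "\<forall>i. X i \<in> {0<..} - {0}" "X \<longlonglongrightarrow> 0"
    show "(\<lambda>i. \<integral>t. indicator {X i..} t *\<^sub>R regularized_theta V u t \<partial>P)
        \<longlonglongrightarrow> (\<integral>t. indicator {0<..} t *\<^sub>R regularized_theta V u t \<partial>P)"
    proof (rule integral_dominated_convergence)
      show "integrable P (\<lambda>t. norm (indicator {0<..} t *\<^sub>R regularized_theta V u t))"
        using regularized_theta_integrable(1) unfolding set_integrable_def by (rule integrable_norm)
      show "AE t in P. norm (indicator {X i..} t *\<^sub>R regularized_theta V u t)
          \<le> norm (indicator {0<..} t *\<^sub>R regularized_theta V u t)" for i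
        using X(1) by (intro AE_I2) (auto simp: indicator_def dest: spec[of _ i])
      show "AE t in P. (\<lambda>i. indicator {X i..} t *\<^sub>R regularized_theta V u t)
          \<longlonglongrightarrow> indicator {0<..} t *\<^sub>R regularized_theta V u t"
      proof (rule AE_I2)
        fix t
        have "\<forall>\<^sub>F i in sequentially. indicator {0<..} t *\<^sub>R regularized_theta V u t
            = indicator {X i..} t *\<^sub>R regularized_theta V u t"
        proof (cases "t > 0")
          case True
          have "\<forall>\<^sub>F i in sequentially. X i < t" using X(2) True by (rule order_tendstoD(2))
          then show ?thesis by eventually_elim (use True in auto)
        next
          case False
          have "\<not> X i \<le> t" for i using X(1) False by (auto simp: not_le dest: spec[of _ i])
          then show ?thesis using False by (auto simp: indicator_def)
        qed
        then show "(\<lambda>i. indicator {X i..} t *\<^sub>R regularized_theta V u t)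
            \<longlonglongrightarrow> indicator {0<..} t *\<^sub>R regularized_theta V u t"
          by (rule Lim_transform_eventually[OF tendsto_const])
      qed
    qed measurable
  qed
qed

end

lemma has_sum_diff:
  fixes f g :: "'i \<Rightarrow> 'b::topological_ab_group_add"
  assumes "(f has_sum a) I" "(g has_sum b) I"
  shows "((\<lambda>i. f i - g i) has_sum (a - b)) I"
proof -
  have "((\<lambda>i. - g i) has_sum - b) I" using assms(2) by (simp add: has_sum_uminus)
  from has_sum_add[OF assms(1) this] show ?thesis by simp
qed

text \<open>For each part of the measure both the lattice series and the dual series converge on
  their own, so they may be subtracted and regrouped. The dual series sums to the integral of a real
  function, hence the kernel is real.\<close>

lemma K_per_eq:
  fixes V :: "real^'n^'n"
  assumes V: "det V = 1" and P: "kernel_part V (pos_part \<mu>)" "kernel_part V (neg_part \<mu>)"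
    and u: "x - y \<notin> lattice_of V"
  shows "K_per V \<mu> x y = of_real (signed_integral \<mu> {0<..} (regularized_theta V (x - y)))"
proof -
  let ?u = "x - y"
  note L1 = has_sum_large_time(2)[OF V P(1) u] and L2 = has_sum_large_time(2)[OF V P(2) u]
  note S1 = has_sum_small_time(2)[OF V P(1) u] and S2 = has_sum_small_time(2)[OF V P(2) u]
  have "((\<lambda>v. signed_integral \<mu> {1..} (\<lambda>t. exp (- (norm (?u + v))\<^sup>2 * t)))
      has_sum signed_integral \<mu> {1..} (regularized_theta V ?u)) (lattice_of V)"
    using has_sum_diff[OF L1 L2] by (simp add: signed_integral_def)
  then have L: "(\<Sum>\<^sub>\<infinity>v\<in>lattice_of V. signed_integral \<mu> {1..} (\<lambda>t. exp (- (norm (?u + v))\<^sup>2 * t)))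
      = signed_integral \<mu> {1..} (regularized_theta V ?u)"
    by (rule infsumI)
  have si: "set_lebesgue_integral M {0<..<1} (\<lambda>t. (pi / t) powr (real CARD('n) / 2) * exp (- (pi\<^sup>2 * (norm w)\<^sup>2 / t)))
    = set_lebesgue_integral M {0<..<1} (\<lambda>t. pi powr (real CARD('n) / 2) / t powr (real CARD('n) / 2)
                 * exp (- pi\<^sup>2 * (norm w)\<^sup>2 / t))" for M :: "real measure" and w :: "real^'n"
    unfolding set_lebesgue_integral_def
    by (intro Bochner_Integration.integral_cong) (auto simp: indicator_def powr_divide)
  have e: "exp (2 * complex_of_real pi * \<i> * of_real (w \<bullet> ?u)) = cis (2 * pi * (w \<bullet> ?u))" for w
    by (simp add: cis_conv_exp mult_ac)
  have "((\<lambda>w. exp (2 * of_real pi * \<i> * of_real (w \<bullet> ?u)) *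
        of_real (signed_integral \<mu> {0<..<1}
          (\<lambda>t. pi powr (real CARD('n) / 2) / t powr (real CARD('n) / 2)
                 * exp (- pi\<^sup>2 * (norm w)\<^sup>2 / t))))
      has_sum of_real (signed_integral \<mu> {0<..<1} (regularized_theta V ?u))) (dual_lattice V - {0})"
    using has_sum_diff[OF S1 S2] unfolding si e by (simp add: signed_integral_def right_diff_distrib)
  then have S: "(\<Sum>\<^sub>\<infinity>w\<in>dual_lattice V - {0}. exp (2 * of_real pi * \<i> * of_real (w \<bullet> ?u)) *
        of_real (signed_integral \<mu> {0<..<1}
          (\<lambda>t. pi powr (real CARD('n) / 2) / t powr (real CARD('n) / 2)
                 * exp (- pi\<^sup>2 * (norm w)\<^sup>2 / t))))
      = of_real (signed_integral \<mu> {0<..<1} (regularized_theta V ?u))"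
    by (rule infsumI)
  have "signed_integral \<mu> {0<..} (regularized_theta V ?u) =
      signed_integral \<mu> {1..} (regularized_theta V ?u) + signed_integral \<mu> {0<..<1} (regularized_theta V ?u)"
    unfolding signed_integral_def
      regularized_theta_integrable(2)[OF V P(1) u] regularized_theta_integrable(2)[OF V P(2) u] by simp
  then show ?thesis unfolding K_per_def L S by simp
qed

section \<open>Convergence factors\<close>

lemma exists_norm_square:
  fixes s :: real
  assumes "s > 0"
  obtains z :: "real^'n" where "z \<noteq> 0" "(norm z)\<^sup>2 = s"
proof -
  obtain z :: "real^'n" where z: "norm z = sqrt s"
    using vector_choose_size[of "sqrt s"] assms by auto
  then have "z \<noteq> 0" "(norm z)\<^sup>2 = s" using assms by auto
  then show thesis using that by blast
qed

lemma weak_G_type_kernel_part: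
  fixes V :: "real^'n^'n"
  assumes f: "weak_G_type V f fstar \<mu>"
  shows "kernel_part V (pos_part \<mu>)" "kernel_part V (neg_part \<mu>)"
proof -
  have sets: "sets (pos_part \<mu>) = sets borel" "sets (neg_part \<mu>) = sets borel"
    using f by (auto simp: weak_G_type_def signed_measure_on_pos_def measure_on_pos_def)
  have 1: "signed_integrable \<mu> {\<alpha>..} (\<lambda>t. exp (- (s * t)))" if "\<alpha> > 0" "s > 0" for \<alpha> s
  proof -
    obtain q :: "real^'n" where "q \<noteq> 0" "(norm q)\<^sup>2 = s" using exists_norm_square[OF \<open>s > 0\<close>] .
    then show ?thesis using f \<open>\<alpha> > 0\<close> by (auto simp: weak_G_type_def)
  qed
  have 2: "signed_integrable \<mu> {0<..<1} (\<lambda>t. t powr (- real CARD('n) / 2) * exp (- (pi\<^sup>2 * (norm w0)\<^sup>2 / t)))"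
    if "w0 \<in> dual_lattice V - {0}" "\<forall>w\<in>dual_lattice V - {0}. norm w0 \<le> norm w" for w0
    using f that by (simp add: weak_G_type_def)
  show "kernel_part V (pos_part \<mu>)" "kernel_part V (neg_part \<mu>)"
    using sets 1 2 unfolding kernel_part_def signed_integrable_def by blast+
qed

text \<open>The value at the origin may be infinite, so real transforms are used for z != 0 only;
  the squared lengths of such z exhaust all s > 0, as \<open>laplace_finite\<close> demands.\<close>

lemma laplace_transform_ennreal:
  assumes \<nu>: "measure_on_pos \<nu>"
    and fin: "\<And>z::real^'n. z \<noteq> 0 \<Longrightarrow> g z < \<infinity>"
    and eq: "\<And>z::real^'n. z \<noteq> 0 \<Longrightarrow> g z = (\<integral>\<^sup>+t\<in>{0<..}. ennreal (exp (- (norm z)\<^sup>2 * t)) \<partial>\<nu>)"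
  shows "laplace_finite \<nu>" and "z \<noteq> 0 \<Longrightarrow> g z = ennreal (laplace \<nu> ((norm z)\<^sup>2))"
proof -
  have sets [measurable_cong]: "sets \<nu> = sets borel" and null: "emeasure \<nu> {..0} = 0"
    using \<nu> by (auto simp: measure_on_pos_def)
  have ae: "AE t in \<nu>. 0 < t"
    by (rule AE_I[of _ _ "{..0}"]) (auto simp: null sets)
  have g: "g z = (\<integral>\<^sup>+t. ennreal (exp (- ((norm z)\<^sup>2 * t))) \<partial>\<nu>)" if "z \<noteq> 0" for z
    unfolding eq[OF that] using ae by (intro nn_integral_cong_AE) (auto simp: indicator_def elim!: eventually_mono)
  have int: "integrable \<nu> (\<lambda>t. exp (- ((norm z)\<^sup>2 * t)))" if "z \<noteq> 0" for z :: "real^'n"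
  proof (rule integrableI_nonneg)
    show "(\<integral>\<^sup>+t. ennreal (exp (- ((norm z)\<^sup>2 * t))) \<partial>\<nu>) < \<infinity>" using fin[OF that] g[OF that] by simp
    show "(\<lambda>t. exp (- ((norm z)\<^sup>2 * t))) \<in> borel_measurable \<nu>" by measurable
  qed simp
  have "integrable \<nu> (\<lambda>t. exp (- (s * t)))" if s: "s > 0" for s
  proof -
    obtain z :: "real^'n" where "z \<noteq> 0" "(norm z)\<^sup>2 = s" using exists_norm_square[OF s] .
    then show ?thesis using int[of z] by simp
  qed
  then show "laplace_finite \<nu>" using sets ae by (simp add: laplace_finite_def)
  show "g z = ennreal (laplace \<nu> ((norm z)\<^sup>2))" if "z \<noteq> 0"
    unfolding g[OF that] laplace_def by (rule nn_integral_eq_integral[OF int[OF that]]) simp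
qed

text \<open>In \<open>ennreal\<close> every sum exists, so finiteness of its value bounds the finite
  partial sums; a real \<open>infsum\<close> would give the default 0 and show nothing.\<close>

lemma summable_on_of_ennreal:
  fixes f :: "'i \<Rightarrow> real"
  assumes fin: "(\<Sum>\<^sub>\<infinity>i\<in>I. ennreal (f i)) < \<infinity>" and nn: "\<And>i. i \<in> I \<Longrightarrow> f i \<ge> 0"
  shows "f summable_on I"
proof (rule nonneg_bdd_above_summable_on[OF nn], simp, rule bdd_aboveI2)
  fix F assume "F \<in> {F. F \<subseteq> I \<and> finite F}"
  then have F: "F \<subseteq> I" "finite F" by auto
  have "ennreal (sum f F) = (\<Sum>i\<in>F. ennreal (f i))"
    using F nn by (subst sum_ennreal) auto
  also have "\<dots> \<le> (\<Sum>\<^sub>\<infinity>i\<in>I. ennreal (f i))"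
    using F by (subst nonneg_infsum_complete) (auto intro!: SUP_upper)
  finally show "sum f F \<le> enn2real (\<Sum>\<^sub>\<infinity>i\<in>I. ennreal (f i))"
    using fin nn F by (subst (asm) ennreal_enn2real[symmetric])
      (auto simp: ennreal_le_iff enn2real_nonneg simp del: ennreal_enn2real)
qed

theorem theorem4p3:
  fixes V :: "real^'n^'n"
    and f :: "real^'n \<Rightarrow> ereal" and fstar :: "real \<Rightarrow> real" and \<mu> :: signed_measure
    and g :: "real \<Rightarrow> real^'n \<Rightarrow> ennreal" and \<mu>g :: "real \<Rightarrow> real measure"
    and N :: nat and x :: "nat \<Rightarrow> real^'n"
  assumes V_indep: "inj (\<lambda>i. column i V)" "independent (columns V)"
    and V_det: "det V = 1"
    and f: "weak_G_type V f fstar \<mu>"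
    and \<mu>g: "\<And>a. a > 0 \<Longrightarrow> measure_on_pos (\<mu>g a)"
    and g_finite: "\<And>a z. a > 0 \<Longrightarrow> z \<noteq> 0 \<Longrightarrow> g a z < \<infinity>"
    and g_eq: "\<And>a z. a > 0 \<Longrightarrow> z \<noteq> 0 \<Longrightarrow>
      g a z = (\<integral>\<^sup>+t\<in>{0<..}. ennreal (exp (- (norm z)\<^sup>2 * t)) \<partial>\<mu>g a)"
    and g_lim: "\<And>z. z \<noteq> 0 \<Longrightarrow> ((\<lambda>a. g a z) \<longlongrightarrow> 1) (at_right 0)"
    and g_sum: "\<And>a u. a > 0 \<Longrightarrow> u \<notin> lattice_of V \<Longrightarrow> (\<Sum>\<^sub>\<infinity>v\<in>lattice_of V. g a (u + v)) < \<infinity>"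
    and nondegenerate: "\<And>i j. i \<in> {1..N} \<Longrightarrow> j \<in> {1..N} \<Longrightarrow> i \<noteq> j \<Longrightarrow> x i - x j \<notin> lattice_of V"
  shows "(\<forall>k\<in>{1..N}. \<forall>j\<in>{1..N}. k \<noteq> j \<longrightarrow>
            (\<forall>\<alpha>\<in>{0<..<1}. \<exists>l::real.
               ((\<lambda>a. K2_pre V \<mu> fstar g \<mu>g (x k) (x j) \<alpha> a) \<longlongrightarrow> l) (at_right 0)) \<and>
            (\<exists>l::real. (K2_inner V \<mu> fstar g \<mu>g (x k) (x j) \<longlongrightarrow> ereal l) (at_right 0))) \<and>
         (\<exists>e::real. E2_per V \<mu> fstar g \<mu>g N x = ereal e \<and>
            complex_of_real e = (\<Sum>k\<in>{1..N}. \<Sum>j\<in>{1..N} - {k}. K_per V \<mu> (x k) (x j)))"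
proof -
  note parts = weak_G_type_kernel_part[OF f]
  have \<nu>: "laplace_finite (\<mu>g a)" if "a > 0" for a
    by (rule laplace_transform_ennreal(1)[OF \<mu>g g_finite g_eq]) (use that in auto)
  have g: "g a z = ennreal (laplace (\<mu>g a) ((norm z)\<^sup>2))" if "a > 0" "z \<noteq> 0" for a z
    by (rule laplace_transform_ennreal(2)[OF \<mu>g g_finite g_eq]) (use that in auto)
  have lim: "((\<lambda>a. laplace (\<mu>g a) s) \<longlongrightarrow> 1) (at_right 0)" if s: "s > 0" for s
  proof -
    obtain z :: "real^'n" where z: "z \<noteq> 0" "(norm z)\<^sup>2 = s" using exists_norm_square[OF s] .
    have "((\<lambda>a. enn2real (g a z)) \<longlongrightarrow> 1) (at_right 0)"
      using g_lim[OF z(1)] by (intro tendsto_enn2real) auto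
    then show ?thesis
      by (rule Lim_transform_eventually)
        (use eventually_at_right_less[of "0::real"] in \<open>auto simp: g z laplace_nonneg elim!: eventually_mono\<close>)
  qed
  \<comment> \<open>Guarantees that the sums never meet the origin, where \<open>g a\<close> may be
    infinite and \<open>enn2real\<close> would return a default value.\<close>
  have nz: "u + v \<noteq> 0" if uv: "u \<notin> lattice_of V" "v \<in> lattice_of V" for u v
  proof -
    obtain c where c: "c > 0" "\<And>v. v \<in> lattice_of V \<Longrightarrow> c \<le> (norm (u + v))\<^sup>2"
      using lattice_distance[OF V_det uv(1)] by blast
    show ?thesis using c(1) c(2)[OF uv(2)] by auto
  qed
  have sum: "(\<lambda>v. laplace (\<mu>g a) ((norm (u + v))\<^sup>2)) summable_on lattice_of V"
    if "a > 0" "u \<notin> lattice_of V" for a u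
  proof (rule summable_on_of_ennreal)
    have "(\<Sum>\<^sub>\<infinity>v\<in>lattice_of V. ennreal (laplace (\<mu>g a) ((norm (u + v))\<^sup>2))) = (\<Sum>\<^sub>\<infinity>v\<in>lattice_of V. g a (u + v))"
      by (rule infsum_cong) (use g[OF that(1)] nz[OF that(2)] in auto)
    then show "(\<Sum>\<^sub>\<infinity>v\<in>lattice_of V. ennreal (laplace (\<mu>g a) ((norm (u + v))\<^sup>2))) < \<infinity>"
      using g_sum[OF that] by simp
  qed (rule laplace_nonneg)
  define R where "R \<alpha> P = density P (indicator {\<alpha>..})" for \<alpha> :: real and P :: "real measure"
  \<comment> \<open>\<open>J u \<alpha>\<close> will be the inner limit and \<open>J0 u\<close> the
    outer one.\<close>
  define J where "J u \<alpha> = (\<integral>t. regularized_theta V u t \<partial>R \<alpha> (pos_part \<mu>)) - (\<integral>t. regularized_theta V u t \<partial>R \<alpha> (neg_part \<mu>))"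
    for u \<alpha>
  define J0 where "J0 u = signed_integral \<mu> {0<..} (regularized_theta V u)" for u
  have pre: "((\<lambda>a. K2_pre V \<mu> fstar g \<mu>g y z \<alpha> a) \<longlongrightarrow> J (y - z) \<alpha>) (at_right 0)"
    if yz: "y - z \<notin> lattice_of V" and \<alpha>: "\<alpha> > 0" for y z \<alpha>
  proof -
    define u where "u = y - z"
    have u: "u \<notin> lattice_of V" using yz by (simp add: u_def)
    have us: "ustar V \<notin> lattice_of V" by (rule ustar_not_in_lattice[OF V_det])
    define Mp where "Mp = R \<alpha> (pos_part \<mu>)"
    define Mn where "Mn = R \<alpha> (neg_part \<mu>)"
    have Mp: "laplace_finite Mp" "AE t in Mp. \<alpha> \<le> t" and Mn: "laplace_finite Mn" "AE t in Mn. \<alpha> \<le> t"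
      unfolding Mp_def Mn_def R_def
      using laplace_finite_restrict[OF parts(1) \<alpha>] laplace_finite_restrict[OF parts(2) \<alpha>] by blast+
    let ?k = "\<lambda>t. pi powr (real CARD('n) / 2) / t powr (real CARD('n) / 2)"
    \<comment> \<open>The expression is regrouped into pieces that converge: \<open>A\<close> pairs
      the sum for one part of the measure with its own share of the background, by bilinearity of
      convolution, and \<open>D\<close> collects everything multiplied by
      \<open>fstar \<alpha>\<close>.\<close>
    define A where "A M a = (\<Sum>\<^sub>\<infinity>v\<in>lattice_of V. laplace M ((norm (u + v))\<^sup>2) * laplace (\<mu>g a) ((norm (u + v))\<^sup>2))
      - set_lebesgue_integral (convolution M (\<mu>g a)) {0<..<1} ?k" for M a
    define D where "D a = (\<Sum>\<^sub>\<infinity>v\<in>lattice_of V. laplace (\<mu>g a) ((norm (u + v))\<^sup>2))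
      - (\<Sum>\<^sub>\<infinity>v\<in>lattice_of V. laplace (\<mu>g a) ((norm (ustar V + v))\<^sup>2))" for a
    have Ap: "(A Mp \<longlongrightarrow> (\<integral>t. regularized_theta V u t \<partial>Mp)) (at_right 0)"
      unfolding A_def by (rule tendsto_sum_laplace_minus_convolution[OF V_det Mp(1) \<alpha> Mp(2) u \<nu> lim sum[OF _ u]])
    have An: "(A Mn \<longlongrightarrow> (\<integral>t. regularized_theta V u t \<partial>Mn)) (at_right 0)"
      unfolding A_def by (rule tendsto_sum_laplace_minus_convolution[OF V_det Mn(1) \<alpha> Mn(2) u \<nu> lim sum[OF _ u]])
    have D0: "(D \<longlongrightarrow> 0) (at_right 0)"
      unfolding D_def by (rule tendsto_sum_laplace_diff[OF V_det u us \<nu> lim sum[OF _ u] sum[OF _ us]])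
    have "((\<lambda>a. A Mp a - A Mn a + fstar \<alpha> * D a) \<longlongrightarrow> J u \<alpha>) (at_right 0)"
      using tendsto_add[OF tendsto_diff[OF Ap An] tendsto_mult_left[OF D0, of "fstar \<alpha>"]]
      by (simp add: J_def Mp_def Mn_def)
    moreover have "\<forall>\<^sub>F a in at_right 0. A Mp a - A Mn a + fstar \<alpha> * D a = K2_pre V \<mu> fstar g \<mu>g y z \<alpha> a"
      using eventually_at_right_less[of "0::real"]
    proof eventually_elim
      case (elim a)
      have ft: "f_trunc \<mu> \<alpha> w = laplace Mp ((norm w)\<^sup>2) - laplace Mn ((norm w)\<^sup>2)" for w :: "real^'n"
      proof -
        have "set_lebesgue_integral M {0<..} (\<lambda>t. exp (- (norm w)\<^sup>2 * t)) = laplace M ((norm w)\<^sup>2)"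
          if M: "laplace_finite M" for M
        proof -
          note [measurable_cong] = laplace_finiteD(1)[OF M]
          show ?thesis
            unfolding laplace_def set_lebesgue_integral_def using laplace_finiteD(2)[OF M]
            by (intro integral_cong_AE) (auto simp: indicator_def elim!: eventually_mono)
        qed
        then show ?thesis
          using Mp(1) Mn(1)
          by (simp add: f_trunc_def signed_integral_def restrict_from_def Mp_def Mn_def R_def)
      qed
      have e: "enn2real (g a (w + v)) = laplace (\<mu>g a) ((norm (w + v))\<^sup>2)"
        if "w \<notin> lattice_of V" "v \<in> lattice_of V" for w v
        using g[OF elim nz[OF that]] by (simp add: laplace_nonneg)
      note hp = has_sum_infsum[OF sum_laplace_minus_convolution(1)[OF V_det Mp(1) \<nu>[OF elim] \<alpha> Mp(2) u sum[OF elim u]]]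
      note hn = has_sum_infsum[OF sum_laplace_minus_convolution(1)[OF V_det Mn(1) \<nu>[OF elim] \<alpha> Mn(2) u sum[OF elim u]]]
      note hf = has_sum_cmult_right[OF has_sum_infsum[OF sum[OF elim u]], of "fstar \<alpha>"]
      have "(\<Sum>\<^sub>\<infinity>v\<in>lattice_of V. (f_trunc \<mu> \<alpha> (u + v) + fstar \<alpha>) * enn2real (g a (u + v)))
        = (\<Sum>\<^sub>\<infinity>v\<in>lattice_of V. laplace Mp ((norm (u + v))\<^sup>2) * laplace (\<mu>g a) ((norm (u + v))\<^sup>2)
            - laplace Mn ((norm (u + v))\<^sup>2) * laplace (\<mu>g a) ((norm (u + v))\<^sup>2)
            + fstar \<alpha> * laplace (\<mu>g a) ((norm (u + v))\<^sup>2))"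
        by (rule infsum_cong) (simp add: e u ft left_diff_distrib distrib_right)
      also note infsumI[OF has_sum_add[OF has_sum_diff[OF hp hn] hf]]
      finally have 1: "(\<Sum>\<^sub>\<infinity>v\<in>lattice_of V. (f_trunc \<mu> \<alpha> (u + v) + fstar \<alpha>) * enn2real (g a (u + v)))
        = (\<Sum>\<^sub>\<infinity>v\<in>lattice_of V. laplace Mp ((norm (u + v))\<^sup>2) * laplace (\<mu>g a) ((norm (u + v))\<^sup>2))
          - (\<Sum>\<^sub>\<infinity>v\<in>lattice_of V. laplace Mn ((norm (u + v))\<^sup>2) * laplace (\<mu>g a) ((norm (u + v))\<^sup>2))
          + fstar \<alpha> * (\<Sum>\<^sub>\<infinity>v\<in>lattice_of V. laplace (\<mu>g a) ((norm (u + v))\<^sup>2))" .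
      have 2: "(\<Sum>\<^sub>\<infinity>v\<in>lattice_of V. enn2real (g a (ustar V + v)))
        = (\<Sum>\<^sub>\<infinity>v\<in>lattice_of V. laplace (\<mu>g a) ((norm (ustar V + v))\<^sup>2))"
        by (rule infsum_cong) (simp add: e us)
      have 3: "signed_integral (signed_convolution (restrict_from \<alpha> \<mu>) (\<mu>g a)) {0<..<1} ?k
        = set_lebesgue_integral (convolution Mp (\<mu>g a)) {0<..<1} ?k
          - set_lebesgue_integral (convolution Mn (\<mu>g a)) {0<..<1} ?k"
        by (simp add: signed_integral_def signed_convolution_def restrict_from_def Mp_def Mn_def R_def)
      show ?case
        unfolding K2_pre_def u_def[symmetric] 1 2 3 A_def D_def by (simp add: right_diff_distrib)
    qed
    ultimately show ?thesis unfolding u_def by (rule Lim_transform_eventually)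
  qed
  \<comment> \<open>An existing limit along a nontrivial filter is the upper limit, so the outer
    limit concerns the real function \<open>J (y - z)\<close> alone.\<close>
  have inner: "K2_inner V \<mu> fstar g \<mu>g y z \<alpha> = ereal (J (y - z) \<alpha>)"
    if "y - z \<notin> lattice_of V" "\<alpha> > 0" for y z \<alpha>
    unfolding K2_inner_def using pre[OF that]
    by (intro lim_imp_Limsup) (auto simp: trivial_limit_at_right_real)
  have outer: "(K2_inner V \<mu> fstar g \<mu>g y z \<longlongrightarrow> ereal (J0 (y - z))) (at_right 0)"
    if yz: "y - z \<notin> lattice_of V" for y z
  proof -
    have "(J (y - z) \<longlongrightarrow> J0 (y - z)) (at_right 0)"
      unfolding J_def J0_def R_def signed_integral_def
      by (intro tendsto_diff tendsto_restricted_integral[OF V_det parts(1) yz] tendsto_restricted_integral[OF V_det parts(2) yz])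
    then have "((\<lambda>\<alpha>. ereal (J (y - z) \<alpha>)) \<longlongrightarrow> ereal (J0 (y - z))) (at_right 0)" by simp
    then show ?thesis
      by (rule Lim_transform_eventually)
        (use eventually_at_right_less[of "0::real"] in \<open>auto simp: inner[OF yz] elim!: eventually_mono\<close>)
  qed
  have K2: "K2_per V \<mu> fstar g \<mu>g y z = ereal (J0 (y - z))" if "y - z \<notin> lattice_of V" for y z
    unfolding K2_per_def by (rule lim_imp_Limsup[OF _ outer[OF that]]) simp
  have nd: "x k - x j \<notin> lattice_of V" if "k \<in> {1..N}" "j \<in> {1..N} - {k}" for k j
    using nondegenerate[of k j] that by auto
  show ?thesis
  proof (intro conjI ballI impI)
    fix k j :: nat and \<alpha> :: real
    assume kj: "k \<in> {1..N}" "j \<in> {1..N}" "k \<noteq> j"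
    show "\<exists>l::real. ((\<lambda>a. K2_pre V \<mu> fstar g \<mu>g (x k) (x j) \<alpha> a) \<longlongrightarrow> l) (at_right 0)" if "\<alpha> \<in> {0<..<1}"
      using pre[OF nondegenerate[OF kj], of \<alpha>] that by auto
    show "\<exists>l::real. (K2_inner V \<mu> fstar g \<mu>g (x k) (x j) \<longlongrightarrow> ereal l) (at_right 0)"
      using outer[OF nondegenerate[OF kj]] by blast
  next
    define e where "e = (\<Sum>k\<in>{1..N}. \<Sum>j\<in>{1..N} - {k}. J0 (x k - x j))"
    have "E2_per V \<mu> fstar g \<mu>g N x = (\<Sum>k\<in>{1..N}. \<Sum>j\<in>{1..N} - {k}. ereal (J0 (x k - x j)))"
      unfolding E2_per_def by (intro sum.cong refl K2 nd) auto
    then have "E2_per V \<mu> fstar g \<mu>g N x = ereal e"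
      by (simp add: e_def)
    moreover have "(\<Sum>k\<in>{1..N}. \<Sum>j\<in>{1..N} - {k}. K_per V \<mu> (x k) (x j))
        = (\<Sum>k\<in>{1..N}. \<Sum>j\<in>{1..N} - {k}. complex_of_real (J0 (x k - x j)))"
      unfolding J0_def by (intro sum.cong refl K_per_eq[OF V_det parts] nd) auto
    ultimately show "\<exists>e::real. E2_per V \<mu> fstar g \<mu>g N x = ereal e \<and>
            complex_of_real e = (\<Sum>k\<in>{1..N}. \<Sum>j\<in>{1..N} - {k}. K_per V \<mu> (x k) (x j))"
      by (auto simp: e_def)
  qed
qed

end
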